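(* Let $\phi(z)=Az+p(z)$ be a self-map of $\mathbb{H}$ of non-zero-step type, let $z_0\in\mathbb{H}$, $z_n=\phi_n(z_0)=x_n+iy_n$, and let $(g,\alpha)$, $\alpha(z)=Az+b$, be the classical semiconjugation of $\phi$ based at $z_0$. If $A=1$, assume moreover that $\lim_{n\to\infty}x_n=+\infty$ (so that $b>0$). Let $\beta(z)=z-\frac{b}{A-1}$ if $A>1$, and $\beta(z)=|b|z$ if $A=1$. Let $(\sigma,\tau)\in\mathcal{F}(\phi)$, where $\tau$ is not elliptic, and let $\tilde\beta\in\operatorname{Aut}(\mathbb{H})$ be such that $\tilde\beta^{-1}\circ\tau\circ\tilde\beta$ is in standard form. Then the following are equivalent: (a) If $A>1$: $\tilde\beta^{-1}\circ\tau\circ\tilde\beta(z)=Az$, and there is $c>0$ such that $\sigma=\tilde\beta\circ(c\,\beta^{-1})\circ g$, i.e. $\sigma(z)=\tilde\beta\big(c\,\beta^{-1}(g(z))\big)$ for all $z\in\mathbb{H}$. If $A=1$: $\tilde\beta^{-1}\circ\tau\circ\tilde\beta(z)=z+1$, and there is $d\in\mathbb{R}$ such that $\sigma=\tilde\beta(\beta^{-1}\circ g+d)$. (b) $\sigma$ is canonical. (c) The function $f=\tilde\beta^{-1}\circ\sigma$ has the following univalence and covering properties: there are sequences $\rho_k\uparrow+\infty$ of positive reals and $M_k\uparrow+\infty$ of positive integers such that $f$ is univalent on $$U=\bigcup_{k=1}^{\infty}\bigcup_{n\ge M_k}\big(x_n+y_n\Delta(i,\rho_k)\big),$$ and, if $A>1$,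 both $U$ and $f(U)$ have an inner-tangent at infinity, while, if $A=1$, $f(U)$ has a lateral-tangent at $+\infty$ with respect to $\mathbb{H}$. (d) There exist $z,w\in\mathbb{H}$ such that $\rho_{\mathbb{H}}(\sigma(z),\sigma(w))=\rho_{\mathbb{H}}(g(z),g(w))\neq 0$.
   Context: $\mathbb{H}=\{z\in\mathbb{C}:\operatorname{Im}z>0\}$; $\rho_{\mathbb{H}}$ is the hyperbolic distance; $\Delta(i,\rho)=\{z\in\mathbb{H}:\rho_{\mathbb{H}}(z,i)<\rho\}$; $\phi_n$ is the $n$-th iterate of $\phi$; n.t.-lim as $z\to\infty$ means the limit as $z\to\infty$ inside each sector $\{|\operatorname{Arg}z-\pi/2|<\theta\}$, $0<\theta<\pi/2$. Here a self-map of $\mathbb{H}$ is an analytic map $\phi:\mathbb{H}\to\mathbb{H}$ that is not an automorphism. We consider $\phi(z)=Az+p(z)$ with $A\ge 1$, $\operatorname{Im}p>0$ on $\mathbb{H}$ and n.t.-$\lim_{z\to\infty}p(z)/z=0$. It is hyperbolic if $A>1$ and parabolic if $A=1$. For $z\in\mathbb{H}$ the sequence $\rho_{\mathbb{H}}(\phi_n(z),\phi_{n+1}(z))$ decreases to a limit $s_\infty(z)\ge0$; for parabolic $\phi$, $s_\infty$ vanishes either everywhere (zero-step) or nowhere (non-zero-step). $\phi$ is of non-zero-step type if it is hyperbolic or parabolic non-zero-step. Classical semiconjugation based at $z_0$ (for $\phi$ of non-zero-step type): let $z_n=\phi_n(z_0)=x_n+iy_n$ and $\gamma_n(z)=(z-x_n)/y_n$.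 By a theorem of Pommerenke, $g=\lim_n\gamma_n\circ\phi_n$ exists locally uniformly in $\mathbb{H}$, is an analytic map $\mathbb{H}\to\mathbb{H}$ with $g(z_0)=i$, the maps $\gamma_n\circ\gamma_{n+1}^{-1}$ converge to $\alpha(z)=Az+b$ with $b=\lim_n(x_{n+1}-x_n)/y_n\in\mathbb{R}$, and $g\circ\phi=\alpha\circ g$; if $A=1$ then $b\neq0$ and $x_n\to+\infty$ or $x_n\to-\infty$. $\mathcal{F}(\phi)$ is the set of pairs $(\sigma,\tau)$ with $\sigma:\mathbb{H}\to\mathbb{H}$ analytic and non-constant, $\tau\in\operatorname{Aut}(\mathbb{H})$, and $\sigma\circ\phi=\tau\circ\sigma$. An automorphism of $\mathbb{H}$ is elliptic if it has a fixed point in $\mathbb{H}$ (the identity is included). The standard form of a non-elliptic automorphism is $z\mapsto Tz$ with $T>1$ (hyperbolic case) or $z\mapsto z+1$ or $z\mapsto z-1$ (parabolic case). Two points $z,w$ are in the same grand orbit of a map $\psi$ if $\psi_n(z)=\psi_k(w)$ for some integers $n,k\ge0$; grand orbits are the equivalence classes and $\mathcal{G}(\psi)$ is the set of grand orbits. If $\sigma\circ\phi=\tau\circ\sigma$, then $\sigma$ induces a map $\Sigma:\mathcal{G}(\phi)\to\mathcal{G}(\tau)$; $\sigma$ is called canonical if $\Sigma$ is a bijection. A set $\Omega\subset\mathbb{H}$ has an inner-tangent at infinity if for every $\delta_n\downarrow0$ there is $R_n\uparrow\infty$ with $\{|z|>R_n,\ \delta_n<\operatorname{Arg}z<\pi-\delta_n\}\subset\Omega$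 for all $n$. A set $V\subset\mathbb{H}$ has a lateral-tangent at $+\infty$ with respect to $\mathbb{H}$ if for every $\delta_n\downarrow0$ there is $t_n\uparrow+\infty$ with $\{\operatorname{Re}z>t_n,\ \delta_n<\operatorname{Im}z<1/\delta_n\}\subset V$ for all $n$. *)

theory Defs
  imports "HOL-Complex_Analysis.Complex_Analysis"
begin

text \<open>
  Maps on the upper half-plane are represented by total functions on \<^typ>\<open>complex\<close>, of which only
  the restriction to \<open>uhp\<close> matters.
\<close>

definition uhp :: "complex set" where
  "uhp = {z. Im z > 0}"

text \<open>The hyperbolic distance of curvature $-1$, i.e. the density is $|dz| / \mathrm{Im}\, z$.\<close>

definition hyp_dist :: "complex \<Rightarrow> complex \<Rightarrow> real" where
  "hyp_dist z w = 2 * artanh (cmod (z - w) / cmod (z - cnj w))"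

definition hyp_disc :: "complex \<Rightarrow> real \<Rightarrow> complex set" where
  "hyp_disc c \<rho> = {z \<in> uhp. hyp_dist z c < \<rho>}"

definition uhp_aut :: "(complex \<Rightarrow> complex) set" where
  "uhp_aut = {\<tau>. \<tau> holomorphic_on uhp \<and> bij_betw \<tau> uhp uhp}"

definition self_map :: "(complex \<Rightarrow> complex) \<Rightarrow> bool" where
  "self_map \<phi> \<longleftrightarrow> \<phi> holomorphic_on uhp \<and> \<phi> ` uhp \<subseteq> uhp \<and> \<phi> \<notin> uhp_aut"

definition elliptic :: "(complex \<Rightarrow> complex) \<Rightarrow> bool" where
  "elliptic \<tau> \<longleftrightarrow> \<tau> \<in> uhp_aut \<and> (\<exists>z\<in>uhp. \<tau> z = z)"

definition standard_form :: "(complex \<Rightarrow> complex) \<Rightarrow> bool" where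
  "standard_form \<tau> \<longleftrightarrow>
     (\<exists>T::real. T > 1 \<and> (\<forall>z\<in>uhp. \<tau> z = of_real T * z)) \<or>
     (\<forall>z\<in>uhp. \<tau> z = z + 1) \<or>
     (\<forall>z\<in>uhp. \<tau> z = z - 1)"

definition nt_lim_infinity :: "(complex \<Rightarrow> complex) \<Rightarrow> complex \<Rightarrow> bool" where
  "nt_lim_infinity f l \<longleftrightarrow>
     (\<forall>\<theta>. 0 < \<theta> \<and> \<theta> < pi/2 \<longrightarrow>
        (f \<longlongrightarrow> l) (inf at_infinity (principal {z. \<bar>Arg z - pi/2\<bar> < \<theta>})))"

definition step_limit :: "(complex \<Rightarrow> complex) \<Rightarrow> complex \<Rightarrow> real" where
  "step_limit \<phi> z = lim (\<lambda>n. hyp_dist ((\<phi> ^^ n) z) ((\<phi> ^^ Suc n) z))"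

definition nonzero_step_type :: "real \<Rightarrow> (complex \<Rightarrow> complex) \<Rightarrow> bool" where
  "nonzero_step_type A \<phi> \<longleftrightarrow> A > 1 \<or> (A = 1 \<and> (\<forall>z\<in>uhp. step_limit \<phi> z \<noteq> 0))"

text \<open>\<open>renorm \<zeta>\<close> is the real affine map sending \<open>\<zeta>\<close> to \<open>\<i>\<close>; thus $\gamma_n$ is \<open>renorm\<close> at $z_n$.\<close>

definition renorm :: "complex \<Rightarrow> complex \<Rightarrow> complex" where
  "renorm \<zeta> z = (z - of_real (Re \<zeta>)) / of_real (Im \<zeta>)"

text \<open>
  The pair $(g, \alpha)$ is determined on \<open>uhp\<close> by the two limits.  That \<open>g\<close> is an analytic map of
  \<open>uhp\<close> into itself with $g(z_0) = i$ and $g \circ \phi = \alpha \circ g$ is a consequence and is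
  therefore not part of the definition.
\<close>

definition classical_semiconjugation ::
  "(complex \<Rightarrow> complex) \<Rightarrow> complex \<Rightarrow> (complex \<Rightarrow> complex) \<Rightarrow> (complex \<Rightarrow> complex) \<Rightarrow> bool" where
  "classical_semiconjugation \<phi> z0 g \<alpha> \<longleftrightarrow>
     (\<forall>K. compact K \<and> K \<subseteq> uhp \<longrightarrow>
        uniform_limit K (\<lambda>n z. renorm ((\<phi> ^^ n) z0) ((\<phi> ^^ n) z)) g sequentially) \<and>
     (\<forall>z\<in>uhp. (\<lambda>n. renorm ((\<phi> ^^ n) z0) (inv (renorm ((\<phi> ^^ Suc n) z0)) z))
        \<longlonglongrightarrow> \<alpha> z)"

definition semiconjugations ::
  "(complex \<Rightarrow> complex) \<Rightarrow> ((complex \<Rightarrow> complex) \<times> (complex \<Rightarrow> complex)) set" where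
  "semiconjugations \<phi> =
     {(\<sigma>, \<tau>). \<sigma> holomorphic_on uhp \<and> \<sigma> ` uhp \<subseteq> uhp \<and> \<not> \<sigma> constant_on uhp \<and>
        \<tau> \<in> uhp_aut \<and> (\<forall>z\<in>uhp. \<sigma> (\<phi> z) = \<tau> (\<sigma> z))}"

definition same_grand_orbit :: "(complex \<Rightarrow> complex) \<Rightarrow> (complex \<times> complex) set" where
  "same_grand_orbit \<psi> =
     {(z, w). z \<in> uhp \<and> w \<in> uhp \<and> (\<exists>n k. (\<psi> ^^ n) z = (\<psi> ^^ k) w)}"

definition grand_orbits :: "(complex \<Rightarrow> complex) \<Rightarrow> complex set set" where
  "grand_orbits \<psi> = uhp // same_grand_orbit \<psi>"

text \<open>
  If $\sigma \circ \phi = \tau \circ \sigma$, then \<open>\<sigma>\<close> maps a grand orbit \<open>C\<close> of \<open>\<phi>\<close> into a single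
  grand orbit of \<open>\<tau>\<close>, which is the value of the induced map at \<open>C\<close>.
\<close>

definition induced_map ::
  "(complex \<Rightarrow> complex) \<Rightarrow> (complex \<Rightarrow> complex) \<Rightarrow> complex set \<Rightarrow> complex set" where
  "induced_map \<sigma> \<tau> C = same_grand_orbit \<tau> `` (\<sigma> ` C)"

definition canonical ::
  "(complex \<Rightarrow> complex) \<Rightarrow> (complex \<Rightarrow> complex) \<Rightarrow> (complex \<Rightarrow> complex) \<Rightarrow> bool" where
  "canonical \<phi> \<sigma> \<tau> \<longleftrightarrow> bij_betw (induced_map \<sigma> \<tau>) (grand_orbits \<phi>) (grand_orbits \<tau>)"

text \<open>
  Arrows $\uparrow$ and $\downarrow$ denote monotone, not necessarily strictly monotone, convergence;
  the $\delta_n$ are positive.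
\<close>

definition inner_tangent_infinity :: "complex set \<Rightarrow> bool" where
  "inner_tangent_infinity \<Omega> \<longleftrightarrow>
     (\<forall>\<delta>::nat \<Rightarrow> real. (\<forall>n. \<delta> n > 0) \<and> decseq \<delta> \<and> \<delta> \<longlonglongrightarrow> 0 \<longrightarrow>
        (\<exists>R::nat \<Rightarrow> real. incseq R \<and> filterlim R at_top sequentially \<and>
           (\<forall>n. {z. cmod z > R n \<and> \<delta> n < Arg z \<and> Arg z < pi - \<delta> n} \<subseteq> \<Omega>)))"

definition lateral_tangent_plus_infinity :: "complex set \<Rightarrow> bool" where
  "lateral_tangent_plus_infinity V \<longleftrightarrow>
     (\<forall>\<delta>::nat \<Rightarrow> real. (\<forall>n. \<delta> n > 0) \<and> decseq \<delta> \<and> \<delta> \<longlonglongrightarrow> 0 \<longrightarrow>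
        (\<exists>t::nat \<Rightarrow> real. incseq t \<and> filterlim t at_top sequentially \<and>
           (\<forall>n. {z. Re z > t n \<and> \<delta> n < Im z \<and> Im z < 1 / \<delta> n} \<subseteq> V)))"

definition univalent_on :: "(complex \<Rightarrow> complex) \<Rightarrow> complex set \<Rightarrow> bool" where
  "univalent_on f U \<longleftrightarrow> f holomorphic_on U \<and> inj_on f U"

definition orbit_neighbourhood ::
  "(complex \<Rightarrow> complex) \<Rightarrow> complex \<Rightarrow> (nat \<Rightarrow> real) \<Rightarrow> (nat \<Rightarrow> nat) \<Rightarrow> complex set" where
  "orbit_neighbourhood \<phi> z0 \<rho> M =
     (\<Union>k. \<Union>n\<in>{M k..}.
        (\<lambda>z. of_real (Re ((\<phi> ^^ n) z0)) + of_real (Im ((\<phi> ^^ n) z0)) * z) ` hyp_disc \<i> (\<rho> k))"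

definition standard_beta :: "real \<Rightarrow> real \<Rightarrow> complex \<Rightarrow> complex" where
  "standard_beta A b z =
     (if A > 1 then z - of_real (b / (A - 1)) else of_real \<bar>b\<bar> * z)"

end

theory Submission
  imports Defs
begin

text \<open>
  Write $f = \tilde\beta^{-1} \circ \sigma$ and \<open>T\<close> for the standard form of \<open>\<tau>\<close>. The maps
  $T^{-n} \circ f \circ \gamma_n^{-1}$ send \<open>\<i>\<close> to $f(z_0)$, so they form a normal family; as
  $f = (T^{-n} \circ f \circ \gamma_n^{-1}) \circ (\gamma_n \circ \phi_n)$, every limit \<open>h\<close> satisfies
  $f = h \circ g$ and $h \circ \alpha = T \circ h$. Applied to \<open>g\<close> itself this gives
  $\alpha^{-n} \circ g \circ \gamma_n^{-1} \to \mathrm{id}$ locally uniformly, hence univalence of \<open>g\<close> near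
  $z_n$ and the absorbing property of $g(\mathbb{H})$. Each of (b), (c) and (d) forces \<open>h\<close> to be an
  automorphism: (d) by the equality case of the Schwarz--Pick lemma, (b) and (c) by showing that \<open>h\<close> is
  bijective, where for (c) a standard form of the wrong type is excluded by comparing displacements.
  Finally, since an automorphism preserves displacements, one that semiconjugates \<open>\<alpha>\<close> to a standard
  form is real affine; this is (a), and it implies the other three.
\<close>

subsection \<open>Hyperbolic distance on the half-plane\<close>

text \<open>Since f = h \<circ> g determines h only on g(H), identities for h are proved on that
  open set and extended by the identity theorem. Closeness of the renormalised g to the identity, on
  a hyperbolic ball of any fixed radius about z_n, yields injectivity by Cauchy's estimate and
  coverings by Brouwer's theorem.

  Bijectivity of h is reached by pushing forward: \<alpha>^n carries given points of H into the
  image under g of a ball about z_n, where information on f can be used; since h \<circ> \<alpha> =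
  T \<circ> h and both \<alpha> and T are invertible, the conclusion is pulled back afterwards.

  The tangency conditions in (c) do not name the type of T. The types are told apart because a
  scaling moves every point by at least a fixed hyperbolic amount, a translation moves high points
  arbitrarily little, and holomorphic self-maps of H never increase hyperbolic distances.\<close>

lemma open_uhp: "open uhp"
  unfolding uhp_def by (rule open_halfspace_Im_gt)

lemma convex_uhp: "convex uhp"
  unfolding uhp_def by (rule convex_halfspace_Im_gt)

lemma connected_uhp: "connected uhp"
  using convex_uhp convex_connected by blast

lemma i_in_uhp [simp]: "\<i> \<in> uhp"
  by (simp add: uhp_def)

lemma uhp_not_cnj: "z \<in> uhp \<Longrightarrow> w \<in> uhp \<Longrightarrow> z \<noteq> cnj w"
  by (auto simp: uhp_def complex_eq_iff)

text \<open>In terms of the hyperbolic distance d this is 4 sinh^2(d/2): a rational expression that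
  orders pairs as d does, so that estimates and equality cases avoid artanh.\<close>

definition hyp_ratio :: "complex \<Rightarrow> complex \<Rightarrow> real" where
  "hyp_ratio z w = (cmod (z - w))\<^sup>2 / (Im z * Im w)"

lemma hyp_ratio_commute: "hyp_ratio z w = hyp_ratio w z"
  by (simp add: hyp_ratio_def norm_minus_commute mult.commute)

lemma hyp_ratio_nonneg: "z \<in> uhp \<Longrightarrow> w \<in> uhp \<Longrightarrow> hyp_ratio z w \<ge> 0"
  by (simp add: hyp_ratio_def uhp_def)

lemma hyp_ratio_eq_0_iff: "z \<in> uhp \<Longrightarrow> w \<in> uhp \<Longrightarrow> hyp_ratio z w = 0 \<longleftrightarrow> z = w"
  by (auto simp: hyp_ratio_def uhp_def)

lemma cmod_diff_cnj_square: "(cmod (z - cnj w))\<^sup>2 = (cmod (z - w))\<^sup>2 + 4 * (Im z * Im w)"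
  unfolding cmod_power2 by (simp add: power2_eq_square algebra_simps)

text \<open>The squared pseudo-hyperbolic distance is x / (x + 4), an increasing function of the
  \<open>hyp_ratio\<close> x.\<close>

lemma hyp_ratio_le_iff_cmod:
  assumes "z \<in> uhp" "w \<in> uhp" "z' \<in> uhp" "w' \<in> uhp"
  shows "hyp_ratio z w \<le> hyp_ratio z' w' \<longleftrightarrow>
    cmod ((z - w) / (z - cnj w)) \<le> cmod ((z' - w') / (z' - cnj w'))" (is "_ \<longleftrightarrow> ?t \<le> ?t'")
proof -
  have key: "x \<le> y \<longleftrightarrow> x / (x + 4) \<le> y / (y + 4)" if "x \<ge> 0" "y \<ge> 0" for x y :: real
    using that by (simp add: field_simps)
  have sq: "(cmod ((a - b) / (a - cnj b)))\<^sup>2 = hyp_ratio a b / (hyp_ratio a b + 4)"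
    if "a \<in> uhp" "b \<in> uhp" for a b
  proof -
    have "Im a > 0" "Im b > 0" using that by (auto simp: uhp_def)
    then have p: "Im a * Im b > 0" by simp
    have "n / (n + 4 * q) = n / q / (n / q + 4)" if "q > 0" for n q :: real
      using that by (simp add: divide_simps)
    from this[OF p] show ?thesis
      unfolding norm_divide power_divide cmod_diff_cnj_square hyp_ratio_def .
  qed
  have "hyp_ratio z w \<le> hyp_ratio z' w' \<longleftrightarrow> ?t\<^sup>2 \<le> ?t'\<^sup>2"
    unfolding sq[OF assms(1,2)] sq[OF assms(3,4)]
    by (rule key) (use assms hyp_ratio_nonneg in auto)
  also have "\<dots> \<longleftrightarrow> ?t \<le> ?t'"
    by (simp add: abs_le_square_iff[symmetric])
  finally show ?thesis .
qed

text \<open>Because 4p = (D - d)(D + d), both sides are the logarithm of (D + d) / (D - d).\<close>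

lemma hyp_dist_eq_arsinh:
  assumes "z \<in> uhp" "w \<in> uhp"
  shows "hyp_dist z w = 2 * arsinh (sqrt (hyp_ratio z w) / 2)"
proof -
  define d D p where "d = cmod (z - w)" and "D = cmod (z - cnj w)" and "p = Im z * Im w"
  have p: "p > 0" using assms by (auto simp: p_def uhp_def)
  have D: "D\<^sup>2 = d\<^sup>2 + 4 * p" unfolding D_def d_def p_def by (rule cmod_diff_cnj_square)
  have d0: "d \<ge> 0" "D \<ge> 0" by (auto simp: d_def D_def)
  have dD: "d < D" by (rule power_less_imp_less_base[of _ 2]) (use D p d0 in auto)
  have x: "sqrt (hyp_ratio z w) / 2 = d / (2 * sqrt p)"
    unfolding hyp_ratio_def using d0 by (simp add: d_def p_def real_sqrt_divide)
  have "(d / (2 * sqrt p))\<^sup>2 + 1 = (D / (2 * sqrt p))\<^sup>2"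
    using p by (simp add: power_divide power_mult_distrib D field_simps)
  then have "sqrt ((d / (2 * sqrt p))\<^sup>2 + 1) = D / (2 * sqrt p)"
    using d0 p by simp
  then have e: "arsinh (d / (2 * sqrt p)) = ln ((d + D) / (2 * sqrt p))"
    by (simp add: arsinh_real_def add_divide_distrib)
  have "((d + D) / (2 * sqrt p))\<^sup>2 = (1 + d / D) / (1 - d / D)"
  proof -
    have "4 * p = (D - d) * (D + d)" using D by (simp add: power2_eq_square algebra_simps)
    then have "((d + D) / (2 * sqrt p))\<^sup>2 = (d + D)\<^sup>2 / ((D - d) * (D + d))"
      using p by (simp add: power_divide power_mult_distrib)
    also have "\<dots> = (D + d) / (D - d)" using dD d0 by (simp add: power2_eq_square add.commute)
    also have "\<dots> = (1 + d / D) / (1 - d / D)" using dD d0 by (simp add: field_simps)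
    finally show ?thesis .
  qed
  then have "ln ((1 + d / D) / (1 - d / D)) = 2 * ln ((d + D) / (2 * sqrt p))"
    using dD d0 p by (metis ln_realpow of_nat_numeral)
  then show ?thesis unfolding hyp_dist_def x e artanh_def d_def[symmetric] D_def[symmetric] by simp
qed

lemma hyp_dist_eq_iff:
  assumes "z \<in> uhp" "w \<in> uhp" "z' \<in> uhp" "w' \<in> uhp"
  shows "hyp_dist z w = hyp_dist z' w' \<longleftrightarrow> hyp_ratio z w = hyp_ratio z' w'"
proof -
  have "inj (arsinh :: real \<Rightarrow> real)" using arsinh_real_strict_mono
    by (metis injI less_irrefl linorder_neqE_linordered_idom)
  then show ?thesis
    by (auto simp: hyp_dist_eq_arsinh assms inj_eq)
qed

lemma hyp_dist_eq_0_iff: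
  assumes "z \<in> uhp" "w \<in> uhp"
  shows "hyp_dist z w = 0 \<longleftrightarrow> z = w"
  using hyp_dist_eq_iff[OF assms i_in_uhp i_in_uhp] hyp_ratio_eq_0_iff[OF assms]
  by (simp add: hyp_dist_def hyp_ratio_def)

lemma hyp_dist_less_iff:
  assumes "z \<in> uhp" "w \<in> uhp" "\<rho> > 0"
  shows "hyp_dist z w < \<rho> \<longleftrightarrow> hyp_ratio z w < 4 * (sinh (\<rho> / 2))\<^sup>2"
proof -
  have s: "sinh (\<rho> / 2) > 0" using assms(3) by simp
  have "hyp_dist z w < \<rho> \<longleftrightarrow> arsinh (sqrt (hyp_ratio z w) / 2) < arsinh (sinh (\<rho> / 2))"
    unfolding hyp_dist_eq_arsinh[OF assms(1,2)] arsinh_sinh_real by auto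
  also have "\<dots> \<longleftrightarrow> sqrt (hyp_ratio z w) < 2 * sinh (\<rho> / 2)" by auto
  also have "\<dots> \<longleftrightarrow> hyp_ratio z w < (2 * sinh (\<rho> / 2))\<^sup>2"
    using s by (metis abs_of_pos mult_pos_pos real_sqrt_abs real_sqrt_less_iff zero_less_numeral)
  finally show ?thesis by (simp add: power_mult_distrib)
qed

lemma hyp_ratio_affine:
  assumes "s > 0"
  shows "hyp_ratio (of_real s * z + of_real r) (of_real s * w + of_real r) = hyp_ratio z w"
proof -
  have "of_real s * z + of_real r - (of_real s * w + of_real r) = of_real s * (z - w)"
    by (simp add: algebra_simps)
  then show ?thesis using assms
    by (simp add: hyp_ratio_def norm_mult power_mult_distrib power2_eq_square)
qed

text \<open>Only the vertical displacement counts: t = Im z / Im w satisfies t^2 - (Q + 2) t + 1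
  \<le> 0, which forces t \<le> Q + 2.\<close>

lemma Im_le_of_hyp_ratio:
  assumes "z \<in> uhp" "w \<in> uhp" "hyp_ratio z w \<le> Q"
  shows "Im z \<le> (Q + 2) * Im w"
proof (rule ccontr)
  assume "\<not> ?thesis"
  moreover have pos: "Im z > 0" "Im w > 0" using assms by (auto simp: uhp_def)
  have "\<bar>Im (z - w)\<bar>\<^sup>2 \<le> (cmod (z - w))\<^sup>2"
    by (intro power_mono abs_Im_le_cmod) auto
  then have "(Im z - Im w)\<^sup>2 \<le> Q * (Im z * Im w)"
    using assms(3) pos by (simp add: hyp_ratio_def divide_simps split: if_splits)
  then have "Im z * (Im z - 2 * Im w - Q * Im w) + (Im w)\<^sup>2 \<le> 0"
    by (simp add: power2_eq_square algebra_simps)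
  moreover have "Im z * (Im z - 2 * Im w - Q * Im w) > 0" if "Im z > (Q + 2) * Im w"
    using pos that by (intro mult_pos_pos) (auto simp: algebra_simps)
  ultimately show False
    by (smt (verit) zero_le_power2)
qed

text \<open>Stands in for the triangle inequality, as \<open>hyp_ratio\<close> is not a metric. The
  factor Q + 2 comes from trading Im v for Im w or Im u.\<close>

lemma hyp_ratio_quasi_triangle:
  assumes "u \<in> uhp" "v \<in> uhp" "w \<in> uhp" "hyp_ratio u v \<le> Q" "hyp_ratio v w \<le> Q"
  shows "hyp_ratio u w \<le> 4 * Q * (Q + 2)"
proof -
  have pos: "Im u > 0" "Im v > 0" "Im w > 0" using assms by (auto simp: uhp_def)
  have Q0: "Q \<ge> 0" using hyp_ratio_nonneg assms by (meson order_trans)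
  define a b where "a = cmod (u - v)" and "b = cmod (v - w)"
  have "cmod (u - w) \<le> a + b"
    unfolding a_def b_def using norm_triangle_ineq[of "u - v" "v - w"] by simp
  then have "(cmod (u - w))\<^sup>2 \<le> (a + b)\<^sup>2" by (intro power_mono) auto
  also have "\<dots> \<le> 2 * (a\<^sup>2 + b\<^sup>2)" using sum_squares_bound[of a b] by (simp add: power2_sum)
  also have "\<dots> \<le> 2 * (Q * (Im u * Im v) + Q * (Im v * Im w))"
    using assms(4,5) pos by (simp add: hyp_ratio_def divide_simps a_def b_def split: if_splits)
  also have "\<dots> = 2 * Q * (Im u * Im v + Im w * Im v)" by (simp add: algebra_simps)
  also have "\<dots> \<le> 2 * Q * (Im u * ((Q + 2) * Im w) + Im w * ((Q + 2) * Im u))"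
    using Im_le_of_hyp_ratio[OF assms(2,3,5)] Im_le_of_hyp_ratio[OF assms(2,1)] assms(4) pos Q0
    by (intro mult_left_mono add_mono) (auto simp: hyp_ratio_commute)
  also have "\<dots> = 4 * Q * (Q + 2) * (Im u * Im w)" by (simp add: algebra_simps)
  finally show ?thesis using pos by (simp add: hyp_ratio_def divide_simps)
qed

text \<open>Completing the square in |z - i|^2 \<le> C Im z. A Euclidean ball is compact and convex,
  as the later Cauchy and Brouwer arguments require.\<close>

lemma hyp_ratio_ball_eq:
  assumes "C \<ge> 0"
  shows "{z \<in> uhp. hyp_ratio z \<i> \<le> C} = cball (Complex 0 (1 + C / 2)) (sqrt ((1 + C / 2)\<^sup>2 - 1))"
    (is "?L = cball ?c ?r")
proof -
  have pos: "(1 + C / 2)\<^sup>2 - 1 \<ge> 0" using assms by (simp add: power2_eq_square algebra_simps)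
  have sq: "(cmod (z - ?c))\<^sup>2 - ?r\<^sup>2 = (cmod (z - \<i>))\<^sup>2 - C * Im z" for z
    using pos by (simp add: cmod_power2) (simp add: power2_eq_square algebra_simps)
  have mem: "z \<in> cball ?c ?r \<longleftrightarrow> (cmod (z - \<i>))\<^sup>2 \<le> C * Im z" for z
  proof -
    have "z \<in> cball ?c ?r \<longleftrightarrow> cmod (z - ?c) \<le> ?r" by (simp add: dist_norm norm_minus_commute)
    also have "\<dots> \<longleftrightarrow> (cmod (z - ?c))\<^sup>2 \<le> ?r\<^sup>2"
      using pos by (smt (verit) norm_ge_zero power2_le_imp_le power_mono real_sqrt_ge_zero)
    finally show ?thesis using sq[of z] by linarith
  qed
  have "Im z > 0" if "(cmod (z - \<i>))\<^sup>2 \<le> C * Im z" for z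
  proof (rule ccontr)
    assume *: "\<not> Im z > 0"
    then have "C * Im z \<le> 0" using assms by (simp add: mult_nonneg_nonpos)
    with that have "(cmod (z - \<i>))\<^sup>2 \<le> 0" by linarith
    then have "z = \<i>" by simp
    then show False using * by simp
  qed
  then show ?thesis unfolding set_eq_iff mem
    by (auto simp: hyp_ratio_def uhp_def divide_simps)
qed

lemma compact_hyp_ratio_bounded:
  assumes "compact K" "K \<subseteq> uhp"
  obtains C where "C > 0" "\<And>z. z \<in> K \<Longrightarrow> hyp_ratio z \<i> \<le> C"
proof -
  have "continuous_on K (\<lambda>z. hyp_ratio z \<i>)"
    unfolding hyp_ratio_def using assms(2)
    by (intro continuous_intros) (auto simp: uhp_def)
  then have "bounded ((\<lambda>z. hyp_ratio z \<i>) ` K)"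
    using assms(1) compact_continuous_image compact_imp_bounded by blast
  then obtain C where "C > 0" "\<forall>x\<in>(\<lambda>z. hyp_ratio z \<i>) ` K. norm x \<le> C"
    by (auto simp: bounded_pos)
  then show ?thesis using that by fastforce
qed

subsection \<open>The Schwarz--Pick lemma\<close>

text \<open>The Moebius map from the half-plane to the unit disc that sends \<open>w\<close> to 0;
  its modulus is the pseudo-hyperbolic distance to \<open>w\<close>.\<close>

definition cayley :: "complex \<Rightarrow> complex \<Rightarrow> complex" where
  "cayley w z = (z - w) / (z - cnj w)"

definition cayley_inv :: "complex \<Rightarrow> complex \<Rightarrow> complex" where
  "cayley_inv w \<zeta> = (w - cnj w * \<zeta>) / (1 - \<zeta>)"

lemma cayley_bij:
  assumes "w \<in> uhp"
  shows norm_cayley_less_1: "z \<in> uhp \<Longrightarrow> cmod (cayley w z) < 1"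
    and cayley_inv_in_uhp: "cmod \<zeta> < 1 \<Longrightarrow> cayley_inv w \<zeta> \<in> uhp"
    and cayley_inv_cayley: "z \<in> uhp \<Longrightarrow> cayley_inv w (cayley w z) = z"
    and cayley_cayley_inv: "cmod \<zeta> < 1 \<Longrightarrow> cayley w (cayley_inv w \<zeta>) = \<zeta>"
    and holomorphic_cayley: "cayley w holomorphic_on uhp"
    and holomorphic_cayley_inv: "cayley_inv w holomorphic_on ball 0 1"
proof -
  have w: "Im w > 0" using assms(1) by (simp add: uhp_def)
  have wc: "w - cnj w \<noteq> 0" using w by (auto simp: complex_eq_iff)
  show "cmod (cayley w z) < 1" if "z \<in> uhp" for z
  proof -
    have "Im z * Im w > 0" using that w by (simp add: uhp_def)
    then have "(cmod (z - w))\<^sup>2 < (cmod (z - cnj w))\<^sup>2" using cmod_diff_cnj_square[of z w] by simp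
    then have "cmod (z - w) < cmod (z - cnj w)" by (rule power_less_imp_less_base) simp
    then show ?thesis unfolding cayley_def norm_divide by (auto simp: divide_simps)
  qed
  have ne1: "1 - \<zeta> \<noteq> 0" if "cmod \<zeta> < 1" for \<zeta> :: complex using that by auto
  show "cayley_inv w \<zeta> \<in> uhp" if "cmod \<zeta> < 1" for \<zeta>
  proof -
    have "Im ((w - cnj w * \<zeta>) * cnj (1 - \<zeta>)) = Im w * (1 - (cmod \<zeta>)\<^sup>2)"
      unfolding cmod_power2 by (simp add: power2_eq_square algebra_simps)
    moreover have "(cmod \<zeta>)\<^sup>2 < 1" using that by (simp add: power_less_one_iff)
    ultimately have "Im ((w - cnj w * \<zeta>) * cnj (1 - \<zeta>)) > 0" using w by simp
    moreover have "cayley_inv w \<zeta> = ((w - cnj w * \<zeta>) * cnj (1 - \<zeta>)) / of_real ((cmod (1 - \<zeta>))\<^sup>2)"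
      unfolding cayley_inv_def by (rule complex_div_cnj[THEN trans]) simp
    ultimately show ?thesis using ne1[OF that] unfolding uhp_def
      by (simp add: Im_divide_of_real)
  qed
  show "cayley_inv w (cayley w z) = z" if "z \<in> uhp" for z
  proof -
    have zc: "z - cnj w \<noteq> 0" using uhp_not_cnj[OF that assms(1)] by simp
    have "1 - cayley w z = (w - cnj w) / (z - cnj w)" unfolding cayley_def using zc by (simp add: field_simps)
    moreover have "w - cnj w * cayley w z = (w - cnj w) * z / (z - cnj w)"
      unfolding cayley_def using zc by (simp add: field_simps)
    ultimately show ?thesis unfolding cayley_inv_def using zc wc by simp
  qed
  show "cayley w (cayley_inv w \<zeta>) = \<zeta>" if "cmod \<zeta> < 1" for \<zeta>
  proof -
    have "cayley_inv w \<zeta> - w = (w - cnj w) * \<zeta> / (1 - \<zeta>)" "cayley_inv w \<zeta> - cnj w = (w - cnj w) / (1 - \<zeta>)"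
      unfolding cayley_inv_def using ne1[OF that] by (simp_all add: field_simps)
    then show ?thesis unfolding cayley_def using ne1[OF that] wc by simp
  qed
  show "cayley w holomorphic_on uhp" unfolding cayley_def [abs_def]
    by (intro holomorphic_intros) (use uhp_not_cnj[OF _ assms(1)] in auto)
  show "cayley_inv w holomorphic_on ball 0 1" unfolding cayley_inv_def [abs_def]
    by (intro holomorphic_intros) auto
qed

text \<open>The Schwarz lemma at 0, applied to \<open>F\<close> read in Cayley coordinates centred
  at \<open>w\<close> and at \<open>F w\<close>; in the equality case \<open>F\<close> becomes a
  rotation there.\<close>

lemma
  assumes hol: "F holomorphic_on uhp" and im: "F ` uhp \<subseteq> uhp" and w: "w \<in> uhp"
  shows schwarz_pick: "z \<in> uhp \<Longrightarrow> hyp_ratio (F z) (F w) \<le> hyp_ratio z w"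
    and schwarz_pick_eq: "z \<in> uhp \<Longrightarrow> z \<noteq> w \<Longrightarrow> hyp_ratio (F z) (F w) = hyp_ratio z w \<Longrightarrow>
      \<exists>a. cmod a = 1 \<and> (\<forall>z\<in>uhp. cayley (F w) (F z) = a * cayley w z)"
proof -
  note CD = cayley_bij[OF w]
  have Fw: "F w \<in> uhp" using im w by auto
  note CD' = cayley_bij[OF Fw]
  define G where "G = cayley (F w) \<circ> F \<circ> cayley_inv w"
  have FD: "F (cayley_inv w \<zeta>) \<in> uhp" if "cmod \<zeta> < 1" for \<zeta> using CD(2)[OF that] im by auto
  have "F \<circ> cayley_inv w holomorphic_on ball 0 1"
    by (rule holomorphic_on_compose_gen[OF CD(6) hol]) (use CD(2) in auto)
  then have G: "G holomorphic_on ball 0 1" unfolding G_def comp_assoc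
    by (rule holomorphic_on_compose_gen[OF _ CD'(5)]) (use FD in auto)
  have G0: "G 0 = 0" by (simp add: G_def cayley_def cayley_inv_def)
  have G1: "cmod (G z) < 1" if "cmod z < 1" for z
    unfolding G_def using CD'(1)[OF FD[OF that]] by simp
  note S = Schwarz_Lemma[OF G G0 G1]
  have GC: "G (cayley w z) = cayley (F w) (F z)" if "z \<in> uhp" for z unfolding G_def using CD(3)[OF that] by simp
  show "hyp_ratio (F z) (F w) \<le> hyp_ratio z w" if z: "z \<in> uhp" for z
  proof -
    have "cmod (cayley (F w) (F z)) \<le> cmod (cayley w z)" using S(1)[OF _ CD(1)[OF z]] GC[OF z] by simp
    then show ?thesis
      using hyp_ratio_le_iff_cmod[of "F z" "F w" z w] im z w unfolding cayley_def by auto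
  qed
  show "\<exists>a. cmod a = 1 \<and> (\<forall>z\<in>uhp. cayley (F w) (F z) = a * cayley w z)"
    if z: "z \<in> uhp" and zw: "z \<noteq> w" and eq: "hyp_ratio (F z) (F w) = hyp_ratio z w" for z
  proof -
    have "cmod (cayley (F w) (F z)) = cmod (cayley w z)"
      using hyp_ratio_le_iff_cmod[of "F z" "F w" z w] hyp_ratio_le_iff_cmod[of z w "F z" "F w"]
        im z w eq unfolding cayley_def by (auto intro!: antisym)
    then have "cmod (G (cayley w z)) = cmod (cayley w z)" using GC[OF z] by simp
    moreover have "cayley w z \<noteq> 0" using uhp_not_cnj[OF z w] zw by (simp add: cayley_def)
    ultimately obtain a where a: "\<forall>z. cmod z < 1 \<longrightarrow> G z = a * z" "cmod a = 1"
      using S(3)[of 0] CD(1)[OF z] by auto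
    have "cayley (F w) (F x) = a * cayley w x" if "x \<in> uhp" for x using a(1) CD(1)[OF that] GC[OF that] by auto
    then show ?thesis using a(2) by blast
  qed
qed

lemma schwarz_pick_eq_bij:
  assumes hol: "F holomorphic_on uhp" and im: "F ` uhp \<subseteq> uhp" and w: "w \<in> uhp"
    and z: "z \<in> uhp" "z \<noteq> w" and eq: "hyp_ratio (F z) (F w) = hyp_ratio z w"
  shows "bij_betw F uhp uhp"
proof -
  obtain a where a: "cmod a = 1"
    and aF: "\<And>z. z \<in> uhp \<Longrightarrow> cayley (F w) (F z) = a * cayley w z"
    using schwarz_pick_eq[OF hol im w z eq] by blast
  have a0: "a \<noteq> 0" using a by auto
  have Fw: "F w \<in> uhp" using im w by auto
  note CD = cayley_bij[OF w] and CD' = cayley_bij[OF Fw]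
  have "inj_on F uhp"
  proof (rule inj_onI)
    fix u v assume uv: "u \<in> uhp" "v \<in> uhp" "F u = F v"
    then have "cayley w u = cayley w v"
      using aF[OF uv(1)] aF[OF uv(2)] a0 by (metis mult_left_cancel)
    then show "u = v" using CD(3)[OF uv(1)] CD(3)[OF uv(2)] by metis
  qed
  moreover have "v \<in> F ` uhp" if v: "v \<in> uhp" for v
  proof -
    define \<zeta> where "\<zeta> = cayley (F w) v / a"
    have "cmod \<zeta> < 1" using CD'(1)[OF v] a unfolding \<zeta>_def norm_divide by simp
    define u where "u = cayley_inv w \<zeta>"
    have u: "u \<in> uhp" "cayley w u = \<zeta>"
      using CD(2,4)[OF \<open>cmod \<zeta> < 1\<close>] by (auto simp: u_def)
    have "cayley (F w) (F u) = cayley (F w) v"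
      unfolding aF[OF u(1)] u(2) using a0 by (simp add: \<zeta>_def)
    then have "F u = v" using CD'(3)[OF v] CD'(3)[of "F u"] u im
      by (metis image_subset_iff)
    then show ?thesis using u by auto
  qed
  ultimately show ?thesis using im by (auto simp: bij_betw_def)
qed

text \<open>With \<open>u\<close> as centre, \<open>F\<close> is a rotation in Cayley coordinates
  that fixes a second point other than 0, so the rotation is trivial. Automorphisms can thus be
  recognised from two values.\<close>

lemma two_fixed_points_imp_id:
  assumes hol: "F holomorphic_on uhp" and im: "F ` uhp \<subseteq> uhp"
    and uv: "u \<in> uhp" "v \<in> uhp" "u \<noteq> v" "F u = u" "F v = v" and z: "z \<in> uhp"
  shows "F z = z"
proof -
  obtain a where aF: "\<And>z. z \<in> uhp \<Longrightarrow> cayley (F u) (F z) = a * cayley u z"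
    using schwarz_pick_eq[OF hol im uv(1) uv(2)] uv by auto
  have "cayley u v \<noteq> 0" unfolding cayley_def using uhp_not_cnj[OF uv(2,1)] uv by auto
  then have "a = 1" using aF[OF uv(2)] uv by simp
  then have "cayley u (F z) = cayley u z" using aF[OF z] uv by simp
  then show ?thesis
    using cayley_bij(3)[OF uv(1), of "F z"] cayley_bij(3)[OF uv(1), of z] im z by (metis image_subset_iff)
qed

lemma uhp_aut_inverse:
  assumes "F \<in> uhp_aut"
  shows "inv_into uhp F \<in> uhp_aut"
proof -
  have hol: "F holomorphic_on uhp" and bij: "bij_betw F uhp uhp" using assms by (auto simp: uhp_aut_def)
  then have inj: "inj_on F uhp" and img: "F ` uhp = uhp" by (auto simp: bij_betw_def)
  obtain k where k: "k holomorphic_on F ` uhp" "\<And>z. z \<in> uhp \<Longrightarrow> k (F z) = z"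
    using holomorphic_has_inverse[OF hol open_uhp inj] by metis
  have "inv_into uhp F y = k y" if "y \<in> uhp" for y
    using k(2) inj img that by (metis f_inv_into_f inv_into_into)
  then have "inv_into uhp F holomorphic_on uhp"
    using k(1) img holomorphic_cong[OF refl] by (metis (no_types, lifting))
  then show ?thesis using bij_betw_inv_into[OF bij] by (simp add: uhp_aut_def)
qed

lemma hyp_ratio_aut:
  assumes "F \<in> uhp_aut" "z \<in> uhp" "w \<in> uhp"
  shows "hyp_ratio (F z) (F w) = hyp_ratio z w"
proof (rule antisym)
  have F: "F holomorphic_on uhp" "F ` uhp = uhp" "inj_on F uhp"
    using assms(1) by (auto simp: uhp_aut_def bij_betw_def)
  show "hyp_ratio (F z) (F w) \<le> hyp_ratio z w" using schwarz_pick F assms by blast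
  have "inv_into uhp F holomorphic_on uhp" "inv_into uhp F ` uhp \<subseteq> uhp"
    using uhp_aut_inverse[OF assms(1)] by (auto simp: uhp_aut_def bij_betw_def)
  from schwarz_pick[OF this, of "F w" "F z"] show "hyp_ratio z w \<le> hyp_ratio (F z) (F w)"
    using F assms by (auto simp: inv_into_f_f)
qed

subsection \<open>Real affine maps\<close>

definition affine_map :: "real \<Rightarrow> real \<Rightarrow> complex \<Rightarrow> complex" where
  "affine_map s r z = of_real s * z + of_real r"

lemma affine_map_in_uhp: "s > 0 \<Longrightarrow> z \<in> uhp \<Longrightarrow> affine_map s r z \<in> uhp"
  by (simp add: affine_map_def uhp_def)

lemma holomorphic_affine_map: "affine_map s r holomorphic_on S"
  unfolding affine_map_def [abs_def] by (intro holomorphic_intros)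

lemma hyp_ratio_affine_map:
  "s > 0 \<Longrightarrow> hyp_ratio (affine_map s r z) (affine_map s r w) = hyp_ratio z w"
  unfolding affine_map_def by (rule hyp_ratio_affine)

text \<open>The geometric sum is left unevaluated, so that one formula covers s = 1 as well.\<close>

lemma affine_map_funpow:
  "(affine_map s r ^^ n) = affine_map (s ^ n) (r * (\<Sum>k<n. s ^ k))"
proof (induction n)
  case 0
  show ?case by (auto simp: affine_map_def)
next
  case (Suc n)
  have "s * (\<Sum>k<n. s ^ k) + 1 = (\<Sum>k<Suc n. s ^ k)"
    by (subst sum.lessThan_Suc_shift) (simp add: sum_distrib_left)
  then have "r * (\<Sum>k<Suc n. s ^ k) = s * (r * (\<Sum>k<n. s ^ k)) + r"
    by (metis distrib_left mult.commute mult.left_commute mult.right_neutral)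
  then show ?case
    by (simp only: funpow.simps Suc.IH) (simp add: fun_eq_iff affine_map_def algebra_simps)
qed

text \<open>Written as an \<open>affine_map\<close>, so that the facts on iterates also serve
  negative powers.\<close>

definition affine_inv :: "real \<Rightarrow> real \<Rightarrow> complex \<Rightarrow> complex" where
  "affine_inv s r = affine_map (1 / s) (- r / s)"

lemma affine_inv_inverse:
  assumes "s > 0"
  shows "affine_inv s r (affine_map s r z) = z" "affine_map s r (affine_inv s r z) = z"
  using assms by (simp_all add: affine_map_def affine_inv_def field_simps)

lemma affine_inv_funpow_inverse:
  assumes "s > 0"
  shows "(affine_inv s r ^^ n) ((affine_map s r ^^ n) z) = z"
    "(affine_map s r ^^ n) ((affine_inv s r ^^ n) z) = z"
proof -
  show "(affine_inv s r ^^ n) ((affine_map s r ^^ n) z) = z"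
  proof (induction n)
    case (Suc n)
    then show ?case
      unfolding funpow_Suc_right[of n "affine_inv s r"] funpow.simps(2)[of n "affine_map s r"]
      using assms by (simp add: affine_inv_inverse)
  qed simp
  show "(affine_map s r ^^ n) ((affine_inv s r ^^ n) z) = z"
  proof (induction n)
    case (Suc n)
    then show ?case
      unfolding funpow_Suc_right[of n "affine_map s r"] funpow.simps(2)[of n "affine_inv s r"]
      using assms by (simp add: affine_inv_inverse)
  qed simp
qed

lemma affine_funpow_in_uhp: "s > 0 \<Longrightarrow> z \<in> uhp \<Longrightarrow> (affine_map s r ^^ n) z \<in> uhp"
  by (simp add: affine_map_funpow affine_map_in_uhp)

lemma affine_inv_funpow_in_uhp: "s > 0 \<Longrightarrow> z \<in> uhp \<Longrightarrow> (affine_inv s r ^^ n) z \<in> uhp"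
  by (simp add: affine_inv_def affine_funpow_in_uhp)

lemma renorm_eq_affine_inv: "Im \<zeta> \<noteq> 0 \<Longrightarrow> renorm \<zeta> = affine_inv (Im \<zeta>) (Re \<zeta>)"
  by (simp add: fun_eq_iff renorm_def affine_inv_def affine_map_def field_simps)

lemma renorm_self: "Im \<zeta> \<noteq> 0 \<Longrightarrow> renorm \<zeta> \<zeta> = \<i>"
  by (simp add: renorm_def complex_eq_iff)

subsection \<open>Limits of self-maps of the half-plane\<close>

text \<open>A bounded hyperbolic distance to \<open>w\<close> keeps the imaginary parts above a
  positive constant, so the limit cannot reach the real line.\<close>

lemma tendsto_uhp:
  assumes "X \<longlonglongrightarrow> x" "\<And>n. X n \<in> uhp" "w \<in> uhp" "\<And>n. hyp_ratio (X n) w \<le> Q"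
  shows "x \<in> uhp"
proof -
  have "Q \<ge> 0" using hyp_ratio_nonneg assms by (meson order_trans)
  then have "Im w / (Q + 2) \<le> Im (X n)" for n
    using Im_le_of_hyp_ratio[OF assms(3,2), of n Q] assms(4)[of n]
    by (simp add: hyp_ratio_commute divide_simps mult.commute)
  then have "Im w / (Q + 2) \<le> Im x"
    by (intro tendsto_lowerbound[OF tendsto_Im[OF assms(1)]]) auto
  moreover have "Im w / (Q + 2) > 0" using \<open>Q \<ge> 0\<close> assms(3) by (simp add: uhp_def)
  ultimately show ?thesis by (simp add: uhp_def)
qed

text \<open>Supplies the locally uniform bounds required by Montel's theorem.\<close>

lemma norm_le_of_hyp_ratio:
  assumes "z \<in> uhp" "w \<in> uhp" "hyp_ratio z w \<le> Q"
  shows "cmod z \<le> cmod w + sqrt (Q * (Q + 2)) * Im w"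
proof -
  have pos: "Im z > 0" "Im w > 0" using assms by (auto simp: uhp_def)
  have Q0: "Q \<ge> 0" using hyp_ratio_nonneg assms by (meson order_trans)
  have "(cmod (z - w))\<^sup>2 \<le> Q * (Im z * Im w)"
    using assms(3) pos by (simp add: hyp_ratio_def divide_simps)
  also have "\<dots> \<le> Q * ((Q + 2) * Im w * Im w)"
    using Im_le_of_hyp_ratio[OF assms] Q0 pos by (intro mult_left_mono mult_right_mono) auto
  also have "\<dots> = (sqrt (Q * (Q + 2)) * Im w)\<^sup>2"
    using Q0 by (simp add: power_mult_distrib power2_eq_square)
  finally have "cmod (z - w) \<le> sqrt (Q * (Q + 2)) * Im w"
    by (rule power2_le_imp_le) (use Q0 pos in auto)
  then show ?thesis using norm_triangle_sub[of z w] by simp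
qed

lemma tendsto_uniform_limit_uhp:
  fixes F :: "nat \<Rightarrow> complex \<Rightarrow> complex"
  assumes "\<And>K. compact K \<Longrightarrow> K \<subseteq> uhp \<Longrightarrow> uniform_limit K F h sequentially"
    and "h holomorphic_on uhp" "u \<longlonglongrightarrow> x" "x \<in> uhp"
  shows "(\<lambda>n. F n (u n)) \<longlonglongrightarrow> h x"
proof -
  obtain e where e: "e > 0" "cball x e \<subseteq> uhp"
    using bspec[OF iffD1[OF open_contains_cball open_uhp] assms(4)] by auto
  have ul: "uniform_limit (cball x e) F h sequentially" using assms(1)[OF _ e(2)] by simp
  have "isCont h x" using assms(2,4) open_uhp continuous_on_eq_continuous_at holomorphic_on_imp_continuous_on by blast
  then have lim: "(\<lambda>n. h (u n)) \<longlonglongrightarrow> h x" using assms(3) isCont_tendsto_compose by blast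
  have ev: "eventually (\<lambda>n. u n \<in> cball x e) sequentially"
    using tendstoD[OF assms(3) e(1)] by eventually_elim (simp add: dist_commute)
  show ?thesis
  proof (rule tendstoI)
    fix d :: real assume "d > 0"
    then have "d / 2 > 0" by simp
    from uniform_limitD[OF ul this] tendstoD[OF lim this] ev
    show "eventually (\<lambda>n. dist (F n (u n)) (h x) < d) sequentially"
    proof eventually_elim
      case (elim n)
      then show ?case using dist_triangle[of "F n (u n)" "h x" "h (u n)"] by force
    qed
  qed
qed

text \<open>The centre has height 1 + C/2, which exceeds the radius; \<open>e\<close> is half of the
  gap. The margin leaves room for Cauchy's estimate and for the ball in Brouwer's theorem.\<close>

lemma hyp_ratio_ball_thicken:
  assumes "C \<ge> 0"
  obtains c R e where "e > 0" "{z \<in> uhp. hyp_ratio z \<i> \<le> C} = cball c R" "cball c (R + e) \<subseteq> uhp"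
proof -
  define c where "c = Complex 0 (1 + C / 2)"
  define R where "R = sqrt ((1 + C / 2)\<^sup>2 - 1)"
  have "(1 + C / 2)\<^sup>2 - 1 < (1 + C / 2)\<^sup>2" by simp
  then have "R < sqrt ((1 + C / 2)\<^sup>2)" unfolding R_def by (rule real_sqrt_less_mono)
  also have "\<dots> = 1 + C / 2" using assms by simp
  finally have R: "R < 1 + C / 2" .
  define e where "e = (1 + C / 2 - R) / 2"
  have "e > 0" "R + e < 1 + C / 2" using R by (auto simp: e_def field_simps)
  have "z \<in> uhp" if "z \<in> cball c (R + e)" for z
  proof -
    have "\<bar>Im (c - z)\<bar> \<le> R + e" using that abs_Im_le_cmod[of "c - z"] by (simp add: dist_norm)
    then show ?thesis using \<open>R + e < 1 + C / 2\<close> by (simp add: c_def uhp_def)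
  qed
  then show ?thesis
    using that[OF \<open>e > 0\<close>] hyp_ratio_ball_eq[OF assms] unfolding c_def R_def by blast
qed

subsection \<open>Renormalisation along an orbit\<close>

text \<open>\<open>ratio_Im\<close> and \<open>ratio_Re\<close> express that \<gamma>_n \<circ>
  \<gamma>_{n+1}^{-1} tends to \<alpha>, and \<open>nontrivial\<close> that \<alpha> is not the
  identity.\<close>

locale renormalised_orbit =
  fixes \<phi> g :: "complex \<Rightarrow> complex" and A b :: real and z0 :: complex
  assumes holomorphic_phi: "\<phi> holomorphic_on uhp" and phi_image: "\<phi> ` uhp \<subseteq> uhp"
    and z0: "z0 \<in> uhp" and A_ge_1: "A \<ge> 1" and nontrivial: "A > 1 \<or> b \<noteq> 0"
    and uniform_limit_g: "\<And>K. compact K \<Longrightarrow> K \<subseteq> uhp \<Longrightarrow>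
      uniform_limit K (\<lambda>n z. renorm ((\<phi> ^^ n) z0) ((\<phi> ^^ n) z)) g sequentially"
    and ratio_Im: "(\<lambda>n. Im ((\<phi> ^^ Suc n) z0) / Im ((\<phi> ^^ n) z0)) \<longlonglongrightarrow> A"
    and ratio_Re: "(\<lambda>n. (Re ((\<phi> ^^ Suc n) z0) - Re ((\<phi> ^^ n) z0)) / Im ((\<phi> ^^ n) z0)) \<longlonglongrightarrow> b"
begin

definition orb :: "nat \<Rightarrow> complex" where "orb n = (\<phi> ^^ n) z0"

text \<open>The inverse \<gamma>_n^{-1} of the renormalisation at \<open>orb n\<close>.\<close>

definition lift :: "nat \<Rightarrow> complex \<Rightarrow> complex" where
  "lift n = affine_map (Im (orb n)) (Re (orb n))"

lemma funpow_phi_in_uhp: "z \<in> uhp \<Longrightarrow> (\<phi> ^^ n) z \<in> uhp"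
  by (induction n) (use phi_image in auto)

lemma holomorphic_funpow_phi: "(\<phi> ^^ n) holomorphic_on uhp"
proof (induction n)
  case (Suc n)
  show ?case unfolding funpow.simps
    by (rule holomorphic_on_compose_gen[OF Suc holomorphic_phi]) (use funpow_phi_in_uhp in auto)
qed (auto simp: id_def)

lemma orb_in_uhp: "orb n \<in> uhp"
  unfolding orb_def using funpow_phi_in_uhp z0 by blast

lemma Im_orb_pos: "Im (orb n) > 0"
  using orb_in_uhp[of n] by (simp add: uhp_def)

lemma lift_in_uhp: "z \<in> uhp \<Longrightarrow> lift n z \<in> uhp"
  unfolding lift_def using affine_map_in_uhp Im_orb_pos by blast

lemma renorm_orb: "renorm (orb n) = affine_inv (Im (orb n)) (Re (orb n))"
  using renorm_eq_affine_inv[of "orb n"] Im_orb_pos[of n] by simp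

lemma lift_renorm: "lift n (renorm (orb n) z) = z" "renorm (orb n) (lift n z) = z"
  unfolding renorm_orb lift_def by (simp_all add: affine_inv_inverse Im_orb_pos)

lemma renorm_in_uhp: "z \<in> uhp \<Longrightarrow> renorm (orb n) z \<in> uhp"
  unfolding renorm_orb affine_inv_def using Im_orb_pos[of n] affine_map_in_uhp by simp

lemma lift_i: "lift n \<i> = orb n"
  by (simp add: lift_def affine_map_def complex_eq_iff)

lemma hyp_ratio_lift: "hyp_ratio (lift n z) (lift n w) = hyp_ratio z w"
  unfolding lift_def by (rule hyp_ratio_affine_map[OF Im_orb_pos])

lemma hyp_ratio_renorm: "hyp_ratio (renorm (orb n) z) \<i> = hyp_ratio z (orb n)"
  using hyp_ratio_lift[of n "renorm (orb n) z" \<i>] by (simp add: lift_renorm lift_i)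

lemma hyp_ratio_funpow_phi:
  "z \<in> uhp \<Longrightarrow> w \<in> uhp \<Longrightarrow> hyp_ratio ((\<phi> ^^ n) z) ((\<phi> ^^ n) w) \<le> hyp_ratio z w"
  by (rule schwarz_pick[OF holomorphic_funpow_phi]) (auto simp: funpow_phi_in_uhp)

lemma tendsto_g: "z \<in> uhp \<Longrightarrow> (\<lambda>n. renorm (orb n) ((\<phi> ^^ n) z)) \<longlonglongrightarrow> g z"
  unfolding orb_def using tendsto_uniform_limitI[OF uniform_limit_g[of "{z}"]] by simp

lemma holomorphic_g: "g holomorphic_on uhp"
proof (rule holomorphic_uniform_sequence[OF open_uhp])
  show "(\<lambda>z. renorm ((\<phi> ^^ n) z0) ((\<phi> ^^ n) z)) holomorphic_on uhp" for n
  proof -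
    have "affine_map (1 / Im (orb n)) (- Re (orb n) / Im (orb n)) \<circ> (\<phi> ^^ n) holomorphic_on uhp"
      by (rule holomorphic_on_compose[OF holomorphic_funpow_phi holomorphic_affine_map])
    then show ?thesis
      by (simp only: o_def affine_inv_def[symmetric] orb_def renorm_orb[unfolded orb_def, symmetric])
  qed
  show "\<exists>d>0. cball x d \<subseteq> uhp \<and>
      uniform_limit (cball x d) (\<lambda>n z. renorm ((\<phi> ^^ n) z0) ((\<phi> ^^ n) z)) g sequentially"
    if x: "x \<in> uhp" for x
  proof -
    obtain d where d: "d > 0" "cball x d \<subseteq> uhp" 
      using bspec[OF iffD1[OF open_contains_cball open_uhp] x] by auto
    show ?thesis
      by (rule exI[of _ d], intro conjI, rule d(1), rule d(2), rule uniform_limit_g[OF compact_cball d(2)])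
  qed
qed

lemma g_z0: "g z0 = \<i>"
proof -
  have "renorm (orb n) ((\<phi> ^^ n) z0) = \<i>" for n
    using renorm_self[of "orb n"] Im_orb_pos[of n] by (simp add: orb_def)
  then have "(\<lambda>n. renorm (orb n) ((\<phi> ^^ n) z0)) \<longlonglongrightarrow> \<i>" by simp
  then show ?thesis using tendsto_g[OF z0] LIMSEQ_unique by blast
qed

text \<open>A limit alone could land on the real line. By Schwarz-Pick, the renormalised iterates of
  \<open>z\<close> stay as close to \<open>\<i>\<close> as \<open>z\<close> is to
  \<open>z0\<close>.\<close>

lemma g_in_uhp: "z \<in> uhp \<Longrightarrow> g z \<in> uhp"
proof (rule tendsto_uhp[OF tendsto_g])
  assume z: "z \<in> uhp"
  then show "renorm (orb n) ((\<phi> ^^ n) z) \<in> uhp" for n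
    using renorm_in_uhp funpow_phi_in_uhp by blast
  show "hyp_ratio (renorm (orb n) ((\<phi> ^^ n) z)) \<i> \<le> hyp_ratio z z0" for n
    unfolding hyp_ratio_renorm unfolding orb_def using hyp_ratio_funpow_phi[OF z z0] .
qed auto

lemma g_image: "g ` uhp \<subseteq> uhp"
  using g_in_uhp by blast

text \<open>The limit of \<gamma>_n = p_n \<gamma>_{n+1} + q_n evaluated at \<phi>_{n+1}(z), where
  p_n tends to A and q_n to b.\<close>

lemma g_phi:
  assumes "z \<in> uhp"
  shows "g (\<phi> z) = affine_map A b (g z)"
proof -
  define p q where "p = (\<lambda>n. Im (orb (Suc n)) / Im (orb n))"
    and "q = (\<lambda>n. (Re (orb (Suc n)) - Re (orb n)) / Im (orb n))"
  have "(\<lambda>n. of_real (p n) * renorm (orb (Suc n)) ((\<phi> ^^ Suc n) z) + of_real (q n))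
      \<longlonglongrightarrow> of_real A * g z + of_real b"
    using ratio_Im ratio_Re LIMSEQ_Suc[OF tendsto_g[OF assms]] unfolding p_def q_def orb_def
    by (intro tendsto_intros)
  moreover have "of_real (p n) * renorm (orb (Suc n)) w + of_real (q n) = renorm (orb n) w" for n w
  proof -
    have "complex_of_real (Im (orb n)) \<noteq> 0" "complex_of_real (Im (orb (Suc n))) \<noteq> 0"
      using Im_orb_pos[of n] Im_orb_pos[of "Suc n"] by auto
    then show ?thesis by (simp add: p_def q_def renorm_def field_simps)
  qed
  ultimately have "(\<lambda>n. renorm (orb n) ((\<phi> ^^ n) (\<phi> z))) \<longlonglongrightarrow> affine_map A b (g z)"
    by (simp add: affine_map_def funpow_swap1)
  moreover have "\<phi> z \<in> uhp" using assms phi_image by auto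
  ultimately show ?thesis using tendsto_g LIMSEQ_unique by blast
qed

lemma affine_map_ne: "z \<in> uhp \<Longrightarrow> affine_map A b z \<noteq> z"
  using nontrivial A_ge_1 by (auto simp: affine_map_def complex_eq_iff uhp_def)

text \<open>Since \<alpha> has no fixed point in the half-plane, \<open>g\<close> separates
  \<open>z0\<close> from \<open>\<phi> z0\<close>.\<close>

lemma g_nonconstant: "\<not> g constant_on uhp"
proof
  assume "g constant_on uhp"
  then have "g (\<phi> z0) = g z0" using z0 phi_image unfolding constant_on_def by auto
  then show False using g_phi[OF z0] affine_map_ne[OF i_in_uhp] g_z0 by simp
qed

lemma open_g_image: "open (g ` uhp)"
  by (rule open_mapping_thm[OF holomorphic_g open_uhp connected_uhp open_uhp order_refl g_nonconstant])

lemma eq_on_uhp_if_eq_on_g_image: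
  assumes "h holomorphic_on uhp" "k holomorphic_on uhp" "\<And>z. z \<in> uhp \<Longrightarrow> h (g z) = k (g z)" "z \<in> uhp"
  shows "h z = k z"
  by (rule analytic_continuation_open[OF open_g_image open_uhp _ connected_uhp g_image assms(1,2) _ assms(4)])
    (use assms(3) z0 in auto)

lemma semiconj_funpow:
  assumes "\<And>z. z \<in> uhp \<Longrightarrow> f (\<phi> z) = affine_map s r (f z)" "z \<in> uhp"
  shows "f ((\<phi> ^^ n) z) = (affine_map s r ^^ n) (f z)"
  by (induction n) (use assms funpow_phi_in_uhp in auto)

lemma g_funpow: "z \<in> uhp \<Longrightarrow> g ((\<phi> ^^ n) z) = (affine_map A b ^^ n) (g z)"
  by (rule semiconj_funpow[of g A b, OF g_phi])

lemma holomorphic_renormalised: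
  assumes "f holomorphic_on uhp"
  shows "(\<lambda>z. (affine_inv s r ^^ m) (f (lift n z))) holomorphic_on uhp"
proof -
  have "(f \<circ> lift n) holomorphic_on uhp"
    by (rule holomorphic_on_compose_gen[OF _ assms])
      (use lift_in_uhp holomorphic_affine_map in \<open>auto simp: lift_def\<close>)
  then have "(affine_inv s r ^^ m) \<circ> (f \<circ> lift n) holomorphic_on uhp"
    unfolding affine_inv_def affine_map_funpow
    by (rule holomorphic_on_compose[OF _ holomorphic_affine_map])
  then show ?thesis by (simp add: o_def)
qed

text \<open>
  The maps $T^{-n} \circ f \circ \gamma_n^{-1}$ all send \<open>\<i>\<close> to $f(z_0)$, hence form a normal family.
\<close>

lemma semiconj_subseq_limit:
  fixes j :: "nat \<Rightarrow> nat"
  assumes hol: "f holomorphic_on uhp" and im: "f ` uhp \<subseteq> uhp" and s: "s > 0"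
    and semi: "\<And>z. z \<in> uhp \<Longrightarrow> f (\<phi> z) = affine_map s r (f z)" and j: "strict_mono j"
  shows "\<exists>q h. strict_mono (q :: nat \<Rightarrow> nat) \<and> h holomorphic_on uhp \<and> h ` uhp \<subseteq> uhp \<and>
    (\<forall>z\<in>uhp. f z = h (g z)) \<and>
    (\<forall>K. compact K \<longrightarrow> K \<subseteq> uhp \<longrightarrow>
      uniform_limit K (\<lambda>n z. (affine_inv s r ^^ j (q n)) (f (lift (j (q n)) z))) h sequentially)"
proof -
  \<comment> \<open>Starting from an arbitrary subsequence \<open>j\<close> makes it possible to
    argue later along indices at which a convergence fails.\<close>
  define F where "F = (\<lambda>n z. (affine_inv s r ^^ j n) (f (lift (j n) z)))"
  have Fu: "F n z \<in> uhp" if "z \<in> uhp" for n z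
    using affine_inv_funpow_in_uhp[OF s] lift_in_uhp[OF that] im unfolding F_def by blast
  have Fhol: "F n holomorphic_on uhp" for n
    unfolding F_def by (rule holomorphic_renormalised[OF hol])
  have Fi: "F n \<i> = f z0" for n
    unfolding F_def lift_i orb_def using semiconj_funpow[of f s r, OF semi z0] affine_inv_funpow_inverse[OF s] by simp
  have fz0: "f z0 \<in> uhp" using im z0 by auto
  have ratio: "hyp_ratio (F n z) (f z0) \<le> hyp_ratio z \<i>" if "z \<in> uhp" for n z
    using schwarz_pick[OF Fhol _ i_in_uhp that, of n] Fu Fi by (metis image_subsetI)
  have bdd: "\<exists>B. \<forall>h\<in>range F. \<forall>z\<in>K. cmod (h z) \<le> B" if K: "compact K" "K \<subseteq> uhp" for K
  proof -
    obtain C where C: "\<And>z. z \<in> K \<Longrightarrow> hyp_ratio z \<i> \<le> C"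
      using compact_hyp_ratio_bounded[OF K] by blast
    have "cmod (F n z) \<le> cmod (f z0) + sqrt (C * (C + 2)) * Im (f z0)" if "z \<in> K" for n z
      using norm_le_of_hyp_ratio[OF Fu fz0 order_trans[OF ratio C]] that K by blast
    then show ?thesis by blast
  qed
  obtain h q where h: "h holomorphic_on uhp" "strict_mono (q :: nat \<Rightarrow> nat)"
    "\<And>x. x \<in> uhp \<Longrightarrow> (\<lambda>n. F (q n) x) \<longlonglongrightarrow> h x"
    "\<And>K. compact K \<Longrightarrow> K \<subseteq> uhp \<Longrightarrow> uniform_limit K (F \<circ> q) h sequentially"
    by (rule Montel[OF open_uhp _ bdd, of F]) (use Fhol in auto)
  have im_h: "h ` uhp \<subseteq> uhp"
  proof (rule image_subsetI)
    show "h z \<in> uhp" if "z \<in> uhp" for z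
      using tendsto_uhp[OF h(3)[OF that] Fu[OF that] fz0 ratio[OF that]] .
  qed
  have fact: "f z = h (g z)" if z: "z \<in> uhp" for z
  proof -
    define u where "u = (\<lambda>n. renorm (orb (j (q n))) ((\<phi> ^^ j (q n)) z))"
    have "strict_mono (j \<circ> q)" using j h(2) strict_mono_o by blast
    then have "u \<longlonglongrightarrow> g z"
      using LIMSEQ_subseq_LIMSEQ[OF tendsto_g[OF z]] by (simp add: u_def o_def)
    \<comment> \<open>The evaluation points move with \<open>n\<close>, but the values are
      constantly \<open>f z\<close>.\<close>
    then have "(\<lambda>n. (F \<circ> q) n (u n)) \<longlonglongrightarrow> h (g z)"
      using tendsto_uniform_limit_uhp[OF h(4,1) _ g_in_uhp[OF z]] by blast
    moreover have "(F \<circ> q) n (u n) = f z" for n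
      using semiconj_funpow[of f s r, OF semi z] affine_inv_funpow_inverse[OF s]
      by (simp add: F_def u_def lift_renorm)
    ultimately show ?thesis by (simp add: LIMSEQ_const_iff)
  qed
  show ?thesis using h(1,2) im_h fact h(4)[unfolded F_def o_def] by blast
qed

text \<open>At a point g(z) both sides of the new relation equal f(\<phi>(z)); the identity theorem
  extends this from g(H) to the half-plane.\<close>

lemma semiconj_factor:
  assumes hol: "f holomorphic_on uhp" and im: "f ` uhp \<subseteq> uhp" and s: "s > 0"
    and semi: "\<And>z. z \<in> uhp \<Longrightarrow> f (\<phi> z) = affine_map s r (f z)"
  obtains h where "h holomorphic_on uhp" "h ` uhp \<subseteq> uhp" "\<forall>z\<in>uhp. f z = h (g z)"
    "\<forall>z\<in>uhp. h (affine_map A b z) = affine_map s r (h z)"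
proof -
  obtain q h where h: "h holomorphic_on uhp" "h ` uhp \<subseteq> uhp" "\<forall>z\<in>uhp. f z = h (g z)"
    using semiconj_subseq_limit[OF hol im s semi strict_mono_id] by blast
  have A: "A > 0" using A_ge_1 by simp
  have "(h \<circ> affine_map A b) z = (affine_map s r \<circ> h) z" if "z \<in> uhp" for z
  proof (rule eq_on_uhp_if_eq_on_g_image[OF _ _ _ that])
    show "h \<circ> affine_map A b holomorphic_on uhp"
      by (rule holomorphic_on_compose_gen[OF holomorphic_affine_map h(1)])
        (use affine_map_in_uhp A in auto)
    show "affine_map s r \<circ> h holomorphic_on uhp"
      by (rule holomorphic_on_compose[OF h(1) holomorphic_affine_map])
    show "(h \<circ> affine_map A b) (g z) = (affine_map s r \<circ> h) (g z)" if "z \<in> uhp" for z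
      using g_phi[OF that] h(3) semi[OF that] that phi_image by (metis comp_apply image_subset_iff)
  qed
  then show ?thesis using that[OF h] by simp
qed

text \<open>
  Every subsequential limit \<open>h\<close> satisfies $g = h \circ g$, so it is the identity.
\<close>

lemma g_renormalised_tendsto_id:
  assumes K: "compact K" "K \<subseteq> uhp"
  shows "uniform_limit K (\<lambda>n z. (affine_inv A b ^^ n) (g (lift n z))) (\<lambda>z. z) sequentially"
proof (rule ccontr)
  define F where "F = (\<lambda>n z. (affine_inv A b ^^ n) (g (lift n z)))"
  assume "\<not> ?thesis"
  then obtain e where e: "e > 0" "\<not> eventually (\<lambda>n. \<forall>z\<in>K. dist (F n z) z < e) sequentially"
    unfolding uniform_limit_iff F_def by blast
  then have inf: "infinite {n. \<not> (\<forall>z\<in>K. dist (F n z) z < e)}"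
    by (simp add: cofinite_eq_sequentially[symmetric] eventually_cofinite)
  \<comment> \<open>Along these indices the distance to the identity somewhere on \<open>K\<close>
    is at least \<open>e\<close>, which a convergent further subsequence contradicts.\<close>
  define j where "j = enumerate {n. \<not> (\<forall>z\<in>K. dist (F n z) z < e)}"
  have j: "strict_mono j" "\<And>n. \<not> (\<forall>z\<in>K. dist (F (j n) z) z < e)"
    using strict_mono_enumerate[OF inf] enumerate_in_set[OF inf] by (auto simp: j_def)
  have A: "A > 0" using A_ge_1 by simp
  obtain q h where h: "h holomorphic_on uhp" and hg: "\<forall>z\<in>uhp. g z = h (g z)"
    and lim: "\<forall>K. compact K \<longrightarrow> K \<subseteq> uhp \<longrightarrow>
      uniform_limit K (\<lambda>n z. (affine_inv A b ^^ j (q n)) (g (lift (j (q n)) z))) h sequentially"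
    using semiconj_subseq_limit[OF holomorphic_g g_image A g_phi j(1)] by blast
  have h3: "uniform_limit K (\<lambda>n z. F (j (q n)) z) h sequentially"
    unfolding F_def using lim K by blast
  have hid: "h z = z" if "z \<in> uhp" for z
    by (rule eq_on_uhp_if_eq_on_g_image[OF h _ _ that]) (use hg in auto)
  have "eventually (\<lambda>n. \<forall>z\<in>K. dist (F (j (q n)) z) (h z) < e) sequentially"
    using uniform_limitD[OF h3 e(1)] .
  then obtain n where "\<forall>z\<in>K. dist (F (j (q n)) z) (h z) < e"
    using eventually_happens' sequentially_bot by blast
  then show False using j(2)[of "q n"] hid K(2) by (metis subsetD)
qed

text \<open>A map whose difference from the identity has derivative at most 1/2 on a convex set is
  injective there. Cauchy's estimate on discs of radius \<open>e\<close> gives this bound once the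
  difference itself is below e/2 on the thickened ball.\<close>

lemma eventually_inj_on_g:
  "\<exists>N. \<forall>n\<ge>N. inj_on g {z \<in> uhp. hyp_ratio z (orb n) \<le> C}"
proof -
  define F where "F = (\<lambda>n z. (affine_inv A b ^^ n) (g (lift n z)))"
  have "max C 0 \<ge> 0" by simp
  then obtain c R e where e: "e > 0" "{z \<in> uhp. hyp_ratio z \<i> \<le> max C 0} = cball c R"
      "cball c (R + e) \<subseteq> uhp"
    by (rule hyp_ratio_ball_thicken)
  have Fhol: "F n holomorphic_on uhp" for n
    unfolding F_def by (rule holomorphic_renormalised[OF holomorphic_g])
  have "e / 2 > 0" using e(1) by simp
  then have "eventually (\<lambda>n. \<forall>z\<in>cball c (R + e). dist (F n z) z < e / 2) sequentially"
    unfolding F_def by (rule uniform_limitD[OF g_renormalised_tendsto_id[OF compact_cball e(3)]])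
  then obtain N where N: "\<And>n z. n \<ge> N \<Longrightarrow> z \<in> cball c (R + e) \<Longrightarrow> dist (F n z) z < e / 2"
    unfolding eventually_sequentially by blast
  have inj: "x = y" if n: "n \<ge> N" and x: "x \<in> cball c R" and y: "y \<in> cball c R" and eq: "F n x = F n y"
    for n x y
  proof -
    define D where "D = (\<lambda>z. F n z - z)"
    have Dhol: "D holomorphic_on uhp" unfolding D_def by (intro holomorphic_intros Fhol)
    have sub: "cball z e \<subseteq> cball c (R + e)" if "z \<in> cball c R" for z
      using that by (simp add: cball_subset_cball_iff dist_commute)
    have zu: "z \<in> uhp" if "z \<in> cball c R" for z using sub[OF that] e(1,3) centre_in_cball[of z e] by (meson less_imp_le subset_iff)
    have der: "(D has_field_derivative deriv D z) (at z within cball c R)" if "z \<in> cball c R" for z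
      using holomorphic_derivI[OF Dhol open_uhp zu[OF that]] .
    have bd: "cmod (deriv D z) \<le> 1 / 2" if z: "z \<in> cball c R" for z
    proof -
      have "cmod ((deriv ^^ 1) D z) \<le> fact 1 * (e / 2) / e ^ 1"
      proof (rule Cauchy_inequality)
        show "D holomorphic_on ball z e" "continuous_on (cball z e) D"
          using Dhol sub[OF z] e(3) by (meson ball_subset_cball holomorphic_on_subset
            holomorphic_on_imp_continuous_on order_trans)+
        show "cmod (D x) \<le> e / 2" if "cmod (z - x) = e" for x
          using N[OF n, of x] sub[OF z] that unfolding D_def by (force simp: dist_norm)
      qed (use e in auto)
      then show ?thesis using e(1) by simp
    qed
    have "cmod (D x - D y) \<le> 1 / 2 * cmod (x - y)"
      by (rule field_differentiable_bound[OF convex_cball der bd x y])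
    moreover have "D x - D y = - (x - y)" using eq by (simp add: D_def)
    ultimately have "cmod (x - y) \<le> 1 / 2 * cmod (x - y)" by (metis norm_minus_cancel)
    then show ?thesis by simp
  qed
  show ?thesis
  proof (intro exI allI impI inj_onI)
    fix n z w
    assume n: "n \<ge> N" and z: "z \<in> {z \<in> uhp. hyp_ratio z (orb n) \<le> C}"
      and w: "w \<in> {z \<in> uhp. hyp_ratio z (orb n) \<le> C}" and eq: "g z = g w"
    have "renorm (orb n) z \<in> cball c R" "renorm (orb n) w \<in> cball c R"
      unfolding e(2)[symmetric] using z w by (auto simp: hyp_ratio_renorm renorm_in_uhp)
    moreover have "F n (renorm (orb n) z) = F n (renorm (orb n) w)"
      using eq by (simp add: F_def lift_renorm)
    ultimately have "renorm (orb n) z = renorm (orb n) w" using inj[OF n] by blast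
    then show "z = w" by (metis lift_renorm(1))
  qed
qed

text \<open>Brouwer's theorem solves \<open>F x = w\<close> near \<open>w\<close> for maps \<open>F\<close> uniformly close to the identity.\<close>

lemma eventually_g_covers:
  assumes K: "compact K" "K \<subseteq> uhp"
  obtains C N where "C > 0" "\<And>n w. n \<ge> N \<Longrightarrow> w \<in> K \<Longrightarrow>
    \<exists>z\<in>uhp. hyp_ratio z (orb n) \<le> C \<and> g z = (affine_map A b ^^ n) w"
proof -
  define F where "F = (\<lambda>n z. (affine_inv A b ^^ n) (g (lift n z)))"
  have A: "A > 0" using A_ge_1 by simp
  obtain C0 where C0: "C0 > 0" "\<And>z. z \<in> K \<Longrightarrow> hyp_ratio z \<i> \<le> C0"
    using compact_hyp_ratio_bounded[OF K] by blast
  then have "C0 \<ge> 0" by simp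
  then obtain c R e where e: "e > 0" "{z \<in> uhp. hyp_ratio z \<i> \<le> C0} = cball c R"
      "cball c (R + e) \<subseteq> uhp"
    by (rule hyp_ratio_ball_thicken)
  \<comment> \<open>The preimages found below lie in the thickened ball rather than in
    \<open>K\<close>, so \<open>C\<close> must bound all of it.\<close>
  obtain C where C: "C > 0" "\<And>z. z \<in> cball c (R + e) \<Longrightarrow> hyp_ratio z \<i> \<le> C"
    using compact_hyp_ratio_bounded[OF compact_cball e(3)] by blast
  have "eventually (\<lambda>n. \<forall>z\<in>cball c (R + e). dist (F n z) z < e) sequentially"
    unfolding F_def by (rule uniform_limitD[OF g_renormalised_tendsto_id[OF compact_cball e(3)] e(1)])
  then obtain N where N: "\<And>n z. n \<ge> N \<Longrightarrow> z \<in> cball c (R + e) \<Longrightarrow> dist (F n z) z < e"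
    unfolding eventually_sequentially by blast
  show ?thesis
  proof (rule that[OF C(1)])
    fix n w assume n: "n \<ge> N" and w: "w \<in> K"
    have "w \<in> cball c R" unfolding e(2)[symmetric] using w C0 K by auto
    then have sub: "cball w e \<subseteq> cball c (R + e)"
      by (simp add: cball_subset_cball_iff dist_commute)
    have "F n holomorphic_on uhp"
      unfolding F_def by (rule holomorphic_renormalised[OF holomorphic_g])
    then have cont: "continuous_on (cball w e) (F n)"
      using sub e(3) by (meson continuous_on_subset holomorphic_on_imp_continuous_on order_trans)
    \<comment> \<open>A fixed point of this map solves \<open>F n x = w\<close>; the map preserves
      the ball because \<open>F n\<close> moves points by less than \<open>e\<close>.\<close>
    have "continuous_on (cball w e) (\<lambda>x. x - F n x + w)" 
      by (intro continuous_on_add continuous_on_diff continuous_on_id continuous_on_const cont)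
    moreover have "(\<lambda>x. x - F n x + w) ` cball w e \<subseteq> cball w e"
    proof (rule image_subsetI)
      fix x assume "x \<in> cball w e"
      then have "dist (F n x) x < e" using N[OF n] sub by blast
      moreover have "w - (x - F n x + w) = F n x - x" by simp
      ultimately show "x - F n x + w \<in> cball w e"
        unfolding mem_cball dist_norm by simp
    qed
    ultimately obtain x where x: "x \<in> cball w e" "x - F n x + w = x"
      using brouwer_ball[OF e(1), of w "\<lambda>x. x - F n x + w"] by blast
    then have Fx: "F n x = w" by (simp add: algebra_simps)
    have xc: "x \<in> cball c (R + e)" using x sub by blast
    have "lift n x \<in> uhp" using xc e(3) lift_in_uhp by blast
    moreover have "hyp_ratio (lift n x) (orb n) \<le> C"
      using hyp_ratio_lift[of n x \<i>] C(2)[OF xc] by (simp add: lift_i)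
    moreover have "g (lift n x) = (affine_map A b ^^ n) w"
      using affine_inv_funpow_inverse(2)[OF A, where r = b and n = n and z = "g (lift n x)"] Fx by (simp add: F_def)
    ultimately show "\<exists>z\<in>uhp. hyp_ratio z (orb n) \<le> C \<and> g z = (affine_map A b ^^ n) w" by blast
  qed
qed

end

subsection \<open>Tangent conditions\<close>

text \<open>Collects separately chosen thresholds: partial sums of absolute values give
  monotonicity, and the added \<open>real n\<close> gives divergence.\<close>

lemma majorant_seq:
  fixes R' :: "nat \<Rightarrow> real"
  obtains R where "incseq R" "filterlim R at_top sequentially" "\<And>n. R' n \<le> R n"
proof -
  define R where "R = (\<lambda>n. (\<Sum>j\<le>n. \<bar>R' j\<bar>) + real n)"
  have "incseq R" unfolding R_def by (rule incseq_SucI) simp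
  moreover have "filterlim R at_top sequentially"
    by (rule filterlim_at_top_mono[OF filterlim_real_sequentially])
      (auto simp: R_def intro!: always_eventually sum_nonneg)
  moreover have "R' n \<le> R n" for n
  proof -
    have "\<bar>R' n\<bar> \<le> (\<Sum>j\<le>n. \<bar>R' j\<bar>)" by (rule member_le_sum) auto
    then show ?thesis unfolding R_def by linarith
  qed
  ultimately show ?thesis by (rule that)
qed

text \<open>Allows the tangency definitions, which quantify over sequences, to be used at a single
  prescribed aperture.\<close>

lemma null_sequence_through:
  fixes \<delta> :: real
  assumes "\<delta> > 0"
  obtains d where "(\<forall>n. d n > 0) \<and> decseq d \<and> d \<longlonglongrightarrow> 0" "d 0 = \<delta>"
proof -
  define d where "d = (\<lambda>n. \<delta> * inverse (real (Suc n)))"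
  have "d \<longlonglongrightarrow> \<delta> * 0"
    unfolding d_def by (intro tendsto_mult tendsto_const LIMSEQ_inverse_real_of_nat)
  moreover have "decseq d" unfolding d_def
    by (rule decseq_SucI) (use assms in \<open>auto intro!: mult_left_mono simp: field_simps\<close>)
  ultimately show ?thesis
    using assms that[of d] by (simp add: d_def)
qed

lemma inner_tangent_infinityD:
  assumes "inner_tangent_infinity \<Omega>" "\<delta> > 0"
  obtains R where "\<And>z. cmod z > R \<Longrightarrow> \<delta> < Arg z \<Longrightarrow> Arg z < pi - \<delta> \<Longrightarrow> z \<in> \<Omega>"
proof -
  obtain d where d: "(\<forall>n. d n > 0) \<and> decseq d \<and> d \<longlonglongrightarrow> 0" "d 0 = \<delta>"
    using assms(2) by (rule null_sequence_through)
  obtain R where "\<forall>n. {z. cmod z > R n \<and> d n < Arg z \<and> Arg z < pi - d n} \<subseteq> \<Omega>"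
    using assms(1) d(1) unfolding inner_tangent_infinity_def by blast
  then have "{z. cmod z > R 0 \<and> d 0 < Arg z \<and> Arg z < pi - d 0} \<subseteq> \<Omega>" by blast
  then show ?thesis using that[of "R 0"] d(2) by auto
qed

lemma inner_tangent_infinityI:
  assumes "\<And>\<delta>. 0 < \<delta> \<Longrightarrow> \<delta> < pi / 2 \<Longrightarrow>
    \<exists>R. \<forall>z. cmod z > R \<longrightarrow> \<delta> < Arg z \<longrightarrow> Arg z < pi - \<delta> \<longrightarrow> z \<in> \<Omega>"
  shows "inner_tangent_infinity \<Omega>"
  unfolding inner_tangent_infinity_def
proof (intro allI impI)
  fix \<delta> :: "nat \<Rightarrow> real" assume \<delta>: "(\<forall>n. \<delta> n > 0) \<and> decseq \<delta> \<and> \<delta> \<longlonglongrightarrow> 0"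
  have "\<exists>R. \<forall>z. cmod z > R \<longrightarrow> \<delta> n < Arg z \<longrightarrow> Arg z < pi - \<delta> n \<longrightarrow> z \<in> \<Omega>" for n
  proof (cases "\<delta> n < pi / 2")
    case False
    then have "\<not> (\<delta> n < Arg z \<and> Arg z < pi - \<delta> n)" for z by argo
    then show ?thesis by blast
  qed (use assms \<delta> in blast)
  then obtain R' where R': "\<And>n z. cmod z > R' n \<Longrightarrow> \<delta> n < Arg z \<Longrightarrow> Arg z < pi - \<delta> n \<Longrightarrow> z \<in> \<Omega>"
    by metis
  obtain R where R: "incseq R" "filterlim R at_top sequentially" "\<And>n. R' n \<le> R n"
    using majorant_seq[of R'] by blast
  have "{z. cmod z > R n \<and> \<delta> n < Arg z \<and> Arg z < pi - \<delta> n} \<subseteq> \<Omega>" for n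
    using R'[of n] order_le_less_trans[OF R(3)[of n]] by blast
  then show "\<exists>R. incseq R \<and> filterlim R at_top sequentially \<and>
      (\<forall>n. {z. cmod z > R n \<and> \<delta> n < Arg z \<and> Arg z < pi - \<delta> n} \<subseteq> \<Omega>)"
    using R(1,2) by blast
qed

lemma lateral_tangent_plus_infinityD:
  assumes "lateral_tangent_plus_infinity V" "\<delta> > 0"
  obtains t where "\<And>z. Re z > t \<Longrightarrow> \<delta> < Im z \<Longrightarrow> Im z < 1 / \<delta> \<Longrightarrow> z \<in> V"
proof -
  obtain d where d: "(\<forall>n. d n > 0) \<and> decseq d \<and> d \<longlonglongrightarrow> 0" "d 0 = \<delta>"
    using assms(2) by (rule null_sequence_through)
  obtain t where "\<forall>n. {z. Re z > t n \<and> d n < Im z \<and> Im z < 1 / d n} \<subseteq> V"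
    using assms(1) d(1) unfolding lateral_tangent_plus_infinity_def by blast
  then have "{z. Re z > t 0 \<and> d 0 < Im z \<and> Im z < 1 / d 0} \<subseteq> V" by blast
  then show ?thesis using that[of "t 0"] d(2) by auto
qed

lemma lateral_tangent_plus_infinityI:
  assumes "\<And>\<delta>. 0 < \<delta> \<Longrightarrow> \<exists>t. \<forall>z. Re z > t \<longrightarrow> \<delta> < Im z \<longrightarrow> Im z < 1 / \<delta> \<longrightarrow> z \<in> V"
  shows "lateral_tangent_plus_infinity V"
  unfolding lateral_tangent_plus_infinity_def
proof (intro allI impI)
  fix \<delta> :: "nat \<Rightarrow> real" assume \<delta>: "(\<forall>n. \<delta> n > 0) \<and> decseq \<delta> \<and> \<delta> \<longlonglongrightarrow> 0"
  have "\<exists>t. \<forall>z. Re z > t \<longrightarrow> \<delta> n < Im z \<longrightarrow> Im z < 1 / \<delta> n \<longrightarrow> z \<in> V" for n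
    using assms \<delta> by blast
  then obtain t' where t': "\<And>n z. Re z > t' n \<Longrightarrow> \<delta> n < Im z \<Longrightarrow> Im z < 1 / \<delta> n \<Longrightarrow> z \<in> V"
    by metis
  obtain t where t: "incseq t" "filterlim t at_top sequentially" "\<And>n. t' n \<le> t n"
    using majorant_seq[of t'] by blast
  have "{z. Re z > t n \<and> \<delta> n < Im z \<and> Im z < 1 / \<delta> n} \<subseteq> V" for n
    using t'[of n] order_le_less_trans[OF t(3)[of n]] by blast
  then show "\<exists>t. incseq t \<and> filterlim t at_top sequentially \<and>
      (\<forall>n. {z. Re z > t n \<and> \<delta> n < Im z \<and> Im z < 1 / \<delta> n} \<subseteq> V)"
    using t(1,2) by blast
qed

lemma Im_eq_cmod_sin_Arg: "Im z = cmod z * sin (Arg z)"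
  using rcis_cmod_Arg[of z] by (metis Im_rcis)

lemma Im_ge_of_Arg:
  assumes "0 < \<delta>" "\<delta> < pi / 2" "\<delta> < Arg z" "Arg z < pi - \<delta>"
  shows "sin \<delta> * cmod z \<le> Im z"
proof -
  have "sin \<delta> \<le> sin (Arg z)"
  proof (cases "Arg z \<le> pi / 2")
    case True
    then show ?thesis using assms by (intro sin_monotone_2pi_le) auto
  next
    case False
    then have "sin \<delta> \<le> sin (pi - Arg z)" using assms by (intro sin_monotone_2pi_le) auto
    then show ?thesis by simp
  qed
  then show ?thesis unfolding Im_eq_cmod_sin_Arg
    by (simp add: mult.commute mult_left_mono)
qed

lemma Arg_uhp: "z \<in> uhp \<Longrightarrow> 0 < Arg z \<and> Arg z < pi"
  using Arg_lt_pi by (simp add: uhp_def)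

text \<open>The angle pi/6 arises from |z| \<le> |Re z| + |Im z| < 2 Im z, that is, sin (Arg z) >
  1/2.\<close>

lemma Arg_of_abs_Re_less_Im:
  assumes "\<bar>Re z\<bar> < Im z"
  shows "pi / 6 < Arg z" "Arg z < pi - pi / 6"
proof -
  have "z \<in> uhp" using assms by (simp add: uhp_def)
  note Arg = Arg_uhp[OF this]
  have "cmod z \<le> \<bar>Re z\<bar> + \<bar>Im z\<bar>" by (rule cmod_le)
  then have c: "cmod z < 2 * Im z" using assms by linarith
  have s: "sin (Arg z) > 1 / 2"
  proof (rule ccontr)
    assume "\<not> ?thesis"
    then have "cmod z * sin (Arg z) \<le> cmod z * (1 / 2)" by (intro mult_left_mono) auto
    then show False using c Im_eq_cmod_sin_Arg[of z] by simp
  qed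
  show "pi / 6 < Arg z"
  proof (rule ccontr)
    assume "\<not> ?thesis"
    then have "sin (Arg z) \<le> sin (pi / 6)" using Arg by (intro sin_monotone_2pi_le) auto
    then show False using s sin_30 by simp
  qed
  show "Arg z < pi - pi / 6"
  proof (rule ccontr)
    assume "\<not> ?thesis"
    then have "sin (pi - Arg z) \<le> sin (pi / 6)" using Arg by (intro sin_monotone_2pi_le) auto
    then show False using s sin_30 by simp
  qed
qed

subsection \<open>Semiconjugations between real affine maps\<close>

definition standard_affine :: "real \<Rightarrow> real \<Rightarrow> bool" where
  "standard_affine s r \<longleftrightarrow> (s > 1 \<and> r = 0) \<or> (s = 1 \<and> (r = 1 \<or> r = -1))"

lemma standard_affine_pos: "standard_affine s r \<Longrightarrow> s > 0"
  by (auto simp: standard_affine_def)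

lemma affine_map_funpow_scaling: "(affine_map s 0 ^^ n) z = of_real (s ^ n) * z"
  by (simp add: affine_map_funpow affine_map_def)

lemma affine_map_funpow_translation: "(affine_map 1 r ^^ n) z = z + of_real (r * real n)"
  by (simp add: affine_map_funpow affine_map_def)

text \<open>A standard form has no periodic point. This matches the two indices in a grand orbit
  relation.\<close>

lemma standard_affine_funpow_inject:
  assumes "standard_affine s r" "z \<in> uhp" "(affine_map s r ^^ m) z = (affine_map s r ^^ n) z"
  shows "m = n"
proof -
  consider "s > 1" "r = 0" | "s = 1" "r \<noteq> 0" using assms(1) by (auto simp: standard_affine_def)
  then show ?thesis
  proof cases
    case 1
    have "z \<noteq> 0" using assms(2) by (auto simp: uhp_def)
    then have "s ^ m = s ^ n" using assms(3) 1 unfolding 1 affine_map_funpow_scaling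
      by (metis mult_right_cancel of_real_eq_iff)
    then show ?thesis using 1(1) power_inject_exp by blast
  next
    case 2
    then show ?thesis using assms(3) unfolding 2 affine_map_funpow_translation
      by (simp add: complex_eq_iff)
  qed
qed

lemma hyp_ratio_scaling:
  assumes "s > 0" "z \<in> uhp"
  shows "hyp_ratio z (affine_map s 0 z) = (s - 1)\<^sup>2 / s * ((cmod z)\<^sup>2 / (Im z)\<^sup>2)"
proof -
  have "z - affine_map s 0 z = of_real (1 - s) * z" by (simp add: affine_map_def algebra_simps)
  then have "(cmod (z - affine_map s 0 z))\<^sup>2 = (s - 1)\<^sup>2 * (cmod z)\<^sup>2"
    by (simp only: norm_mult norm_of_real power_mult_distrib power2_abs power2_commute[of 1 s])
  then show ?thesis by (simp add: hyp_ratio_def affine_map_def power2_eq_square)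
qed

text \<open>The bound is attained on the imaginary axis. For s > 1 it is positive, which
  distinguishes scalings from translations.\<close>

lemma hyp_ratio_scaling_ge:
  assumes "s > 0" "z \<in> uhp"
  shows "(s - 1)\<^sup>2 / s \<le> hyp_ratio z (affine_map s 0 z)"
proof -
  have "(Im z)\<^sup>2 \<le> (cmod z)\<^sup>2" using abs_Im_le_cmod[of z] by (simp add: abs_le_square_iff[symmetric])
  then have "1 \<le> (cmod z)\<^sup>2 / (Im z)\<^sup>2" using assms(2) by (simp add: uhp_def)
  then have "(s - 1)\<^sup>2 / s * 1 \<le> (s - 1)\<^sup>2 / s * ((cmod z)\<^sup>2 / (Im z)\<^sup>2)"
    using assms(1) by (intro mult_left_mono) auto
  then show ?thesis using hyp_ratio_scaling[OF assms] by simp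
qed

lemma hyp_ratio_translation: "hyp_ratio z (affine_map 1 r z) = r\<^sup>2 / (Im z)\<^sup>2"
  by (simp add: hyp_ratio_def affine_map_def power2_eq_square)

text \<open>The quantity 1 / (Im z)^2 is the displacement of a unit translation at z, so high points
  are moved arbitrarily little.\<close>

lemma exists_high_point:
  fixes K :: real
  assumes "K > 0"
  obtains z where "z \<in> uhp" "1 / (Im z)\<^sup>2 < K"
proof -
  have "(1 / sqrt (K / 2))\<^sup>2 = 2 / K" using assms by (simp add: power_divide)
  then have "1 / (1 / sqrt (K / 2))\<^sup>2 < K" using assms by (simp add: field_simps)
  then show ?thesis using that[of "Complex 0 (1 / sqrt (K / 2))"] assms by (simp add: uhp_def)
qed

text \<open>By Schwarz-Pick, \<eta> does not increase displacements: the small displacement of the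
  translation at a high point would bound that of the scaling, which stays above a positive
  constant.\<close>

lemma no_semiconj_translation_scaling:
  assumes "\<eta> holomorphic_on uhp" "\<eta> ` uhp \<subseteq> uhp" "s > 1"
    and semi: "\<And>z. z \<in> uhp \<Longrightarrow> \<eta> (affine_map 1 1 z) = affine_map s 0 (\<eta> z)"
  shows False
proof -
  have "(s - 1)\<^sup>2 / s > 0" using assms(3) by simp
  then obtain z where z: "z \<in> uhp" "1 / (Im z)\<^sup>2 < (s - 1)\<^sup>2 / s" by (rule exists_high_point)
  have "(s - 1)\<^sup>2 / s \<le> hyp_ratio (\<eta> z) (affine_map s 0 (\<eta> z))"
    using hyp_ratio_scaling_ge[of s "\<eta> z"] assms z by auto
  also have "\<dots> \<le> hyp_ratio z (affine_map 1 1 z)"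
    unfolding semi[OF z(1), symmetric]
    by (rule schwarz_pick[OF assms(1,2) _ z(1)]) (use affine_map_in_uhp z in auto)
  also have "\<dots> = 1 / (Im z)\<^sup>2" by (simp add: hyp_ratio_translation)
  finally show False using z(2) by simp
qed

text \<open>
  The inverse of \<open>\<eta>\<close> on a horoball at infinity would semiconjugate a translation to a scaling.
\<close>

lemma no_inj_semiconj_scaling_translation:
  assumes "\<eta> holomorphic_on uhp" "inj_on \<eta> uhp" "A > 1" "\<bar>r\<bar> = 1"
    and semi: "\<And>z. z \<in> uhp \<Longrightarrow> \<eta> (affine_map A 0 z) = affine_map 1 r (\<eta> z)"
    and horo: "{w. Im w > R} \<subseteq> \<eta> ` uhp" "R \<ge> 0"
  shows False
proof -
  obtain k where k: "k holomorphic_on \<eta> ` uhp" "\<And>z. z \<in> uhp \<Longrightarrow> k (\<eta> z) = z"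
    using holomorphic_has_inverse[OF assms(1) open_uhp assms(2)] by metis
  \<comment> \<open>The vertical shift turns the horoball into the whole half-plane, where
    Schwarz-Pick applies, and it commutes with horizontal translations.\<close>
  define m where "m = k \<circ> (\<lambda>w. w + \<i> * of_real R)"
  have shift: "w + \<i> * of_real R \<in> \<eta> ` uhp" if "w \<in> uhp" for w
    using horo that by (auto simp: uhp_def)
  have mhol: "m holomorphic_on uhp" unfolding m_def
    by (rule holomorphic_on_compose_gen[OF _ k(1)]) (use shift in \<open>auto intro!: holomorphic_intros\<close>)
  have mu: "m w \<in> uhp" if "w \<in> uhp" for w
    using shift[OF that] k(2) unfolding m_def by auto
  have mshift: "m (affine_map 1 r w) = affine_map A 0 (m w)" if w: "w \<in> uhp" for w
  proof -
    obtain z where z: "z \<in> uhp" "w + \<i> * of_real R = \<eta> z" using shift[OF w] by auto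
    have "affine_map 1 r w + \<i> * of_real R = \<eta> (affine_map A 0 z)"
      unfolding semi[OF z(1)] z(2)[symmetric] by (simp add: affine_map_def)
    moreover have "affine_map A 0 z \<in> uhp" using affine_map_in_uhp z assms(3) by simp
    ultimately show ?thesis using z k(2) by (simp add: m_def)
  qed
  have "(A - 1)\<^sup>2 / A > 0" using assms(3) by simp
  then obtain w where w: "w \<in> uhp" "1 / (Im w)\<^sup>2 < (A - 1)\<^sup>2 / A" by (rule exists_high_point)
  have "(A - 1)\<^sup>2 / A \<le> hyp_ratio (m w) (affine_map A 0 (m w))"
    using hyp_ratio_scaling_ge[of A "m w"] assms(3) mu w by auto
  also have "\<dots> \<le> hyp_ratio w (affine_map 1 r w)"
    unfolding mshift[OF w(1), symmetric]
    by (rule schwarz_pick[OF mhol _ _ w(1)]) (use affine_map_in_uhp w mu in auto)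
  also have "\<dots> = 1 / (Im w)\<^sup>2" using assms(4) by (metis hyp_ratio_translation one_power2 power2_abs)
  finally show False using w(2) by simp
qed

text \<open>An automorphism preserves displacements. Their infimum is positive, which rules out a
  translation, and its value determines \<open>s\<close>; since it is attained at
  \<open>\<i>\<close>, the image of \<open>\<i>\<close> lies on the imaginary axis. After division
  by the height \<open>c\<close> of that image, the points \<open>\<i>\<close> and
  A\<open>\<i>\<close> are fixed.\<close>

lemma aut_semiconj_scaling:
  assumes aut: "\<eta> \<in> uhp_aut" and A: "A > 1" and std: "standard_affine s r"
    and semi: "\<And>z. z \<in> uhp \<Longrightarrow> \<eta> (affine_map A 0 z) = affine_map s r (\<eta> z)"
  shows "s = A" "r = 0" "\<exists>c>0. \<forall>z\<in>uhp. \<eta> z = affine_map c 0 z"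
proof -
  have hol: "\<eta> holomorphic_on uhp" and img: "\<eta> ` uhp = uhp"
    using aut by (auto simp: uhp_aut_def bij_betw_def)
  have iso: "hyp_ratio (\<eta> z) (affine_map s r (\<eta> z)) = hyp_ratio z (affine_map A 0 z)" if "z \<in> uhp" for z
    unfolding semi[OF that, symmetric] using hyp_ratio_aut[OF aut that] affine_map_in_uhp A that by simp
  define K where "K = (A - 1)\<^sup>2 / A"
  have K: "K > 0" using A by (simp add: K_def)
  have lower: "K \<le> hyp_ratio w (affine_map s r w)" if w: "w \<in> uhp" for w
  proof -
    obtain z where "z \<in> uhp" "w = \<eta> z" using img w by blast
    then show ?thesis using iso hyp_ratio_scaling_ge[of A z] A unfolding K_def by simp
  qed
  have s1: "s > 1 \<and> r = 0"
  proof (rule ccontr)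
    assume "\<not> ?thesis"
    then have "s = 1" "r\<^sup>2 = 1" using std by (auto simp: standard_affine_def)
    moreover obtain w where "w \<in> uhp" "1 / (Im w)\<^sup>2 < K" using K by (rule exists_high_point)
    ultimately show False using lower[of w] by (simp add: hyp_ratio_translation)
  qed
  then show r0: "r = 0" by simp
  have ii: "hyp_ratio \<i> (affine_map t 0 \<i>) = (t - 1)\<^sup>2 / t" if "t > 0" for t
    using hyp_ratio_scaling[OF that, of \<i>] by simp
  have ei: "\<eta> \<i> \<in> uhp" using img i_in_uhp by blast
  have "(s - 1)\<^sup>2 / s \<le> K"
    using hyp_ratio_scaling_ge[of s "\<eta> \<i>"] iso[of \<i>] ii[of A] ei s1 A by (simp add: K_def)
  moreover have "K \<le> (s - 1)\<^sup>2 / s" using lower[of \<i>] ii[of s] s1 by simp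
  ultimately have sK: "(s - 1)\<^sup>2 / s = K" by simp
  show sA: "s = A"
  proof -
    have "(s - 1)\<^sup>2 * A = (A - 1)\<^sup>2 * s" using sK A s1 by (simp add: K_def field_simps)
    \<comment> \<open>The infimum determines the factor only up to inversion; s A = 1 is impossible
      as both factors exceed 1.\<close>
    then have "(s - A) * (s * A - 1) = 0" by (simp add: power2_eq_square algebra_simps)
    moreover have "s * A > 1" using s1 A by (simp add: less_1_mult)
    ultimately show ?thesis by simp
  qed
  have Im_pos: "Im (\<eta> \<i>) > 0" using ei by (simp add: uhp_def)
  have "K * ((cmod (\<eta> \<i>))\<^sup>2 / (Im (\<eta> \<i>))\<^sup>2) = K"
    using iso[of \<i>] hyp_ratio_scaling[of A "\<eta> \<i>"] ii[of A] ei A sA r0 by (simp add: K_def)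
  then have "(cmod (\<eta> \<i>))\<^sup>2 = (Im (\<eta> \<i>))\<^sup>2" using K Im_pos by (simp add: field_simps)
  then have "Re (\<eta> \<i>) = 0" by (simp add: cmod_power2)
  define c where "c = Im (\<eta> \<i>)"
  have c: "c > 0" using Im_pos by (simp add: c_def)
  have eta_i: "\<eta> \<i> = of_real c * \<i>" using \<open>Re (\<eta> \<i>) = 0\<close> by (simp add: complex_eq_iff c_def)
  define F where "F = affine_map (1 / c) 0 \<circ> \<eta>"
  have Fz: "F z = \<eta> z / of_real c" for z by (simp add: F_def affine_map_def)
  have "F z = z" if z: "z \<in> uhp" for z
  proof (rule two_fixed_points_imp_id[OF _ _ i_in_uhp _ _ _ _ z])
    show "F holomorphic_on uhp" unfolding F_def
      by (rule holomorphic_on_compose[OF hol holomorphic_affine_map])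
    show "F ` uhp \<subseteq> uhp" using img c affine_map_in_uhp[of "1 / c"] by (auto simp: F_def)
    show "affine_map A 0 \<i> \<in> uhp" using A affine_map_in_uhp by simp
    show "\<i> \<noteq> affine_map A 0 \<i>" using A by (simp add: affine_map_def complex_eq_iff)
    show "F \<i> = \<i>" using c by (simp add: Fz eta_i)
    show "F (affine_map A 0 \<i>) = affine_map A 0 \<i>"
      unfolding Fz semi[OF i_in_uhp] sA r0 eta_i using c by (simp add: affine_map_def)
  qed
  then have "\<eta> z = affine_map c 0 z" if "z \<in> uhp" for z
    using c that by (simp add: Fz affine_map_def field_simps)
  then show "\<exists>c>0. \<forall>z\<in>uhp. \<eta> z = affine_map c 0 z" using c by blast
qed

text \<open>The displacement 1 / (Im z)^2 is preserved, hence so are heights. Once the real part of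
  the image of \<open>\<i>\<close> is subtracted, \<open>\<i>\<close> is fixed, and the preserved
  distance from \<open>\<i>\<close> to 2\<open>\<i>\<close> then fixes 2\<open>\<i>\<close> as well.
  Evaluation at \<open>\<i>\<close> decides the sign of \<open>r\<close>.\<close>

lemma aut_semiconj_translation:
  assumes aut: "\<eta> \<in> uhp_aut" and std: "standard_affine s r"
    and semi: "\<And>z. z \<in> uhp \<Longrightarrow> \<eta> (affine_map 1 1 z) = affine_map s r (\<eta> z)"
  shows "s = 1" "r = 1" "\<exists>d. \<forall>z\<in>uhp. \<eta> z = affine_map 1 d z"
proof -
  have hol: "\<eta> holomorphic_on uhp" and img: "\<eta> ` uhp = uhp"
    using aut by (auto simp: uhp_aut_def bij_betw_def)
  have sr: "s = 1" "r\<^sup>2 = 1"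
    using std no_semiconj_translation_scaling[of \<eta> s, OF hol] semi img
    by (auto simp: standard_affine_def)
  show "s = 1" by (rule sr)
  have eu: "\<eta> z \<in> uhp" if "z \<in> uhp" for z using img that by blast
  have Im_eta: "Im (\<eta> z) = Im z" if z: "z \<in> uhp" for z
  proof -
    have "hyp_ratio (\<eta> z) (affine_map 1 r (\<eta> z)) = hyp_ratio z (affine_map 1 1 z)"
      using semi[OF z] hyp_ratio_aut[OF aut z, of "affine_map 1 1 z"] affine_map_in_uhp z sr by simp
    then have "(Im (\<eta> z))\<^sup>2 = (Im z)\<^sup>2" using sr by (simp add: hyp_ratio_translation)
    then show ?thesis using z eu[OF z] by (simp add: uhp_def power2_eq_iff)
  qed
  define d where "d = Re (\<eta> \<i>)"
  define F where "F = affine_map 1 (- d) \<circ> \<eta>"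
  have Fz: "F z = \<eta> z - of_real d" for z by (simp add: F_def affine_map_def)
  have Fhol: "F holomorphic_on uhp" unfolding F_def
    by (rule holomorphic_on_compose[OF hol holomorphic_affine_map])
  have Fi: "F \<i> = \<i>" using Im_eta[OF i_in_uhp] by (simp add: Fz d_def complex_eq_iff)
  have i2: "2 * \<i> \<in> uhp" by (simp add: uhp_def)
  have "hyp_ratio (\<eta> (2 * \<i>)) (\<eta> \<i>) = hyp_ratio (2 * \<i>) \<i>" by (rule hyp_ratio_aut[OF aut i2 i_in_uhp])
  moreover have "hyp_ratio (\<eta> (2 * \<i>)) (\<eta> \<i>) = ((Re (F (2 * \<i>)))\<^sup>2 + 1) / 2"
    using Im_eta[OF i2] Im_eta[OF i_in_uhp]
    unfolding hyp_ratio_def cmod_power2 by (simp add: Fz d_def)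
  moreover have "hyp_ratio (2 * \<i>) \<i> = 1 / 2" by (simp add: hyp_ratio_def)
  ultimately have "Re (F (2 * \<i>)) = 0" by simp
  then have F2i: "F (2 * \<i>) = 2 * \<i>" using Im_eta[OF i2] by (simp add: Fz complex_eq_iff)
  have "F z = z" if z: "z \<in> uhp" for z
    by (rule two_fixed_points_imp_id[OF Fhol _ i_in_uhp i2 _ Fi F2i z])
      (use img affine_map_in_uhp[of 1] in \<open>auto simp: F_def complex_eq_iff\<close>)
  then have eta: "\<eta> z = z + of_real d" if "z \<in> uhp" for z using that by (metis Fz diff_add_cancel)
  then show "\<exists>d. \<forall>z\<in>uhp. \<eta> z = affine_map 1 d z" by (auto simp: affine_map_def)
  have "affine_map 1 1 \<i> \<in> uhp" using affine_map_in_uhp by simp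
  from eta[OF this] semi[OF i_in_uhp] eta[OF i_in_uhp] sr(1) show "r = 1"
    by (simp add: affine_map_def complex_eq_iff)
qed

subsection \<open>Grand orbits\<close>

lemma funpow_image_uhp: "\<psi> ` uhp \<subseteq> uhp \<Longrightarrow> z \<in> uhp \<Longrightarrow> (\<psi> ^^ n) z \<in> uhp"
  by (induction n) auto

lemma equiv_same_grand_orbit: "equiv uhp (same_grand_orbit \<psi>)"
proof (rule equivI)
  show "same_grand_orbit \<psi> \<subseteq> uhp \<times> uhp" by (auto simp: same_grand_orbit_def)
  show "refl_on uhp (same_grand_orbit \<psi>)" by (auto simp: refl_on_def same_grand_orbit_def)
  show "sym (same_grand_orbit \<psi>)" unfolding sym_def same_grand_orbit_def by (auto, metis)
  show "trans (same_grand_orbit \<psi>)"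
  proof (rule transI)
    fix x y z assume "(x, y) \<in> same_grand_orbit \<psi>" "(y, z) \<in> same_grand_orbit \<psi>"
    then obtain n k m l where *: "x \<in> uhp" "z \<in> uhp" "(\<psi> ^^ n) x = (\<psi> ^^ k) y" "(\<psi> ^^ m) y = (\<psi> ^^ l) z"
      by (auto simp: same_grand_orbit_def)
    have "(\<psi> ^^ (m + n)) x = (\<psi> ^^ (k + l)) z"
      by (metis * add.commute comp_apply funpow_add)
    then show "(x, z) \<in> same_grand_orbit \<psi>" using * by (auto simp: same_grand_orbit_def)
  qed
qed

text \<open>Bijectivity on the quotients, read on representatives. The relation \<sigma> \<circ>
  \<phi>_n = \<tau>_n \<circ> \<sigma> shows that \<sigma> respects grand orbits.\<close>

lemma canonical_iff:
  assumes sig: "\<sigma> ` uhp \<subseteq> uhp" and phi: "\<phi> ` uhp \<subseteq> uhp"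
    and semi: "\<And>z. z \<in> uhp \<Longrightarrow> \<sigma> (\<phi> z) = \<tau> (\<sigma> z)"
  shows "canonical \<phi> \<sigma> \<tau> \<longleftrightarrow>
    (\<forall>w\<in>uhp. \<exists>z\<in>uhp. (\<sigma> z, w) \<in> same_grand_orbit \<tau>) \<and>
    (\<forall>z\<in>uhp. \<forall>w\<in>uhp. (\<sigma> z, \<sigma> w) \<in> same_grand_orbit \<tau> \<longrightarrow> (z, w) \<in> same_grand_orbit \<phi>)"
proof -
  define E E' where "E = same_grand_orbit \<phi>" and "E' = same_grand_orbit \<tau>"
  have eq: "equiv uhp E" "equiv uhp E'" unfolding E_def E'_def by (rule equiv_same_grand_orbit)+
  have pow: "\<sigma> ((\<phi> ^^ n) z) = (\<tau> ^^ n) (\<sigma> z)" if "z \<in> uhp" for n z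
    by (induction n) (use semi funpow_image_uhp[OF phi that] in auto)
  have resp: "(\<sigma> z, \<sigma> w) \<in> E'" if "(z, w) \<in> E" for z w
    using that sig pow unfolding E_def E'_def same_grand_orbit_def by (auto, metis)
  have ind: "induced_map \<sigma> \<tau> (E `` {z}) = E' `` {\<sigma> z}" if z: "z \<in> uhp" for z
  proof -
    have "(z, z) \<in> E" using eq(1) z by (meson equiv_class_self Image_singleton_iff)
    moreover have "E' `` {\<sigma> w} = E' `` {\<sigma> z}" if "(z, w) \<in> E" for w
      using equiv_class_eq[OF eq(2) resp[OF that]] by simp
    ultimately show ?thesis unfolding induced_map_def E'_def[symmetric] by blast
  qed
  have E'iff: "E' `` {x} = E' `` {y} \<longleftrightarrow> (x, y) \<in> E'" if "x \<in> uhp" "y \<in> uhp" for x y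
    using eq_equiv_class_iff[OF eq(2) that] .
  have Eiff: "E `` {x} = E `` {y} \<longleftrightarrow> (x, y) \<in> E" if "x \<in> uhp" "y \<in> uhp" for x y
    using eq_equiv_class_iff[OF eq(1) that] .
  have su: "\<sigma> z \<in> uhp" if "z \<in> uhp" for z using sig that by blast
  have go: "grand_orbits \<phi> = (\<lambda>z. E `` {z}) ` uhp" "grand_orbits \<tau> = (\<lambda>z. E' `` {z}) ` uhp"
    unfolding grand_orbits_def quotient_def E_def E'_def by auto
  have "inj_on (induced_map \<sigma> \<tau>) (grand_orbits \<phi>) \<longleftrightarrow>
      (\<forall>z\<in>uhp. \<forall>w\<in>uhp. (\<sigma> z, \<sigma> w) \<in> E' \<longrightarrow> (z, w) \<in> E)"
    unfolding go inj_on_def by (simp add: ind E'iff Eiff su)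
  moreover have "induced_map \<sigma> \<tau> ` grand_orbits \<phi> = grand_orbits \<tau> \<longleftrightarrow>
      (\<forall>w\<in>uhp. \<exists>z\<in>uhp. (\<sigma> z, w) \<in> E')" (is "?L = _ \<longleftrightarrow> ?R")
  proof -
    have L: "?L = (\<lambda>z. E' `` {\<sigma> z}) ` uhp" unfolding go image_image using ind by auto
    then have "?L \<subseteq> grand_orbits \<tau>" unfolding go using su by blast
    moreover have "grand_orbits \<tau> \<subseteq> ?L \<longleftrightarrow> ?R"
    proof -
      have "E' `` {w} \<in> (\<lambda>z. E' `` {\<sigma> z}) ` uhp \<longleftrightarrow> (\<exists>z\<in>uhp. (\<sigma> z, w) \<in> E')" if "w \<in> uhp" for w
      proof -
        have "E' `` {w} = E' `` {\<sigma> z} \<longleftrightarrow> (\<sigma> z, w) \<in> E'" if "z \<in> uhp" for z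
          using E'iff[OF su[OF that] \<open>w \<in> uhp\<close>] by metis
        then show ?thesis by (simp add: image_iff)
      qed
      then show ?thesis unfolding L go(2) by (simp add: image_subset_iff)
    qed
    ultimately show ?thesis by blast
  qed
  ultimately show ?thesis unfolding canonical_def bij_betw_def E_def E'_def by blast
qed

section \<open>Growth and compactness facts for exhausting sectors\<close>

text \<open>Otherwise \<open>y\<close> would stay below \<open>x\<close> from \<open>N\<close> on.
  In the tangency proofs it selects the index whose renormalisation brings a far point into a fixed
  compact set.\<close>

lemma exists_bracket:
  fixes y :: "nat \<Rightarrow> real"
  assumes "filterlim y at_top sequentially" "y N \<le> x"
  shows "\<exists>n\<ge>N. y n \<le> x \<and> x < y (Suc n)"
proof (rule ccontr)
  assume "\<not> ?thesis"
  then have step: "y (Suc n) \<le> x" if "n \<ge> N" "y n \<le> x" for n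
    using that by (auto simp: not_less)
  have "y n \<le> x" if "n \<ge> N" for n
    using that
  proof (induction n rule: dec_induct)
    case base
    show ?case by (rule assms(2))
  next
    case (step n)
    then show ?case using \<open>\<And>n. n \<ge> N \<Longrightarrow> y n \<le> x \<Longrightarrow> y (Suc n) \<le> x\<close> by blast
  qed
  moreover have "eventually (\<lambda>n. y n > x \<and> n \<ge> N) sequentially"
    using assms(1) eventually_ge_at_top[of N] by (auto simp: filterlim_at_top_dense eventually_conj_iff)
  then obtain n where "y n > x" "n \<ge> N" using eventually_happens' sequentially_bot by blast
  ultimately show False by force
qed

lemma compact_truncated_halfplane: "compact {v :: complex. cmod v \<le> R \<and> t \<le> Im v}"
proof -
  have "{v :: complex. cmod v \<le> R \<and> t \<le> Im v} = cball 0 R \<inter> {v. Im v \<ge> t}" by auto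
  then show ?thesis by (simp add: compact_Int_closed closed_halfspace_Im_ge)
qed

lemma filterlim_power_times_at_top:
  fixes A c :: real
  assumes "A > 1" "c > 0"
  shows "filterlim (\<lambda>n. A ^ n * c) at_top sequentially"
  unfolding filterlim_at_top_dense
proof
  fix Z
  obtain N where N: "Z / c < A ^ N" using real_arch_pow[OF assms(1)] by blast
  have "Z < A ^ n * c" if "n \<ge> N" for n
  proof -
    have "A ^ N \<le> A ^ n" using assms(1) that by (intro power_increasing) auto
    then have "Z / c < A ^ n" using N by linarith
    then show ?thesis using assms(2) by (simp add: divide_simps)
  qed
  then show "eventually (\<lambda>n. Z < A ^ n * c) sequentially"
    unfolding eventually_sequentially by blast
qed

text \<open>The right-hand side is the \<open>hyp_ratio\<close> threshold of hyperbolic radius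
  \<open>\<rho> k\<close>; sinh x \<ge> x makes it at least \<open>\<rho> k\<close> once
  \<open>\<rho> k\<close> exceeds 1.\<close>

lemma exists_sinh_gt:
  fixes \<rho> :: "nat \<Rightarrow> real"
  assumes "filterlim \<rho> at_top sequentially"
  shows "\<exists>k. C < 4 * (sinh (\<rho> k / 2))\<^sup>2"
proof -
  have "eventually (\<lambda>k. \<rho> k > max C 1) sequentially"
    using assms filterlim_at_top_dense by blast
  then obtain k where k: "\<rho> k > max C 1" using eventually_happens' sequentially_bot by blast
  have "\<rho> k / 2 \<le> sinh (\<rho> k / 2)"
    using real_le_x_sinh[of "\<rho> k / 2"] k by (simp add: sinh_field_def exp_minus)
  then have "(\<rho> k / 2)\<^sup>2 \<le> (sinh (\<rho> k / 2))\<^sup>2" using k by (intro power_mono) auto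
  then have "\<rho> k * \<rho> k \<le> 4 * (sinh (\<rho> k / 2))\<^sup>2" by (simp add: power2_eq_square)
  moreover have "\<rho> k * 1 \<le> \<rho> k * \<rho> k" using k by (intro mult_left_mono) auto
  ultimately show ?thesis using k by (intro exI[of _ k]) linarith
qed

section \<open>Orbit neighbourhoods\<close>

context renormalised_orbit
begin

lemma orbit_neighbourhood_eq:
  assumes "\<And>k. \<rho> k > 0"
  shows "orbit_neighbourhood \<phi> z0 \<rho> M =
    {z \<in> uhp. \<exists>k n. n \<ge> M k \<and> hyp_ratio z (orb n) < 4 * (sinh (\<rho> k / 2))\<^sup>2}"
proof -
  have "(\<lambda>z. of_real (Re ((\<phi> ^^ n) z0)) + of_real (Im ((\<phi> ^^ n) z0)) * z) ` hyp_disc \<i> (\<rho> k) =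
      {z \<in> uhp. hyp_ratio z (orb n) < 4 * (sinh (\<rho> k / 2))\<^sup>2}" for n k
  proof -
    have "(\<lambda>z. of_real (Re ((\<phi> ^^ n) z0)) + of_real (Im ((\<phi> ^^ n) z0)) * z) = lift n"
      by (simp add: fun_eq_iff lift_def affine_map_def orb_def)
    moreover have "hyp_disc \<i> (\<rho> k) = {z \<in> uhp. hyp_ratio z \<i> < 4 * (sinh (\<rho> k / 2))\<^sup>2}"
      unfolding hyp_disc_def using hyp_dist_less_iff[OF _ i_in_uhp assms] by blast
    moreover have "lift n ` {z \<in> uhp. hyp_ratio z \<i> < Q} = {z \<in> uhp. hyp_ratio z (orb n) < Q}" for Q
    proof (intro equalityI subsetI)
      fix z assume "z \<in> {z \<in> uhp. hyp_ratio z (orb n) < Q}"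
      then have "renorm (orb n) z \<in> {z \<in> uhp. hyp_ratio z \<i> < Q}"
        using renorm_in_uhp hyp_ratio_renorm by simp
      then show "z \<in> lift n ` {z \<in> uhp. hyp_ratio z \<i> < Q}"
        using lift_renorm(1)[of n z] by (metis imageI)
    next
      fix z assume "z \<in> lift n ` {z \<in> uhp. hyp_ratio z \<i> < Q}"
      then show "z \<in> {z \<in> uhp. hyp_ratio z (orb n) < Q}"
        using lift_in_uhp hyp_ratio_lift[of n _ \<i>] by (auto simp: lift_i)
    qed
    ultimately show ?thesis by (simp only:)
  qed
  then show ?thesis unfolding orbit_neighbourhood_def by auto
qed

lemma eventually_in_orbit_neighbourhood:
  assumes "\<And>k. \<rho> k > 0" "filterlim \<rho> at_top sequentially"
  shows "\<exists>N. \<forall>n\<ge>N. \<forall>z\<in>uhp. hyp_ratio z (orb n) \<le> C \<longrightarrow> z \<in> orbit_neighbourhood \<phi> z0 \<rho> M"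
proof -
  obtain k where "C < 4 * (sinh (\<rho> k / 2))\<^sup>2" using exists_sinh_gt[OF assms(2)] by blast
  then show ?thesis unfolding orbit_neighbourhood_eq[OF assms(1)]
    by (intro exI[of _ "M k"]) force
qed

text \<open>The \<alpha>-orbit of \<open>\<i>\<close> leaves every hyperbolic ball: its height is
  A^l if A > 1, and its \<open>hyp_ratio\<close> to \<open>\<i>\<close> is l^2 b^2 if A = 1.\<close>

lemma bounded_returns:
  "\<exists>L. \<forall>l. hyp_ratio ((affine_map A b ^^ l) \<i>) \<i> \<le> Q \<longrightarrow> l \<le> L"
proof (cases "A > 1")
  case True
  obtain L where L: "Q + 2 < A ^ L" using real_arch_pow[OF True] by blast
  have "l \<le> L" if "hyp_ratio ((affine_map A b ^^ l) \<i>) \<i> \<le> Q" for l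
  proof (rule ccontr)
    assume "\<not> l \<le> L"
    then have "A ^ L \<le> A ^ l" using True by (intro power_increasing) auto
    moreover have "(affine_map A b ^^ l) \<i> \<in> uhp" using affine_funpow_in_uhp True by simp
    ultimately show False
      using L Im_le_of_hyp_ratio[OF _ i_in_uhp that] by (simp add: affine_map_funpow affine_map_def)
  qed
  then show ?thesis by blast
next
  case False
  then have A: "A = 1" and b: "b \<noteq> 0" using nontrivial A_ge_1 by auto
  then have "b\<^sup>2 > 0" by simp
  then obtain L where L: "Q < real L * b\<^sup>2" using ex_less_of_nat_mult by blast
  have "l \<le> L" if "hyp_ratio ((affine_map A b ^^ l) \<i>) \<i> \<le> Q" for l
  proof (rule ccontr)
    assume "\<not> l \<le> L"
    then have "real L * b\<^sup>2 \<le> real l * b\<^sup>2" by (intro mult_right_mono) auto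
    also have "\<dots> \<le> (real l)\<^sup>2 * b\<^sup>2"
      using \<open>\<not> l \<le> L\<close> by (intro mult_right_mono) (auto simp: power2_eq_square)
    also have "\<dots> = hyp_ratio ((affine_map A b ^^ l) \<i>) \<i>"
      unfolding A affine_map_funpow_translation hyp_ratio_def
      by (simp add: norm_mult power_mult_distrib mult.commute)
    finally show False using L that by simp
  qed
  then show ?thesis by blast
qed

text \<open>Schwarz-Pick for \<phi>_n, which sends \<open>z0\<close> and \<open>orb (m - n)\<close>
  to \<open>orb n\<close> and \<open>orb m\<close>; the bound depends only on the difference of the
  indices.\<close>

lemma hyp_ratio_orb_le: "n \<le> m \<Longrightarrow> hyp_ratio (orb n) (orb m) \<le> hyp_ratio z0 (orb (m - n))"
  using hyp_ratio_funpow_phi[OF z0 orb_in_uhp, of n "m - n"]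
  unfolding orb_def by (metis comp_apply funpow_add le_add_diff_inverse)

text \<open>
  If $g(z) = g(w)$ with \<open>z\<close> near $z_n$ and \<open>w\<close> near $z_m$, then $\alpha^n(i)$ and $\alpha^m(i)$ are
  close, so $|n - m|$ is bounded and \<open>w\<close> is itself near $z_n$.
\<close>

lemma eventually_g_separates:
  "\<exists>N. \<forall>n\<ge>N. \<forall>m z w. z \<in> uhp \<longrightarrow> w \<in> uhp \<longrightarrow> hyp_ratio z (orb n) \<le> Q \<longrightarrow>
    hyp_ratio w (orb m) \<le> Q \<longrightarrow> g z = g w \<longrightarrow> z = w"
proof -
  \<comment> \<open>The quasi-triangle bound for \<alpha>^m(i) and \<alpha>^n(i), both within
    \<open>Q\<close> of the common value g(z) = g(w).\<close>
  define Q1 where "Q1 = 4 * Q * (Q + 2)"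
  obtain L where L: "\<And>l. hyp_ratio ((affine_map A b ^^ l) \<i>) \<i> \<le> Q1 \<Longrightarrow> l \<le> L"
    using bounded_returns by blast
  define B where "B = Max ((\<lambda>l. hyp_ratio z0 (orb l)) ` {..L})"
  have B: "hyp_ratio z0 (orb l) \<le> B" if "l \<le> L" for l
    unfolding B_def using that by (intro Max_ge) auto
  define Q2 where "Q2 = max Q B"
  \<comment> \<open>Large enough for \<open>z\<close>, which is within \<open>Q\<close> of
    \<open>orb n\<close>, and for \<open>w\<close>, which reaches \<open>orb n\<close> through
    \<open>orb m\<close>.\<close>
  define C where "C = max Q (4 * Q2 * (Q2 + 2))"
  obtain N where N: "\<And>n. n \<ge> N \<Longrightarrow> inj_on g {z \<in> uhp. hyp_ratio z (orb n) \<le> C}"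
    using eventually_inj_on_g by blast
  have A: "A > 0" using A_ge_1 by simp
  define a where "a = (\<lambda>n. (affine_map A b ^^ n) \<i>)"
  have au: "a n \<in> uhp" for n unfolding a_def using affine_funpow_in_uhp[OF A] by simp
  have near: "hyp_ratio (g z) (a n) \<le> hyp_ratio z (orb n)" if "z \<in> uhp" for z n
    using schwarz_pick[OF holomorphic_g g_image orb_in_uhp that, of n] g_funpow[OF z0, of n]
    by (simp add: a_def orb_def g_z0)
  have a_shift: "hyp_ratio (a m) (a n) = hyp_ratio (a (m - n)) \<i>" if "n \<le> m" for m n
  proof -
    have "a m = (affine_map A b ^^ n) (a (m - n))"
      unfolding a_def using that by (metis comp_apply funpow_add le_add_diff_inverse)
    then show ?thesis unfolding a_def affine_map_funpow using hyp_ratio_affine_map A by simp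
  qed
  have le: "m - n \<le> L" if "n \<le> m" "hyp_ratio (a m) (a n) \<le> Q1" for m n
    using L[of "m - n"] that a_shift[OF that(1)] unfolding a_def by simp
  have orbs: "hyp_ratio (orb m) (orb n) \<le> B" if "hyp_ratio (a m) (a n) \<le> Q1" for m n
  proof (cases "n \<le> m")
    case True
    then show ?thesis
      using hyp_ratio_orb_le[OF True] B[OF le[OF True that]] by (simp add: hyp_ratio_commute)
  next
    case False
    then have nm: "m \<le> n" by simp
    then show ?thesis
      using hyp_ratio_orb_le[OF nm] B[OF le[OF nm]] that by (simp add: hyp_ratio_commute)
  qed
  show ?thesis
  proof (intro exI allI impI)
    fix n m z w
    assume n: "n \<ge> N" and z: "z \<in> uhp" and w: "w \<in> uhp" and zn: "hyp_ratio z (orb n) \<le> Q"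
      and wm: "hyp_ratio w (orb m) \<le> Q" and eq: "g z = g w"
    have "hyp_ratio (a m) (g w) \<le> Q" "hyp_ratio (g w) (a n) \<le> Q"
      using near[OF w, of m] near[OF z, of n] wm zn eq by (auto simp: hyp_ratio_commute)
    then have "hyp_ratio (a m) (a n) \<le> Q1"
      unfolding Q1_def by (rule hyp_ratio_quasi_triangle[OF au g_in_uhp[OF w] au])
    then have "hyp_ratio w (orb n) \<le> 4 * Q2 * (Q2 + 2)"
      using hyp_ratio_quasi_triangle[OF w orb_in_uhp orb_in_uhp, of m Q2 n] orbs[of m n] wm
      by (simp add: Q2_def)
    then have "w \<in> {z \<in> uhp. hyp_ratio z (orb n) \<le> C}" "z \<in> {z \<in> uhp. hyp_ratio z (orb n) \<le> C}"
      using z w zn by (auto simp: C_def)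
    then show "z = w" using N[OF n] eq by (auto dest: inj_onD)
  qed
qed

text \<open>The geometric growth of the heights y_n dominates the horizontal steps, so the orbit
  stays in a sector. Therefore \<gamma>_n maps the part of a given sector with y_n \<le> |z| <
  y_{n+1} into a compact set independent of n.\<close>

lemma inner_tangent_orbit_neighbourhood:
  assumes A: "A > 1" and Im_phi: "\<And>z. z \<in> uhp \<Longrightarrow> Im (\<phi> z) \<ge> A * Im z"
    and \<rho>: "\<And>k. \<rho> k > 0" "filterlim \<rho> at_top sequentially"
  shows "inner_tangent_infinity (orbit_neighbourhood \<phi> z0 \<rho> M)"
proof (rule inner_tangent_infinityI)
  fix \<delta> :: real assume \<delta>: "0 < \<delta>" "\<delta> < pi / 2"
  define x y where "x = (\<lambda>n. Re (orb n))" and "y = (\<lambda>n. Im (orb n))"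
  have y0: "y n > 0" for n using Im_orb_pos by (simp add: y_def)
  have yS: "y (Suc n) \<ge> A * y n" for n
    using Im_phi[OF orb_in_uhp, of n] by (simp add: y_def orb_def)
  have "y n \<ge> A ^ n * y 0" for n
  proof (induction n)
    case (Suc n)
    have "A ^ Suc n * y 0 \<le> A * y n" using Suc A by (simp add: mult.assoc)
    then show ?case using yS[of n] by simp
  qed simp
  then have ytop: "filterlim y at_top sequentially"
    by (intro filterlim_at_top_mono[OF filterlim_power_times_at_top[OF A y0[of 0]]] always_eventually allI)
  have "Bseq (\<lambda>n. y (Suc n) / y n)" "Bseq (\<lambda>n. (x (Suc n) - x n) / y n)"
    using ratio_Im ratio_Re unfolding x_def y_def orb_def
    by (auto intro: convergent_imp_Bseq convergentI)
  then obtain Y B where YB: "\<And>n. norm (y (Suc n) / y n) \<le> Y" "\<And>n. norm ((x (Suc n) - x n) / y n) \<le> B"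
    unfolding Bseq_def by blast
  have Y: "y (Suc n) \<le> Y * y n" for n
    using YB(1)[of n] y0[of n] y0[of "Suc n"] by (simp add: divide_simps)
  have B: "\<bar>x (Suc n) - x n\<bar> \<le> B * y n" for n
    using YB(2)[of n] y0[of n] by (simp add: divide_simps)
  \<comment> \<open>The first term starts the induction; the second makes D + B \<le> D A, which
    carries it from n to n + 1.\<close>
  define D where "D = max (\<bar>x 0\<bar> / y 0) (B / (A - 1))"
  have D: "\<bar>x n\<bar> \<le> D * y n" for n
  proof (induction n)
    case 0
    have "\<bar>x 0\<bar> / y 0 \<le> D" by (simp add: D_def)
    then show ?case using y0[of 0] by (simp add: divide_simps)
  next
    case (Suc n)
    have "D \<ge> 0" unfolding D_def using y0[of 0] by (simp add: le_max_iff_disj)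
    have "B / (A - 1) \<le> D" by (simp add: D_def)
    then have BD: "D + B \<le> D * A" using A by (simp add: field_simps)
    have "\<bar>x (Suc n)\<bar> \<le> D * y n + B * y n" using Suc B[of n] by linarith
    also have "\<dots> \<le> (D * A) * y n"
      using mult_right_mono[OF BD, of "y n"] y0[of n] by (simp add: algebra_simps)
    also have "\<dots> \<le> D * y (Suc n)" using yS[of n] \<open>D \<ge> 0\<close> by (simp add: mult.assoc mult_left_mono)
    finally show ?case .
  qed
  \<comment> \<open>The modulus bound uses |z| < y_{n+1} \<le> Y y_n and |x_n| \<le> D y_n; the
    height bound uses Im z \<ge> sin \<delta> |z|.\<close>
  define K where "K = {v :: complex. cmod v \<le> Y + D \<and> sin \<delta> \<le> Im v}"
  have sin: "sin \<delta> > 0" using \<delta> by (intro sin_gt_zero) auto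
  have "compact K" "K \<subseteq> uhp" unfolding K_def using compact_truncated_halfplane sin
    by (auto simp: uhp_def)
  then obtain C where C: "\<And>v. v \<in> K \<Longrightarrow> hyp_ratio v \<i> \<le> C" using compact_hyp_ratio_bounded by blast
  obtain N where N: "\<And>n z. n \<ge> N \<Longrightarrow> z \<in> uhp \<Longrightarrow> hyp_ratio z (orb n) \<le> C \<Longrightarrow>
      z \<in> orbit_neighbourhood \<phi> z0 \<rho> M"
    using eventually_in_orbit_neighbourhood[OF \<rho>] by blast
  have "z \<in> orbit_neighbourhood \<phi> z0 \<rho> M" if z: "cmod z > y N" "\<delta> < Arg z" "Arg z < pi - \<delta>" for z
  proof -
    have "y N \<le> cmod z" using z(1) by simp
    from exists_bracket[OF ytop this] obtain n where n: "n \<ge> N" "y n \<le> cmod z" "cmod z < y (Suc n)"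
      by blast
    have Im: "sin \<delta> * cmod z \<le> Im z" by (rule Im_ge_of_Arg[OF \<delta> z(2,3)])
    have "sin \<delta> * y n \<le> Im z" using mult_left_mono[OF n(2), of "sin \<delta>"] sin Im by linarith
    then have "Im z > 0" using mult_pos_pos[OF sin y0[of n]] by linarith
    then have zu: "z \<in> uhp" by (simp add: uhp_def)
    have "cmod (z - of_real (x n)) \<le> cmod z + \<bar>x n\<bar>" using norm_triangle_ineq4[of z "of_real (x n)"] by simp
    also have "\<dots> \<le> (Y + D) * y n" using n(3) Y[of n] D[of n] by (simp add: distrib_right)
    finally have "cmod (renorm (orb n) z) \<le> Y + D"
      using y0[of n] by (simp add: renorm_def norm_divide x_def y_def divide_simps)
    moreover have "sin \<delta> \<le> Im (renorm (orb n) z)"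
      using \<open>sin \<delta> * y n \<le> Im z\<close> y0[of n] by (simp add: renorm_def Im_divide_of_real y_def divide_simps)
    ultimately have "renorm (orb n) z \<in> K" by (simp add: K_def)
    then show ?thesis using N[OF n(1) zu] C by (metis hyp_ratio_renorm)
  qed
  then show "\<exists>R. \<forall>z. cmod z > R \<longrightarrow> \<delta> < Arg z \<longrightarrow> Arg z < pi - \<delta> \<longrightarrow>
      z \<in> orbit_neighbourhood \<phi> z0 \<rho> M" by blast
qed

end

text \<open>Translation preserves the height of \<open>v\<close>, so a strip that contains
  \<open>v\<close> eventually absorbs its translates into \<open>V\<close>.\<close>

lemma lateral_tangent_translate:
  assumes "lateral_tangent_plus_infinity V" "v \<in> uhp"
  obtains n where "v + of_nat n \<in> V"
proof -
  define \<delta> where "\<delta> = min (Im v) (1 / Im v) / 2"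
  have v: "Im v > 0" using assms(2) by (simp add: uhp_def)
  then have \<delta>: "\<delta> > 0" "\<delta> < Im v" "\<delta> < 1 / Im v"
    by (auto simp: \<delta>_def min_def field_simps)
  then have "Im v < 1 / \<delta>" using v by (simp add: field_simps)
  obtain t where t: "\<And>z. Re z > t \<Longrightarrow> \<delta> < Im z \<Longrightarrow> Im z < 1 / \<delta> \<Longrightarrow> z \<in> V"
    using lateral_tangent_plus_infinityD[OF assms(1) \<delta>(1)] by blast
  obtain n where "t - Re v < real n" using reals_Archimedean2 by blast
  then have "v + of_nat n \<in> V" using \<delta> \<open>Im v < 1 / \<delta>\<close> by (intro t) auto
  then show ?thesis by (rule that)
qed

subsection \<open>Semiconjugations of a map of non-zero-step type\<close>

text \<open>Here \<open>f\<close> stands for \<sigma> with the normalising automorphism removed, and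
  \<open>affine_map s r\<close> for the standard form of \<tau>. \<open>Im_phi\<close> is the form
  in which Im p > 0 enters.\<close>

locale semiconjugation = renormalised_orbit +
  fixes f :: "complex \<Rightarrow> complex" and s r :: real
  assumes holomorphic_f: "f holomorphic_on uhp" and f_image: "f ` uhp \<subseteq> uhp"
    and f_phi: "\<And>z. z \<in> uhp \<Longrightarrow> f (\<phi> z) = affine_map s r (f z)"
    and std: "standard_affine s r"
    and b_pos: "A = 1 \<Longrightarrow> b > 0"
    and Im_phi: "\<And>z. z \<in> uhp \<Longrightarrow> Im (\<phi> z) \<ge> A * Im z"
begin

text \<open>
  The model map \<open>affine_map A e\<close>, $z \mapsto Az$ or $z \mapsto z + 1$, is $\beta^{-1} \circ \alpha \circ \beta$
  with $\beta$ = \<open>affine_map b1 b0\<close>.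
\<close>

definition e :: real where "e = (if A > 1 then 0 else 1)"
definition b1 :: real where "b1 = (if A > 1 then 1 else b)"
definition b0 :: real where "b0 = (if A > 1 then - b / (A - 1) else 0)"

definition G :: "complex \<Rightarrow> complex" where "G z = affine_inv b1 b0 (g z)"

abbreviation model :: "complex \<Rightarrow> complex" where "model \<equiv> affine_map A e"
abbreviation T :: "complex \<Rightarrow> complex" where "T \<equiv> affine_map s r"

lemma model_scaling: "A > 1 \<Longrightarrow> model = affine_map A 0"
  unfolding e_def by simp

lemma model_translation: "A = 1 \<Longrightarrow> model = affine_map 1 1"
  unfolding e_def by simp

lemma A_pos: "A > 0"
  using A_ge_1 by simp

lemma s_pos: "s > 0"
  using std by (rule standard_affine_pos)

lemma b1_pos: "b1 > 0"
  using b_pos A_ge_1 by (auto simp: b1_def)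

text \<open>For A > 1, \<beta> moves 0 to -b / (A - 1), the fixed point of \<alpha>; for A = 1 it
  rescales the unit translation to translation by b.\<close>

lemma beta_model: "affine_map b1 b0 (model z) = affine_map A b (affine_map b1 b0 z)"
proof (cases "A > 1")
  case True
  then have "complex_of_real (A - 1) \<noteq> 0" by simp
  moreover have "- b / (A - 1) = A * (- b / (A - 1)) + b" using True by (simp add: field_simps)
  then have "complex_of_real (- b / (A - 1)) = of_real A * of_real (- b / (A - 1)) + of_real b"
    by (metis of_real_add of_real_mult)
  ultimately show ?thesis using True
    by (simp add: affine_map_def b1_def b0_def e_def distrib_left del: of_real_minus of_real_divide)
next
  case False
  then have "A = 1" "e = 1" "b1 = b" "b0 = 0" unfolding e_def b1_def b0_def using A_ge_1 by auto
  then show ?thesis by (simp add: affine_map_def algebra_simps)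
qed

lemma beta_model_funpow:
  "affine_map b1 b0 ((model ^^ n) z) = (affine_map A b ^^ n) (affine_map b1 b0 z)"
  by (induction n) (simp_all add: beta_model)

lemma beta_G: "affine_map b1 b0 (G z) = g z"
  unfolding G_def using affine_inv_inverse(2)[OF b1_pos] .

lemma G_in_uhp: "z \<in> uhp \<Longrightarrow> G z \<in> uhp"
  unfolding G_def affine_inv_def using affine_map_in_uhp g_in_uhp b1_pos by simp

lemma G_eq_iff: "G z = G w \<longleftrightarrow> g z = g w"
  by (metis beta_G G_def)

lemma hyp_ratio_G: "hyp_ratio (G z) (G w) = hyp_ratio (g z) (g w)"
  by (metis beta_G hyp_ratio_affine_map b1_pos)

lemma beta_inject: "affine_map b1 b0 z = affine_map b1 b0 w \<longleftrightarrow> z = w"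
  by (metis affine_inv_inverse(1)[OF b1_pos])

lemma G_phi: "z \<in> uhp \<Longrightarrow> G (\<phi> z) = model (G z)"
  using beta_model[of "G z"] g_phi[of z] by (metis beta_G beta_inject)

lemma G_funpow: "z \<in> uhp \<Longrightarrow> G ((\<phi> ^^ n) z) = (model ^^ n) (G z)"
  by (rule semiconj_funpow[of G A e, OF G_phi])

lemma f_funpow: "z \<in> uhp \<Longrightarrow> f ((\<phi> ^^ n) z) = (T ^^ n) (f z)"
  by (rule semiconj_funpow[of f s r, OF f_phi])

lemma eventually_G_covers:
  assumes "compact K" "K \<subseteq> uhp"
  shows "\<exists>C N. \<forall>n\<ge>N. \<forall>w\<in>K. \<exists>z\<in>uhp. hyp_ratio z (orb n) \<le> C \<and> G z = (model ^^ n) w"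
proof -
  have "compact (affine_map b1 b0 ` K)" using assms(1)
    by (intro compact_continuous_image) (auto simp: affine_map_def [abs_def] intro!: continuous_intros)
  moreover have "affine_map b1 b0 ` K \<subseteq> uhp" using assms(2) affine_map_in_uhp b1_pos by blast
  ultimately obtain C N where CN: "\<And>n w. n \<ge> N \<Longrightarrow> w \<in> affine_map b1 b0 ` K \<Longrightarrow>
    \<exists>z\<in>uhp. hyp_ratio z (orb n) \<le> C \<and> g z = (affine_map A b ^^ n) w"
    using eventually_g_covers by metis
  have "\<exists>z\<in>uhp. hyp_ratio z (orb n) \<le> C \<and> G z = (model ^^ n) w" if n: "n \<ge> N" and w: "w \<in> K" for n w
  proof -
    obtain z where "z \<in> uhp" "hyp_ratio z (orb n) \<le> C"
        "affine_map b1 b0 (G z) = affine_map b1 b0 ((model ^^ n) w)"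
      using CN[OF n imageI[OF w]] unfolding beta_G beta_model_funpow by blast
    then show ?thesis by (auto simp: beta_inject)
  qed
  then show ?thesis by blast
qed

text \<open>The factorisation in the coordinate \<beta>; it remains to decide when \<eta> is
  bijective.\<close>

lemma factor_through_G:
  obtains \<eta> where "\<eta> holomorphic_on uhp" "\<eta> ` uhp \<subseteq> uhp" "\<forall>z\<in>uhp. f z = \<eta> (G z)"
    "\<forall>z\<in>uhp. \<eta> (model z) = T (\<eta> z)"
proof -
  obtain h where h: "h holomorphic_on uhp" "h ` uhp \<subseteq> uhp" "\<forall>z\<in>uhp. f z = h (g z)"
    "\<forall>z\<in>uhp. h (affine_map A b z) = T (h z)"
    by (rule semiconj_factor[OF holomorphic_f f_image s_pos f_phi])
  have bu: "affine_map b1 b0 z \<in> uhp" if "z \<in> uhp" for z using affine_map_in_uhp b1_pos that by blast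
  show ?thesis
  proof (rule that[of "h \<circ> affine_map b1 b0"])
    show "h \<circ> affine_map b1 b0 holomorphic_on uhp"
      by (rule holomorphic_on_compose_gen[OF holomorphic_affine_map h(1)]) (use bu in blast)
    show "(h \<circ> affine_map b1 b0) ` uhp \<subseteq> uhp" using bu h(2) by auto
    show "\<forall>z\<in>uhp. f z = (h \<circ> affine_map b1 b0) (G z)" using h(3) by (simp add: beta_G)
    show "\<forall>z\<in>uhp. (h \<circ> affine_map b1 b0) (model z) = T ((h \<circ> affine_map b1 b0) z)"
      using h(4) bu by (simp add: beta_model)
  qed
qed

section \<open>Rigidity of the factor map\<close>

text \<open>Statement (a) for \<open>f\<close>. The two cases share one formula: only the scale
  \<open>c\<close> is free if A > 1, only the shift \<open>d\<close> if A = 1.\<close>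

definition affine_form :: bool where
  "affine_form \<longleftrightarrow> s = A \<and> r = e \<and>
    (\<exists>c d. c > 0 \<and> (A > 1 \<longrightarrow> d = 0) \<and> (A = 1 \<longrightarrow> c = 1) \<and> (\<forall>z\<in>uhp. f z = affine_map c d (G z)))"

text \<open>The common end of all implications towards (a): a bijective \<eta> is an automorphism
  between the two standard forms.\<close>

lemma affine_form_if_bij:
  assumes eta: "\<eta> holomorphic_on uhp" "\<forall>z\<in>uhp. f z = \<eta> (G z)"
    "\<forall>z\<in>uhp. \<eta> (model z) = T (\<eta> z)" and bij: "bij_betw \<eta> uhp uhp"
  shows affine_form
proof -
  have aut: "\<eta> \<in> uhp_aut" using eta(1) bij by (simp add: uhp_aut_def)
  show ?thesis
  proof (cases "A > 1")
    case True
    have semi: "\<eta> (affine_map A 0 z) = T (\<eta> z)" if "z \<in> uhp" for z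
      using bspec[OF eta(3) that] unfolding model_scaling[OF True] .
    note rig = aut_semiconj_scaling[OF aut True std semi]
    obtain c where "c > 0" "\<forall>z\<in>uhp. \<eta> z = affine_map c 0 z" using rig(3) by blast
    then show ?thesis unfolding affine_form_def using True rig(1,2) eta(2) G_in_uhp
      by (simp add: e_def) (intro exI[of _ c], simp)
  next
    case False
    then have A1: "A = 1" using A_ge_1 by simp
    have e1: "e = 1" unfolding e_def using A1 by simp
    have semi: "\<eta> (affine_map 1 1 z) = T (\<eta> z)" if "z \<in> uhp" for z
      using bspec[OF eta(3) that] unfolding model_translation[OF A1] .
    note rig = aut_semiconj_translation[OF aut std semi]
    obtain d where "\<forall>z\<in>uhp. \<eta> z = affine_map 1 d z" using rig(3) by blast
    then show ?thesis unfolding affine_form_def using A1 e1 rig(1,2) eta(2) G_in_uhp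
      by (intro conjI exI[of _ "1::real"] exI[of _ d]) auto
  qed
qed

text \<open>The commutation holds because scalings commute with z -> Az and translations with z -> z
  + 1.\<close>

lemma affine_formE:
  assumes affine_form
  obtains c d where "c > 0" "\<forall>z\<in>uhp. f z = affine_map c d (G z)"
    "\<forall>n z. affine_map c d ((model ^^ n) z) = (model ^^ n) (affine_map c d z)" "s = A" "r = e"
proof -
  obtain c d where cd: "c > 0" "A > 1 \<longrightarrow> d = 0" "A = 1 \<longrightarrow> c = 1"
    "\<forall>z\<in>uhp. f z = affine_map c d (G z)" and sr: "s = A" "r = e"
    using assms unfolding affine_form_def by blast
  have "affine_map c d (model z) = model (affine_map c d z)" for z
    using cd(2,3) A_ge_1 by (auto simp: affine_map_def e_def algebra_simps)
  then have "affine_map c d ((model ^^ n) z) = (model ^^ n) (affine_map c d z)" for n z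
    by (induction n) simp_all
  then show ?thesis using that[OF cd(1,4)] sr by blast
qed

lemma model_funpow_in_uhp: "z \<in> uhp \<Longrightarrow> (model ^^ n) z \<in> uhp"
  using affine_funpow_in_uhp A_pos by blast

lemma T_funpow_in_uhp: "z \<in> uhp \<Longrightarrow> (T ^^ n) z \<in> uhp"
  using affine_funpow_in_uhp s_pos by blast

lemma model_funpow_inject: "(model ^^ n) z = (model ^^ n) w \<longleftrightarrow> z = w"
  by (metis affine_inv_funpow_inverse(1)[OF A_pos])

lemma T_funpow_inject: "(T ^^ n) z = (T ^^ n) w \<longleftrightarrow> z = w"
  by (metis affine_inv_funpow_inverse(1)[OF s_pos])

lemma eta_funpow:
  assumes "\<eta> ` uhp \<subseteq> uhp" "\<forall>z\<in>uhp. \<eta> (model z) = T (\<eta> z)" "z \<in> uhp"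
  shows "\<eta> ((model ^^ n) z) = (T ^^ n) (\<eta> z)"
  by (induction n) (use assms model_funpow_in_uhp in auto)

text \<open>The model map is invertible on the half-plane, so preimages can be pulled back as well
  as pushed forward. To see that \<eta> attains \<open>v\<close> it suffices to attain one T^n
  v.\<close>

lemma eta_image_invariant:
  assumes "\<eta> ` uhp \<subseteq> uhp" "\<forall>z\<in>uhp. \<eta> (model z) = T (\<eta> z)" "v \<in> uhp"
  shows "(T ^^ n) v \<in> \<eta> ` uhp \<longleftrightarrow> v \<in> \<eta> ` uhp"
proof
  assume "(T ^^ n) v \<in> \<eta> ` uhp"
  then obtain z where z: "z \<in> uhp" "(T ^^ n) v = \<eta> z" by blast
  define u where "u = (affine_inv A e ^^ n) z"
  have u: "u \<in> uhp" "z = (model ^^ n) u"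
    unfolding u_def using affine_inv_funpow_in_uhp[OF A_pos z(1)] affine_inv_funpow_inverse(2)[OF A_pos]
    by auto
  have "(T ^^ n) v = (T ^^ n) (\<eta> u)" using z(2) eta_funpow[OF assms(1,2) u(1)] u(2) by simp
  then show "v \<in> \<eta> ` uhp" using u(1) T_funpow_inject by blast
next
  assume "v \<in> \<eta> ` uhp"
  then show "(T ^^ n) v \<in> \<eta> ` uhp"
    using eta_funpow[OF assms(1,2)] model_funpow_in_uhp by (metis (no_types, lifting) imageE imageI)
qed

text \<open>Real affine maps are isometries, so under (a) any pair separated by \<open>g\<close>
  serves. Conversely, equality for one pair is the equality case of Schwarz-Pick for \<eta> at the
  corresponding values of \<open>G\<close>.\<close>

lemma affine_form_iff_isometric:
  "affine_form \<longleftrightarrow> (\<exists>z\<in>uhp. \<exists>w\<in>uhp. hyp_ratio (f z) (f w) = hyp_ratio (g z) (g w) \<and> g z \<noteq> g w)"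
proof
  assume form: affine_form
  obtain c d where cd: "c > 0" "\<forall>z\<in>uhp. f z = affine_map c d (G z)"
    and "\<forall>n z. affine_map c d ((model ^^ n) z) = (model ^^ n) (affine_map c d z)" "s = A" "r = e"
    by (rule affine_formE[OF form])
  obtain z w where zw: "z \<in> uhp" "w \<in> uhp" "g z \<noteq> g w"
    using g_nonconstant unfolding constant_on_def by metis
  then have "hyp_ratio (f z) (f w) = hyp_ratio (g z) (g w)"
    using cd by (simp add: hyp_ratio_affine_map hyp_ratio_G)
  then show "\<exists>z\<in>uhp. \<exists>w\<in>uhp. hyp_ratio (f z) (f w) = hyp_ratio (g z) (g w) \<and> g z \<noteq> g w"
    using zw by blast
next
  assume "\<exists>z\<in>uhp. \<exists>w\<in>uhp. hyp_ratio (f z) (f w) = hyp_ratio (g z) (g w) \<and> g z \<noteq> g w"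
  then obtain z w where zw: "z \<in> uhp" "w \<in> uhp" "hyp_ratio (f z) (f w) = hyp_ratio (G z) (G w)" "G z \<noteq> G w"
    by (auto simp: hyp_ratio_G G_eq_iff)
  obtain \<eta> where eta': "\<eta> holomorphic_on uhp" "\<eta> ` uhp \<subseteq> uhp" "\<forall>z\<in>uhp. f z = \<eta> (G z)"
    "\<forall>z\<in>uhp. \<eta> (model z) = T (\<eta> z)" by (rule factor_through_G)
  note eta = eta'(1,2) bspec[OF eta'(3)] bspec[OF eta'(4)]
  have "bij_betw \<eta> uhp uhp"
    by (rule schwarz_pick_eq_bij[OF eta(1,2) G_in_uhp[OF zw(2)] G_in_uhp[OF zw(1)] zw(4)])
      (use zw(1-3) eta(3) in simp)
  then show affine_form by (rule affine_form_if_bij[OF eta'(1,3,4)])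
qed

text \<open>Canonicity, transported from $(\sigma, \tau)$ to $(f, T)$ by $\tilde\beta$.\<close>

definition orbit_bijective :: bool where
  "orbit_bijective \<longleftrightarrow> (\<forall>v\<in>uhp. \<exists>z\<in>uhp. \<exists>n k. (T ^^ n) (f z) = (T ^^ k) v) \<and>
    (\<forall>z\<in>uhp. \<forall>w\<in>uhp. \<forall>n k. (T ^^ n) (f z) = (T ^^ k) (f w) \<longrightarrow>
      (\<exists>n k. (\<phi> ^^ n) z = (\<phi> ^^ k) w))"

text \<open>Every grand orbit is met because iterates of a given point eventually lie in the image
  of \<open>G\<close>. Points with equal values of \<open>g\<close> merge: by Schwarz-Pick their
  iterates stay within a fixed distance of z_n, where \<open>g\<close> is eventually
  injective.\<close>

lemma orbit_bijective_if_affine_form: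
  assumes affine_form
  shows orbit_bijective
proof -
  obtain c d where c: "c > 0" and f': "\<forall>z\<in>uhp. f z = affine_map c d (G z)"
    and comm': "\<forall>n z. affine_map c d ((model ^^ n) z) = (model ^^ n) (affine_map c d z)"
    and sr: "s = A" "r = e"
    by (rule affine_formE[OF assms])
  note f = bspec[OF f'] and comm = comm'[rule_format]
  have "\<exists>z\<in>uhp. \<exists>n k. (T ^^ n) (f z) = (T ^^ k) v" if v: "v \<in> uhp" for v
  proof -
    define v' where "v' = affine_inv c d v"
    have "v' \<in> uhp" unfolding v'_def affine_inv_def using affine_map_in_uhp c v by simp
    then obtain N where "\<forall>n\<ge>N. \<exists>z\<in>uhp. G z = (model ^^ n) v'"
      using eventually_G_covers[of "{v'}"] by simp blast
    then obtain z where z: "z \<in> uhp" "G z = (model ^^ N) v'" by blast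
    have "f z = (T ^^ N) v"
      unfolding f[OF z(1)] z(2) comm sr unfolding v'_def using affine_inv_inverse(2)[OF c] by simp
    then have "(T ^^ 0) (f z) = (T ^^ N) v" by simp
    then show ?thesis using z(1) by blast
  qed
  moreover have "\<exists>n k. (\<phi> ^^ n) z = (\<phi> ^^ k) w"
    if z: "z \<in> uhp" and w: "w \<in> uhp" and eq: "(T ^^ n) (f z) = (T ^^ k) (f w)" for z w n k
  proof -
    define z' w' where "z' = (\<phi> ^^ n) z" and "w' = (\<phi> ^^ k) w"
    have u: "z' \<in> uhp" "w' \<in> uhp" using z w funpow_phi_in_uhp by (auto simp: z'_def w'_def)
    have "f z' = f w'" using eq f_funpow z w by (simp add: z'_def w'_def)
    then have "affine_inv c d (affine_map c d (G z')) = affine_inv c d (affine_map c d (G w'))"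
      using f u by simp
    then have gz: "g z' = g w'" using G_eq_iff affine_inv_inverse(1)[OF c] by simp
    define C where "C = max (hyp_ratio z' z0) (hyp_ratio w' z0)"
    obtain N where N: "\<And>n. n \<ge> N \<Longrightarrow> inj_on g {z \<in> uhp. hyp_ratio z (orb n) \<le> C}"
      using eventually_inj_on_g by blast
    have "(\<phi> ^^ N) z' = (\<phi> ^^ N) w'"
    proof (rule inj_onD[OF N])
      show "g ((\<phi> ^^ N) z') = g ((\<phi> ^^ N) w')" using gz g_funpow u by simp
      show "(\<phi> ^^ N) z' \<in> {z \<in> uhp. hyp_ratio z (orb N) \<le> C}"
        using funpow_phi_in_uhp[OF u(1)] hyp_ratio_funpow_phi[OF u(1) z0, of N] by (simp add: C_def orb_def)
      show "(\<phi> ^^ N) w' \<in> {z \<in> uhp. hyp_ratio z (orb N) \<le> C}"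
        using funpow_phi_in_uhp[OF u(2)] hyp_ratio_funpow_phi[OF u(2) z0, of N] by (simp add: C_def orb_def)
    qed simp
    then have "(\<phi> ^^ (N + n)) z = (\<phi> ^^ (N + k)) w" by (simp add: z'_def w'_def funpow_add)
    then show ?thesis by blast
  qed
  ultimately show ?thesis unfolding orbit_bijective_def by blast
qed

text \<open>For injectivity of \<eta>, both points are pushed by a model power into the image of
  \<open>G\<close>, where injectivity on grand orbits applies. Surjectivity follows from invariance
  of the image under T.\<close>

lemma affine_form_if_orbit_bijective:
  assumes orbit_bijective
  shows affine_form
proof -
  obtain \<eta> where eta': "\<eta> holomorphic_on uhp" "\<eta> ` uhp \<subseteq> uhp" "\<forall>z\<in>uhp. f z = \<eta> (G z)"
    "\<forall>z\<in>uhp. \<eta> (model z) = T (\<eta> z)" by (rule factor_through_G)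
  note eta = eta'(1,2) bspec[OF eta'(3)] bspec[OF eta'(4)]
  note pow = eta_funpow[OF eta'(2,4)]
  have eu: "\<eta> z \<in> uhp" if "z \<in> uhp" for z using eta(2) that by blast
  have "inj_on \<eta> uhp"
  proof (rule inj_onI)
    fix u v assume u: "u \<in> uhp" and v: "v \<in> uhp" and uv: "\<eta> u = \<eta> v"
    obtain n where "\<forall>m\<ge>n. \<forall>w\<in>{u, v}. \<exists>z\<in>uhp. G z = (model ^^ m) w"
      using eventually_G_covers[of "{u, v}"] u v by simp blast
    then obtain z w where z: "z \<in> uhp" "G z = (model ^^ n) u" and w: "w \<in> uhp" "G w = (model ^^ n) v"
      by blast
    have "f z = f w" using eta(3) z w pow u v uv by simp
    then have "(T ^^ 0) (f z) = (T ^^ 0) (f w)" by simp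
    then obtain j k where "(\<phi> ^^ j) z = (\<phi> ^^ k) w"
      using assms z(1) w(1) unfolding orbit_bijective_def by blast
    then have "(model ^^ j) (G z) = (model ^^ k) (G w)" using G_funpow z(1) w(1) by metis
    then have eq: "(model ^^ (j + n)) u = (model ^^ (k + n)) v" using z(2) w(2) by (simp add: funpow_add)
    \<comment> \<open>The exponents could differ a priori; applying \<eta> turns the relation into
      one at a single point, where equal powers of T have equal exponents.\<close>
    then have "(T ^^ (j + n)) (\<eta> v) = (T ^^ (k + n)) (\<eta> v)" using pow[OF u] pow[OF v] uv by metis
    then have "j + n = k + n" using standard_affine_funpow_inject[OF std eu[OF v]] by blast
    then show "u = v" using eq model_funpow_inject by simp
  qed
  moreover have "v \<in> \<eta> ` uhp" if v: "v \<in> uhp" for v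
  proof -
    obtain z n k where z: "z \<in> uhp" "(T ^^ n) (f z) = (T ^^ k) v"
      using assms v unfolding orbit_bijective_def by blast
    then have "(T ^^ k) v = \<eta> (G ((\<phi> ^^ n) z))"
      using f_funpow[OF z(1)] eta(3) funpow_phi_in_uhp by metis
    then have "(T ^^ k) v \<in> \<eta> ` uhp" using G_in_uhp funpow_phi_in_uhp z(1) by blast
    then show ?thesis using eta_image_invariant[OF eta'(2,4) v] by blast
  qed
  ultimately have "bij_betw \<eta> uhp uhp" using eta(2) by (auto simp: bij_betw_def)
  then show ?thesis by (rule affine_form_if_bij[OF eta'(1,3,4)])
qed

section \<open>Univalence and covering along the orbit\<close>

lemma affine_form_covers:
  assumes affine_form and \<rho>: "\<And>k. \<rho> k > 0" "filterlim \<rho> at_top sequentially"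
    and K: "compact K" "K \<subseteq> uhp"
  obtains N where "\<And>n w. n \<ge> N \<Longrightarrow> w \<in> K \<Longrightarrow> (model ^^ n) w \<in> f ` orbit_neighbourhood \<phi> z0 \<rho> M"
proof -
  obtain c d where c: "c > 0" and f': "\<forall>z\<in>uhp. f z = affine_map c d (G z)"
    and comm': "\<forall>n z. affine_map c d ((model ^^ n) z) = (model ^^ n) (affine_map c d z)"
    and sr: "s = A" "r = e"
    by (rule affine_formE[OF assms(1)])
  note f = bspec[OF f'] and comm = comm'[rule_format]
  have "compact (affine_inv c d ` K)" using K(1)
    using c by (intro compact_continuous_image)
      (auto simp: affine_inv_def affine_map_def [abs_def] intro!: continuous_intros)
  moreover have "affine_inv c d ` K \<subseteq> uhp"
    using K(2) affine_map_in_uhp[of "1 / c"] c unfolding affine_inv_def by auto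
  ultimately obtain C N1 where N1: "\<And>n w. n \<ge> N1 \<Longrightarrow> w \<in> affine_inv c d ` K \<Longrightarrow>
      \<exists>z\<in>uhp. hyp_ratio z (orb n) \<le> C \<and> G z = (model ^^ n) w"
    using eventually_G_covers[of "affine_inv c d ` K"] by blast
  obtain N2 where N2: "\<And>n z. n \<ge> N2 \<Longrightarrow> z \<in> uhp \<Longrightarrow> hyp_ratio z (orb n) \<le> C \<Longrightarrow>
      z \<in> orbit_neighbourhood \<phi> z0 \<rho> M"
    using eventually_in_orbit_neighbourhood[OF \<rho>] by blast
  show ?thesis
  proof (rule that)
    fix n w assume n: "n \<ge> max N1 N2" and w: "w \<in> K"
    then obtain z where z: "z \<in> uhp" "hyp_ratio z (orb n) \<le> C" "G z = (model ^^ n) (affine_inv c d w)"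
      using N1[of n "affine_inv c d w"] by auto
    then have "f z = (model ^^ n) w" using f comm affine_inv_inverse(2)[OF c] by simp
    moreover have "z \<in> orbit_neighbourhood \<phi> z0 \<rho> M" using N2[of n z] n z by simp
    ultimately show "(model ^^ n) w \<in> f ` orbit_neighbourhood \<phi> z0 \<rho> M" by (metis imageI)
  qed
qed

text \<open>Division by A^n brings the part of the sector with A^n \<le> |z| < A^(n+1) into one
  compact set, whose model images are eventually covered.\<close>

lemma inner_tangent_if_affine_form:
  assumes affine_form "\<And>k. \<rho> k > 0" "filterlim \<rho> at_top sequentially" and A: "A > 1"
  shows "inner_tangent_infinity (f ` orbit_neighbourhood \<phi> z0 \<rho> M)"
proof (rule inner_tangent_infinityI)
  fix \<delta> :: real assume \<delta>: "0 < \<delta>" "\<delta> < pi / 2"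
  have sin: "sin \<delta> > 0" using \<delta> by (intro sin_gt_zero) auto
  define K where "K = {v :: complex. cmod v \<le> A \<and> sin \<delta> \<le> Im v}"
  have "compact K" "K \<subseteq> uhp" unfolding K_def using compact_truncated_halfplane sin
    by (auto simp: uhp_def)
  then obtain N where N: "\<And>n w. n \<ge> N \<Longrightarrow> w \<in> K \<Longrightarrow> (model ^^ n) w \<in> f ` orbit_neighbourhood \<phi> z0 \<rho> M"
    using affine_form_covers[OF assms(1-3)] by metis
  have "z \<in> f ` orbit_neighbourhood \<phi> z0 \<rho> M"
    if z: "cmod z > A ^ N * 1" "\<delta> < Arg z" "Arg z < pi - \<delta>" for z
  proof -
    have "A ^ N * 1 \<le> cmod z" using z(1) by simp
    from exists_bracket[OF filterlim_power_times_at_top[OF A zero_less_one] this]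
    obtain n where n: "n \<ge> N" "A ^ n \<le> cmod z" "cmod z < A * A ^ n" by auto
    have An: "A ^ n > 0" using A by simp
    have Im: "sin \<delta> * cmod z \<le> Im z" by (rule Im_ge_of_Arg[OF \<delta> z(2,3)])
    have "sin \<delta> * A ^ n \<le> Im z" using mult_left_mono[OF n(2), of "sin \<delta>"] sin Im by linarith
    define w where "w = z / of_real (A ^ n)"
    have "cmod w \<le> A" using n(3) An A by (simp add: w_def norm_divide norm_power divide_simps)
    moreover have "sin \<delta> \<le> Im w" unfolding w_def Im_divide_of_real
      using \<open>sin \<delta> * A ^ n \<le> Im z\<close> An by (simp add: divide_simps)
    ultimately have "w \<in> K" by (simp add: K_def)
    moreover have "(model ^^ n) w = z"
      unfolding model_scaling[OF A] using An A by (simp add: affine_map_funpow_scaling w_def del: of_real_power)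
    ultimately show ?thesis using N[OF n(1)] by metis
  qed
  then show "\<exists>R. \<forall>z. cmod z > R \<longrightarrow> \<delta> < Arg z \<longrightarrow> Arg z < pi - \<delta> \<longrightarrow>
      z \<in> f ` orbit_neighbourhood \<phi> z0 \<rho> M" by blast
qed

text \<open>Removing the integer part of Re z brings the strip into a compact set; the bound 1 +
  1/\<delta> adds the fractional part and the height.\<close>

lemma lateral_tangent_if_affine_form:
  assumes affine_form "\<And>k. \<rho> k > 0" "filterlim \<rho> at_top sequentially" and A: "A = 1"
  shows "lateral_tangent_plus_infinity (f ` orbit_neighbourhood \<phi> z0 \<rho> M)"
proof (rule lateral_tangent_plus_infinityI)
  fix \<delta> :: real assume \<delta>: "0 < \<delta>"
  define K where "K = {v :: complex. cmod v \<le> 1 + 1 / \<delta> \<and> \<delta> \<le> Im v}"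
  have "compact K" "K \<subseteq> uhp" unfolding K_def using compact_truncated_halfplane \<delta>
    by (auto simp: uhp_def)
  then obtain N where N: "\<And>n w. n \<ge> N \<Longrightarrow> w \<in> K \<Longrightarrow> (model ^^ n) w \<in> f ` orbit_neighbourhood \<phi> z0 \<rho> M"
    using affine_form_covers[OF assms(1-3)] by metis
  have "z \<in> f ` orbit_neighbourhood \<phi> z0 \<rho> M"
    if z: "Re z > real N" "\<delta> < Im z" "Im z < 1 / \<delta>" for z
  proof -
    define n where "n = nat \<lfloor>Re z\<rfloor>"
    have n: "real n \<le> Re z" "Re z < real n + 1" using z(1) by (auto simp: n_def)
    have "n \<ge> N" unfolding n_def using z(1) by linarith
    have "cmod (z - of_nat n) \<le> \<bar>Re z - real n\<bar> + \<bar>Im z\<bar>" using cmod_le[of "z - of_nat n"] by simp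
    then have "z - of_nat n \<in> K" using z n \<delta> by (auto simp: K_def)
    moreover have "(model ^^ n) (z - of_nat n) = z"
      unfolding model_translation[OF A] by (simp add: affine_map_funpow_translation)
    ultimately show ?thesis using N[OF \<open>n \<ge> N\<close>] by metis
  qed
  then show "\<exists>t. \<forall>z. Re z > t \<longrightarrow> \<delta> < Im z \<longrightarrow> Im z < 1 / \<delta> \<longrightarrow>
      z \<in> f ` orbit_neighbourhood \<phi> z0 \<rho> M" by blast
qed

lemma exists_univalence_seq:
  assumes affine_form and \<rho>: "\<And>k. \<rho> k > 0" "incseq \<rho>"
  obtains M :: "nat \<Rightarrow> nat" where "\<And>k. M k > 0" "incseq M" "filterlim M at_top sequentially"
    "inj_on f (orbit_neighbourhood \<phi> z0 \<rho> M)"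
proof -
  obtain c d where c: "c > 0" and f': "\<forall>z\<in>uhp. f z = affine_map c d (G z)"
    and comm': "\<forall>n z. affine_map c d ((model ^^ n) z) = (model ^^ n) (affine_map c d z)"
    and sr: "s = A" "r = e"
    by (rule affine_formE[OF assms(1)])
  note f = bspec[OF f'] and comm = comm'[rule_format]
  define Q where "Q = (\<lambda>k. 4 * (sinh (\<rho> k / 2))\<^sup>2)"
  have Qmono: "Q j \<le> Q k" if "j \<le> k" for j k
  proof -
    have "\<rho> j / 2 \<le> \<rho> k / 2" using \<rho>(2) that by (simp add: incseqD)
    then have "sinh (\<rho> j / 2) \<le> sinh (\<rho> k / 2)" by simp
    moreover have "0 \<le> sinh (\<rho> j / 2)" using \<rho>(1)[of j] by simp
    ultimately show ?thesis unfolding Q_def by (intro mult_left_mono power_mono) auto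
  qed
  have "\<forall>k. \<exists>N. \<forall>n\<ge>N. \<forall>m z w. z \<in> uhp \<longrightarrow> w \<in> uhp \<longrightarrow> hyp_ratio z (orb n) \<le> Q k \<longrightarrow>
      hyp_ratio w (orb m) \<le> Q k \<longrightarrow> g z = g w \<longrightarrow> z = w"
    using eventually_g_separates by blast
  from choice[OF this] obtain N where N: "\<And>k n m z w. n \<ge> N k \<Longrightarrow> z \<in> uhp \<Longrightarrow> w \<in> uhp \<Longrightarrow>
      hyp_ratio z (orb n) \<le> Q k \<Longrightarrow> hyp_ratio w (orb m) \<le> Q k \<Longrightarrow> g z = g w \<Longrightarrow> z = w"
    by blast
  \<comment> \<open>The sum makes \<open>M\<close> monotone and at least \<open>N k\<close>, the
    term \<open>k\<close> makes it diverge, and \<open>Suc\<close> makes it positive.\<close>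
  define M where "M = (\<lambda>k. Suc (k + (\<Sum>j\<le>k. N j)))"
  have NM: "N k \<le> M k" for k
  proof -
    have "N k \<le> (\<Sum>j\<le>k. N j)" by (rule member_le_sum) auto
    then show ?thesis by (simp add: M_def)
  qed
  \<comment> \<open>Only the point with the larger radius needs a late index; the other index
    \<open>m\<close> is arbitrary, and its smaller radius is absorbed by \<open>Q k\<close>.\<close>
  have sep: "z = w" if z: "z \<in> uhp" "n \<ge> M k" "hyp_ratio z (orb n) < Q k"
    and w: "w \<in> uhp" "hyp_ratio w (orb m) < Q j" and "j \<le> k" "g z = g w" for z w n k m j
    using N[of k n z w m] NM[of k] Qmono[OF \<open>j \<le> k\<close>] that by force
  show ?thesis
  proof (rule that[of M])
    show "incseq M" unfolding M_def by (rule incseq_SucI) simp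
    show "filterlim M at_top sequentially"
      by (rule filterlim_at_top_mono[OF filterlim_ident]) (auto simp: M_def intro!: always_eventually)
    show "inj_on f (orbit_neighbourhood \<phi> z0 \<rho> M)"
      unfolding orbit_neighbourhood_eq[OF \<rho>(1)] Q_def[symmetric]
    proof (rule inj_onI)
      fix z w
      assume "z \<in> {z \<in> uhp. \<exists>k n. n \<ge> M k \<and> hyp_ratio z (orb n) < 4 * (sinh (\<rho> k / 2))\<^sup>2}"
        and "w \<in> {z \<in> uhp. \<exists>k n. n \<ge> M k \<and> hyp_ratio z (orb n) < 4 * (sinh (\<rho> k / 2))\<^sup>2}" and eq: "f z = f w"
      then obtain k n j m where z: "z \<in> uhp" "n \<ge> M k" "hyp_ratio z (orb n) < Q k"
        and w: "w \<in> uhp" "m \<ge> M j" "hyp_ratio w (orb m) < Q j" unfolding Q_def by blast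
      have "affine_inv c d (affine_map c d (G z)) = affine_inv c d (affine_map c d (G w))"
        using f z(1) w(1) eq by simp
      then have gz: "g z = g w" using G_eq_iff affine_inv_inverse(1)[OF c] by simp
      show "z = w"
      proof (cases "j \<le> k")
        case True
        then show ?thesis using sep[OF z w(1,3)] gz by blast
      next
        case False
        then show ?thesis using sep[OF w z(1,3)] gz by fastforce
      qed
    qed
  qed (simp add: M_def)
qed

text \<open>Two points with the same value under \<eta> are pushed into a ball about z_n that lies
  inside the orbit neighbourhood, where \<open>f\<close> is injective. Surjectivity combines the
  tangency of the image with its invariance under T.\<close>

lemma affine_form_if_univalent_covering:
  assumes \<rho>: "\<And>k. \<rho> k > 0" "filterlim \<rho> at_top sequentially"
    and inj: "inj_on f (orbit_neighbourhood \<phi> z0 \<rho> M)"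
    and inner: "A > 1 \<Longrightarrow> inner_tangent_infinity (f ` orbit_neighbourhood \<phi> z0 \<rho> M)"
    and lateral: "A = 1 \<Longrightarrow> lateral_tangent_plus_infinity (f ` orbit_neighbourhood \<phi> z0 \<rho> M)"
  shows affine_form
proof -
  define U where "U = orbit_neighbourhood \<phi> z0 \<rho> M"
  obtain \<eta> where eta': "\<eta> holomorphic_on uhp" "\<eta> ` uhp \<subseteq> uhp" "\<forall>z\<in>uhp. f z = \<eta> (G z)"
    "\<forall>z\<in>uhp. \<eta> (model z) = T (\<eta> z)" by (rule factor_through_G)
  note eta = eta'(1,2) bspec[OF eta'(3)] bspec[OF eta'(4)]
  note pow = eta_funpow[OF eta'(2,4)] and inv = eta_image_invariant[OF eta'(2,4)]
  have "U \<subseteq> uhp" unfolding U_def orbit_neighbourhood_eq[OF \<rho>(1)] by blast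
  then have fU: "f ` U \<subseteq> \<eta> ` uhp" using eta(3) G_in_uhp by blast
  have inj_eta: "inj_on \<eta> uhp"
  proof (rule inj_onI)
    fix u v assume u: "u \<in> uhp" and v: "v \<in> uhp" and uv: "\<eta> u = \<eta> v"
    have "compact {u, v}" "{u, v} \<subseteq> uhp" using u v by auto
    from eventually_G_covers[OF this] obtain C N1 where N1: "\<forall>m\<ge>N1. \<forall>w\<in>{u, v}.
        \<exists>z\<in>uhp. hyp_ratio z (orb m) \<le> C \<and> G z = (model ^^ m) w" by blast
    obtain N2 where N2: "\<And>n z. n \<ge> N2 \<Longrightarrow> z \<in> uhp \<Longrightarrow> hyp_ratio z (orb n) \<le> C \<Longrightarrow> z \<in> U"
      using eventually_in_orbit_neighbourhood[OF \<rho>] unfolding U_def by blast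
    define n where "n = max N1 N2"
    obtain z where z: "z \<in> uhp" "hyp_ratio z (orb n) \<le> C" "G z = (model ^^ n) u"
      using N1[rule_format, of n u] by (auto simp: n_def)
    obtain w where w: "w \<in> uhp" "hyp_ratio w (orb n) \<le> C" "G w = (model ^^ n) v"
      using N1[rule_format, of n v] by (auto simp: n_def)
    have "f z = f w" using eta(3) z w pow u v uv by simp
    moreover have "z \<in> U" "w \<in> U" using N2[of n] z w by (auto simp: n_def)
    ultimately have "z = w" using inj unfolding U_def by (auto dest: inj_onD)
    then show "u = v" using z w model_funpow_inject by simp
  qed
  have "v \<in> \<eta> ` uhp" if v: "v \<in> uhp" for v
  proof -
    \<comment> \<open>The second and third cases, of mixed type, are contradictory. A translation by
      -1 is kept here, since \<eta> is still onto; it is excluded afterwards by the rigidity of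
      automorphisms.\<close>
    consider "A > 1" "s > 1" "r = 0" | "A > 1" "s = 1" "\<bar>r\<bar> = 1" | "A = 1" "s > 1" "r = 0"
      | "A = 1" "s = 1" "r = 1" | "A = 1" "s = 1" "r = -1"
      using std A_ge_1 unfolding standard_affine_def by fastforce
    then show ?thesis
    proof cases
      case 1
      \<comment> \<open>Scaling preserves the argument, so the sector needs only to contain the ray
        through \<open>v\<close>.\<close>
      define \<delta> where "\<delta> = min (Arg v) (pi - Arg v) / 2"
      have \<delta>: "\<delta> > 0" "\<delta> < Arg v" "Arg v < pi - \<delta>"
        using Arg_uhp[OF v] by (auto simp: \<delta>_def min_def field_simps)
      obtain R where R: "\<And>z. cmod z > R \<Longrightarrow> \<delta> < Arg z \<Longrightarrow> Arg z < pi - \<delta> \<Longrightarrow> z \<in> f ` U"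
        using inner_tangent_infinityD[OF inner[OF 1(1)] \<delta>(1)] unfolding U_def by blast
      have "v \<noteq> 0" using v by (auto simp: uhp_def)
      obtain n where n: "R / cmod v < s ^ n" using real_arch_pow[OF 1(2)] by blast
      have "s ^ n > 0" using 1(2) by simp
      have "(T ^^ n) v \<in> f ` U" unfolding 1(3) affine_map_funpow_scaling
      proof (rule R)
        show "R < cmod (complex_of_real (s ^ n) * v)"
          using n \<open>v \<noteq> 0\<close> \<open>s ^ n > 0\<close> unfolding norm_mult norm_of_real by (simp add: divide_simps)
      qed (use \<delta> \<open>s ^ n > 0\<close> in \<open>auto simp: Arg_times_of_real simp del: of_real_power\<close>)
      then show ?thesis using fU inv[OF v] by blast
    next
      case 2
      have "pi / 6 > 0" by simp
      then obtain R where R: "\<And>z. cmod z > R \<Longrightarrow> pi / 6 < Arg z \<Longrightarrow> Arg z < pi - pi / 6 \<Longrightarrow> z \<in> f ` U"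
        using inner_tangent_infinityD[OF inner[OF 2(1)]] unfolding U_def by blast
      have "z \<in> \<eta> ` uhp" if z: "Im z > max R 1" for z
      proof -
        \<comment> \<open>A point above max R 1 with |Re| at most 1 lies in the sector of aperture
          pi/6. Translations bring every equally high point there, so the image of \<eta> contains a
          horoball.\<close>
        have near: "w \<in> \<eta> ` uhp" if "Im w = Im z" "\<bar>Re w\<bar> \<le> 1" for w
          using R[of w] Arg_of_abs_Re_less_Im[of w] abs_Im_le_cmod[of w] z that fU by auto
        have zu: "z \<in> uhp" using z by (simp add: uhp_def)
        have trans: "(T ^^ n) w = w + of_real (r * real n)" for n w
          unfolding 2 by (rule affine_map_funpow_translation)
        define n where "n = nat \<lfloor>\<bar>Re z\<bar>\<rfloor>"
        have n: "real n \<le> \<bar>Re z\<bar>" "\<bar>Re z\<bar> < real n + 1" by (auto simp: n_def)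
        show ?thesis
        \<comment> \<open>If T moves \<open>z\<close> towards the imaginary axis, a forward iterate
          of \<open>z\<close> is near it; otherwise \<open>z\<close> is a forward iterate of a point
          near it.\<close>
        proof (cases "Re z * r \<le> 0")
          case True
          have "\<bar>Re z + r * real n\<bar> \<le> 1"
            using 2(3) True n by (auto simp: abs_if split: if_splits)
          then have "(T ^^ n) z \<in> \<eta> ` uhp" unfolding trans by (intro near) auto
          then show ?thesis using inv[OF zu] by blast
        next
          case False
          define w where "w = z - of_real (r * real n)"
          have "w \<in> uhp" using z by (simp add: w_def uhp_def)
          have "\<bar>Re z - r * real n\<bar> \<le> 1"
            using 2(3) False n by (auto simp: abs_if split: if_splits)
          then have "w \<in> \<eta> ` uhp" by (intro near) (auto simp: w_def)
          then have "(T ^^ n) w \<in> \<eta> ` uhp" using inv[OF \<open>w \<in> uhp\<close>] by blast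
          then show ?thesis unfolding trans by (simp add: w_def)
        qed
      qed
      then have horo: "{z. Im z > max R 1} \<subseteq> \<eta> ` uhp" by blast
      have "\<eta> (affine_map A 0 z) = affine_map 1 r (\<eta> z)" if "z \<in> uhp" for z
        using eta(4)[OF that] unfolding model_scaling[OF 2(1)] 2(2) .
      moreover have "0 \<le> max R 1" by simp
      ultimately have False
        using no_inj_semiconj_scaling_translation[OF eta(1) inj_eta 2(1,3) _ horo] by blast
      then show ?thesis ..
    next
      case 3
      have "\<eta> (affine_map 1 1 z) = affine_map s 0 (\<eta> z)" if "z \<in> uhp" for z
        using eta(4)[OF that] unfolding model_translation[OF 3(1)] 3(3) .
      from no_semiconj_translation_scaling[OF eta(1,2) 3(2) this]
      show ?thesis by simp
    next
      case 4
      obtain n where "v + of_nat n \<in> f ` U"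
        using lateral_tangent_translate[OF lateral[OF 4(1)] v] unfolding U_def by blast
      then have "(T ^^ n) v \<in> \<eta> ` uhp" using fU unfolding 4 affine_map_funpow_translation by auto
      then show ?thesis using inv[OF v] by blast
    next
      case 5
      obtain n where "v + of_nat n \<in> f ` U"
        using lateral_tangent_translate[OF lateral[OF 5(1)] v] unfolding U_def by blast
      then have "v + of_nat n \<in> \<eta> ` uhp" using fU by blast
      moreover have "v + of_nat n \<in> uhp" using v by (simp add: uhp_def)
      \<comment> \<open>Here T moves left, so its n-th iterate returns the covered point to
        \<open>v\<close>.\<close>
      ultimately have "(T ^^ n) (v + of_nat n) \<in> \<eta> ` uhp" using inv by blast
      then show ?thesis unfolding 5 affine_map_funpow_translation by simp
    qed
  qed
  then have "bij_betw \<eta> uhp uhp" using eta(2) inj_eta by (auto simp: bij_betw_def)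
  then show ?thesis by (rule affine_form_if_bij[OF eta'(1,3,4)])
qed

end

section \<open>From the stated hypotheses to the renormalised setting\<close>

lemma inv_affine_inv: "s > 0 \<Longrightarrow> inv (affine_inv s r) = affine_map s r"
  by (rule inv_equality) (simp_all add: affine_inv_inverse)

lemma inv_affine_map: "s > 0 \<Longrightarrow> inv (affine_map s r) = affine_inv s r"
  by (rule inv_equality) (simp_all add: affine_inv_inverse)

text \<open>Since \<gamma>_{n+1}^{-1}(i) = z_{n+1}, the second limit of the definition at
  \<open>\<i>\<close> reads \<gamma>_n(z_{n+1}) -> Ai + b; real and imaginary parts give the two
  ratios.\<close>

lemma classical_semiconjugation_renormalised_orbit:
  assumes "self_map \<phi>" and A: "A \<ge> 1" and nzs: "nonzero_step_type A \<phi>" and z0: "z0 \<in> uhp"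
    and cs: "classical_semiconjugation \<phi> z0 g \<alpha>"
    and \<alpha>: "\<And>z. z \<in> uhp \<Longrightarrow> \<alpha> z = of_real A * z + of_real b"
  shows "renormalised_orbit \<phi> g A b z0"
proof
  show hol: "\<phi> holomorphic_on uhp" and img: "\<phi> ` uhp \<subseteq> uhp"
    using assms(1) by (auto simp: self_map_def)
  show "z0 \<in> uhp" "A \<ge> 1" by (rule z0, rule A)
  show "uniform_limit K (\<lambda>n z. renorm ((\<phi> ^^ n) z0) ((\<phi> ^^ n) z)) g sequentially"
    if "compact K" "K \<subseteq> uhp" for K
    by (rule mp[OF spec[OF conjunct1[OF cs[unfolded classical_semiconjugation_def]]] conjI[OF that]])
  define zs where "zs = (\<lambda>n. (\<phi> ^^ n) z0)"
  have zsu: "zs n \<in> uhp" for n unfolding zs_def by (rule funpow_image_uhp[OF img z0])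
  have pos: "Im (zs n) > 0" for n using zsu[of n] by (simp add: uhp_def)
  have "(\<lambda>n. renorm (zs n) (inv (renorm (zs (Suc n))) \<i>)) \<longlonglongrightarrow> of_real A * \<i> + of_real b"
    using bspec[OF conjunct2[OF cs[unfolded classical_semiconjugation_def]] i_in_uhp]
    unfolding zs_def \<alpha>[OF i_in_uhp] .
  moreover have "inv (renorm (zs n)) \<i> = zs n" for n
  proof -
    have "renorm (zs n) = affine_inv (Im (zs n)) (Re (zs n))"
      by (rule renorm_eq_affine_inv) (use pos[of n] in simp)
    then show ?thesis
      by (simp add: inv_affine_inv pos) (simp add: affine_map_def complex_eq_iff)
  qed
  ultimately have lim: "(\<lambda>n. renorm (zs n) (zs (Suc n))) \<longlonglongrightarrow> of_real A * \<i> + of_real b" by simp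
  define p q where "p = (\<lambda>n. Im (zs (Suc n)) / Im (zs n))"
    and "q = (\<lambda>n. (Re (zs (Suc n)) - Re (zs n)) / Im (zs n))"
  have p: "p \<longlonglongrightarrow> A"
    using tendsto_Im[OF lim] by (simp add: p_def renorm_def Im_divide_of_real)
  have q: "q \<longlonglongrightarrow> b"
    using tendsto_Re[OF lim] by (simp add: q_def renorm_def Re_divide_of_real)
  show "(\<lambda>n. Im ((\<phi> ^^ Suc n) z0) / Im ((\<phi> ^^ n) z0)) \<longlonglongrightarrow> A"
    using p unfolding p_def zs_def .
  show "(\<lambda>n. (Re ((\<phi> ^^ Suc n) z0) - Re ((\<phi> ^^ n) z0)) / Im ((\<phi> ^^ n) z0)) \<longlonglongrightarrow> b"
    using q unfolding q_def zs_def .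
  show "A > 1 \<or> b \<noteq> 0"
  proof (rule ccontr)
    assume "\<not> ?thesis"
    then have A1: "A = 1" and b0: "b = 0" using A by auto
    \<comment> \<open>With A = 1 and b = 0 this expression tends to 0, so the hyperbolic step would
      vanish in the limit, against the non-zero-step hypothesis.\<close>
    have ratio: "hyp_ratio (zs n) (zs (Suc n)) = ((q n)\<^sup>2 + (p n - 1)\<^sup>2) / p n" for n
    proof -
      define y y' where "y = Im (zs n)" and "y' = Im (zs (Suc n))"
      have y: "y > 0" "y' > 0" using pos by (auto simp: y_def y'_def)
      have "(cmod (zs n - zs (Suc n)))\<^sup>2 = y\<^sup>2 * ((q n)\<^sup>2 + (p n - 1)\<^sup>2)"
        using y unfolding cmod_power2 q_def p_def y_def[symmetric] y'_def[symmetric]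
        by (simp add: power_divide power2_commute field_simps flip: y_def y'_def)
      then show ?thesis using y unfolding hyp_ratio_def y_def[symmetric] y'_def[symmetric] p_def
        by (simp add: power2_eq_square)
    qed
    have "(\<lambda>n. ((q n)\<^sup>2 + (p n - 1)\<^sup>2) / p n) \<longlonglongrightarrow> (0\<^sup>2 + (1 - 1)\<^sup>2) / 1"
      using p q unfolding A1 b0 by (intro tendsto_intros) auto
    then have "(\<lambda>n. hyp_ratio (zs n) (zs (Suc n))) \<longlonglongrightarrow> 0" by (simp add: ratio)
    then have "(\<lambda>n. 2 * arsinh (sqrt (hyp_ratio (zs n) (zs (Suc n))) / 2)) \<longlonglongrightarrow> 2 * arsinh (sqrt 0 / 2)"
      by (intro tendsto_intros) auto
    then have "(\<lambda>n. hyp_dist (zs n) (zs (Suc n))) \<longlonglongrightarrow> 0"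
      by (simp add: hyp_dist_eq_arsinh[OF zsu zsu])
    then have "step_limit \<phi> z0 = 0" unfolding step_limit_def zs_def by (rule limI)
    then show False using nzs A1 z0 by (auto simp: nonzero_step_type_def)
  qed
qed

text \<open>If b were negative, the real parts would eventually decrease, whereas a sequence tending
  to infinity must at some step rise above its current value.\<close>

lemma (in renormalised_orbit) b_pos_if_at_top:
  assumes "filterlim (\<lambda>n. Re ((\<phi> ^^ n) z0)) at_top sequentially" "A = 1"
  shows "b > 0"
proof (rule ccontr)
  assume "\<not> b > 0"
  then have "b < 0" using nontrivial assms(2) by auto
  then have "eventually (\<lambda>n. (Re (orb (Suc n)) - Re (orb n)) / Im (orb n) < 0) sequentially"
    using order_tendstoD(2)[OF ratio_Re] unfolding orb_def by blast
  then obtain N where N: "\<And>n. n \<ge> N \<Longrightarrow> (Re (orb (Suc n)) - Re (orb n)) / Im (orb n) < 0"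
    unfolding eventually_sequentially by blast
  have decr: "Re (orb (Suc n)) \<le> Re (orb n)" if "n \<ge> N" for n
    using N[OF that] Im_orb_pos[of n] by (simp add: divide_less_0_iff)
  have "filterlim (\<lambda>n. Re (orb n)) at_top sequentially" using assms(1) by (simp add: orb_def)
  then show False
    using exists_bracket[of "\<lambda>n. Re (orb n)" N "Re (orb N)"] decr by force
qed

lemma standard_form_affine_map:
  assumes "standard_form \<tau>"
  obtains s r where "standard_affine s r" "\<forall>z\<in>uhp. \<tau> z = affine_map s r z"
proof -
  consider T where "T > 1" "\<forall>z\<in>uhp. \<tau> z = of_real T * z"
    | "\<forall>z\<in>uhp. \<tau> z = z + 1" | "\<forall>z\<in>uhp. \<tau> z = z - 1"
    using assms unfolding standard_form_def by blast
  then show ?thesis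
  proof cases
    case 1
    then show ?thesis using that[of T 0] by (simp add: standard_affine_def affine_map_def)
  next
    case 2
    then show ?thesis using that[of 1 1] by (simp add: standard_affine_def affine_map_def)
  next
    case 3
    then show ?thesis using that[of 1 "-1"] by (simp add: standard_affine_def affine_map_def)
  qed
qed

lemma affine_map_eq_iff:
  "(\<forall>z\<in>uhp. affine_map s r z = affine_map s' r' z) \<longleftrightarrow> s = s' \<and> r = r'"
proof
  assume "\<forall>z\<in>uhp. affine_map s r z = affine_map s' r' z"
  then have "affine_map s r \<i> = affine_map s' r' \<i>" by simp
  then show "s = s' \<and> r = r'" by (simp add: affine_map_def complex_eq_iff)
qed simp

theorem theorem3p2:
  fixes \<phi> p g \<alpha> \<sigma> \<tau> \<beta>' :: "complex \<Rightarrow> complex"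
    and A b :: real
    and z0 :: complex
  assumes "self_map \<phi>"
    and "\<And>z. z \<in> uhp \<Longrightarrow> \<phi> z = of_real A * z + p z"
    and "A \<ge> 1"
    and "\<And>z. z \<in> uhp \<Longrightarrow> Im (p z) > 0"
    and "nt_lim_infinity (\<lambda>z. p z / z) 0"
    and "nonzero_step_type A \<phi>"
    and "z0 \<in> uhp"
    and "classical_semiconjugation \<phi> z0 g \<alpha>"
    and "\<And>z. z \<in> uhp \<Longrightarrow> \<alpha> z = of_real A * z + of_real b"
    and "A = 1 \<Longrightarrow> filterlim (\<lambda>n. Re ((\<phi> ^^ n) z0)) at_top sequentially"
    and "(\<sigma>, \<tau>) \<in> semiconjugations \<phi>"
    and "\<not> elliptic \<tau>"
    and "\<beta>' \<in> uhp_aut"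
    and "standard_form (inv_into uhp \<beta>' \<circ> \<tau> \<circ> \<beta>')"
  shows
    "let \<beta> = standard_beta A b;
         f = inv_into uhp \<beta>' \<circ> \<sigma>;
         stmt_a =
           ((A > 1 \<longrightarrow>
               (\<forall>z\<in>uhp. inv_into uhp \<beta>' (\<tau> (\<beta>' z)) = of_real A * z) \<and>
               (\<exists>c::real. c > 0 \<and>
                  (\<forall>z\<in>uhp. \<sigma> z = \<beta>' (of_real c * inv \<beta> (g z))))) \<and>
            (A = 1 \<longrightarrow>
               (\<forall>z\<in>uhp. inv_into uhp \<beta>' (\<tau> (\<beta>' z)) = z + 1) \<and>
               (\<exists>d::real. \<forall>z\<in>uhp. \<sigma> z = \<beta>' (inv \<beta> (g z) + of_real d))));
         stmt_b = canonical \<phi> \<sigma> \<tau>;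
         stmt_c =
           (\<exists>(\<rho> :: nat \<Rightarrow> real) (M :: nat \<Rightarrow> nat).
              (\<forall>k. \<rho> k > 0) \<and> incseq \<rho> \<and> filterlim \<rho> at_top sequentially \<and>
              (\<forall>k. M k > 0) \<and> incseq M \<and> filterlim M at_top sequentially \<and>
              (let U = orbit_neighbourhood \<phi> z0 \<rho> M in
                 univalent_on f U \<and>
                 (A > 1 \<longrightarrow> inner_tangent_infinity U \<and> inner_tangent_infinity (f ` U)) \<and>
                 (A = 1 \<longrightarrow> lateral_tangent_plus_infinity (f ` U))));
         stmt_d =
           (\<exists>z\<in>uhp. \<exists>w\<in>uhp.
              hyp_dist (\<sigma> z) (\<sigma> w) = hyp_dist (g z) (g w) \<and> hyp_dist (g z) (g w) \<noteq> 0)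
     in (stmt_a \<longleftrightarrow> stmt_b) \<and> (stmt_b \<longleftrightarrow> stmt_c) \<and> (stmt_c \<longleftrightarrow> stmt_d)"
proof -
  define B where "B = inv_into uhp \<beta>'"
  define f where "f = B \<circ> \<sigma>"
  have aut: "\<beta>' \<in> uhp_aut" "B \<in> uhp_aut"
    unfolding B_def using assms(13) uhp_aut_inverse by auto
  have hol: "\<beta>' holomorphic_on uhp" "B holomorphic_on uhp"
    and bij: "inj_on \<beta>' uhp" "\<beta>' ` uhp = uhp" "B ` uhp = uhp"
    using aut by (auto simp: uhp_aut_def bij_betw_def)
  have B\<beta>: "B (\<beta>' u) = u" if "u \<in> uhp" for u unfolding B_def using bij(1) that by simp
  have \<beta>B: "\<beta>' (B u) = u" if "u \<in> uhp" for u
    unfolding B_def using bij(2) that by (simp add: f_inv_into_f)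
  have \<beta>u: "\<beta>' u \<in> uhp" "B u \<in> uhp" if "u \<in> uhp" for u using bij that by auto
  have sig: "\<sigma> holomorphic_on uhp" "\<sigma> ` uhp \<subseteq> uhp" "\<tau> \<in> uhp_aut"
    and semi: "\<And>z. z \<in> uhp \<Longrightarrow> \<sigma> (\<phi> z) = \<tau> (\<sigma> z)"
    using assms(11) by (auto simp: semiconjugations_def)
  have su: "\<sigma> z \<in> uhp" if "z \<in> uhp" for z using sig(2) that by blast
  have \<tau>u: "\<tau> z \<in> uhp" if "z \<in> uhp" for z using sig(3) that by (auto simp: uhp_aut_def bij_betw_def)
  have fu: "f z \<in> uhp" "\<beta>' (f z) = \<sigma> z" if "z \<in> uhp" for z
    using su[OF that] \<beta>u \<beta>B by (auto simp: f_def)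
  obtain s r where std: "standard_affine s r" and conj: "\<forall>z\<in>uhp. (B \<circ> \<tau> \<circ> \<beta>') z = affine_map s r z"
    using assms(14) unfolding B_def by (rule standard_form_affine_map)
  have \<tau>\<beta>: "\<tau> (\<beta>' u) = \<beta>' (affine_map s r u)" if "u \<in> uhp" for u
    using conj \<beta>B[OF \<tau>u[OF \<beta>u(1)[OF that]]] that by auto
  interpret renormalised_orbit \<phi> g A b z0
    by (rule classical_semiconjugation_renormalised_orbit[OF assms(1,3,6,7,8,9)])
  interpret semiconjugation \<phi> g A b z0 f s r
  proof
    show "f holomorphic_on uhp" unfolding f_def
      by (rule holomorphic_on_compose_gen[OF sig(1) hol(2) sig(2)])
    show "f ` uhp \<subseteq> uhp" using fu by auto
    show "f (\<phi> z) = affine_map s r (f z)" if z: "z \<in> uhp" for z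
    proof -
      have "f (\<phi> z) = B (\<tau> (\<beta>' (f z)))" using semi[OF z] fu(2)[OF z] by (simp add: f_def)
      then show ?thesis using conj fu(1)[OF z] by simp
    qed
    show "standard_affine s r" by (rule std)
    show "b > 0" if "A = 1" using b_pos_if_at_top[OF assms(10)[OF that] that] .
    show "Im (\<phi> z) \<ge> A * Im z" if "z \<in> uhp" for z
      using assms(2,4)[OF that] by simp
  qed
  \<comment> \<open>For A = 1 positivity of \<open>b\<close> turns \<open>\<bar>b\<bar>\<close> into
    the scale \<open>b1\<close>.\<close>
  have beta: "standard_beta A b = affine_map b1 b0"
    using b_pos A_ge_1 by (auto simp: fun_eq_iff standard_beta_def affine_map_def b1_def b0_def)
  have inv_beta: "inv (standard_beta A b) (g z) = G z" for z
    unfolding beta inv_affine_map[OF b1_pos] G_def ..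
  have sig_iff: "\<sigma> z = \<beta>' u \<longleftrightarrow> f z = u" if "z \<in> uhp" "u \<in> uhp" for z u
    using B\<beta>[OF that(2)] fu(2)[OF that(1)] by (auto simp: f_def)
  have conj_iff: "(\<forall>z\<in>uhp. B (\<tau> (\<beta>' z)) = affine_map s' r' z) \<longleftrightarrow> s = s' \<and> r = r'" for s' r'
    using conj affine_map_eq_iff[of s r s' r'] by auto
  have a: "((A > 1 \<longrightarrow>
               (\<forall>z\<in>uhp. B (\<tau> (\<beta>' z)) = of_real A * z) \<and>
               (\<exists>c::real. c > 0 \<and>
                  (\<forall>z\<in>uhp. \<sigma> z = \<beta>' (of_real c * inv (standard_beta A b) (g z))))) \<and>
            (A = 1 \<longrightarrow>
               (\<forall>z\<in>uhp. B (\<tau> (\<beta>' z)) = z + 1) \<and>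
               (\<exists>d::real. \<forall>z\<in>uhp. \<sigma> z = \<beta>' (inv (standard_beta A b) (g z) + of_real d))))
      \<longleftrightarrow> affine_form" (is "?a \<longleftrightarrow> _")
  proof (cases "A > 1")
    case True
    then have e0: "e = 0" unfolding e_def by simp
    have 1: "(\<forall>z\<in>uhp. B (\<tau> (\<beta>' z)) = of_real A * z) \<longleftrightarrow> s = A \<and> r = 0"
      using conj_iff[of A 0] by (simp add: affine_map_def)
    have 2: "(\<forall>z\<in>uhp. \<sigma> z = \<beta>' (of_real c * G z)) \<longleftrightarrow> (\<forall>z\<in>uhp. f z = affine_map c 0 (G z))"
      if "c > 0" for c
      using sig_iff[OF _ affine_map_in_uhp[OF that G_in_uhp], of _ _ 0] by (auto simp: affine_map_def)
    have "?a \<longleftrightarrow> s = A \<and> r = 0 \<and> (\<exists>c>0. \<forall>z\<in>uhp. f z = affine_map c 0 (G z))"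
      unfolding inv_beta 1 using True 2 by auto
    then show ?thesis unfolding affine_form_def e0 using True by auto
  next
    case False
    then have A1: "A = 1" using A_ge_1 by simp
    have e1: "e = 1" unfolding e_def using False by simp
    have 1: "(\<forall>z\<in>uhp. B (\<tau> (\<beta>' z)) = z + 1) \<longleftrightarrow> s = 1 \<and> r = 1"
      using conj_iff[of 1 1] by (simp add: affine_map_def)
    have 2: "(\<forall>z\<in>uhp. \<sigma> z = \<beta>' (G z + of_real d)) \<longleftrightarrow> (\<forall>z\<in>uhp. f z = affine_map 1 d (G z))" for d
      using sig_iff[OF _ affine_map_in_uhp[OF zero_less_one G_in_uhp], of _ _ d] by (auto simp: affine_map_def)
    have "?a \<longleftrightarrow> s = 1 \<and> r = 1 \<and> (\<exists>d. \<forall>z\<in>uhp. f z = affine_map 1 d (G z))"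
      unfolding inv_beta 1 2 using A1 by auto
    also have "\<dots> \<longleftrightarrow> affine_form"
      unfolding affine_form_def e1 using A1 by (auto intro: exI[of _ "1::real"])
    finally show ?thesis .
  qed
  have \<tau>pow: "(\<tau> ^^ n) (\<beta>' u) = \<beta>' ((affine_map s r ^^ n) u)" if "u \<in> uhp" for n u
    by (induction n) (use that \<tau>\<beta> T_funpow_in_uhp in auto)
  \<comment> \<open>Injectivity of the normalising automorphism transfers the grand orbit relation
    of \<tau> to that of its standard form.\<close>
  have go: "(\<sigma> z, \<beta>' v) \<in> same_grand_orbit \<tau> \<longleftrightarrow>
      (\<exists>n k. (affine_map s r ^^ n) (f z) = (affine_map s r ^^ k) v)" if "z \<in> uhp" "v \<in> uhp" for z v
  proof -
    have "(\<tau> ^^ n) (\<sigma> z) = (\<tau> ^^ k) (\<beta>' v) \<longleftrightarrow>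
        (affine_map s r ^^ n) (f z) = (affine_map s r ^^ k) v" for n k
      unfolding fu(2)[OF that(1), symmetric] \<tau>pow[OF fu(1)[OF that(1)]] \<tau>pow[OF that(2)]
      by (rule inj_on_eq_iff[OF bij(1)]) (use that fu T_funpow_in_uhp in auto)
    then show ?thesis using su[OF that(1)] \<beta>u(1)[OF that(2)] by (simp add: same_grand_orbit_def)
  qed
  have b: "canonical \<phi> \<sigma> \<tau> \<longleftrightarrow> affine_form"
  proof -
    have "(\<forall>w\<in>uhp. \<exists>z\<in>uhp. (\<sigma> z, w) \<in> same_grand_orbit \<tau>) \<longleftrightarrow>
        (\<forall>v\<in>uhp. \<exists>z\<in>uhp. (\<sigma> z, \<beta>' v) \<in> same_grand_orbit \<tau>)"
      using bij(2) by (metis imageE imageI)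
    moreover have "(\<sigma> z, \<sigma> w) \<in> same_grand_orbit \<tau> \<longleftrightarrow>
        (\<exists>n k. (affine_map s r ^^ n) (f z) = (affine_map s r ^^ k) (f w))" if "z \<in> uhp" "w \<in> uhp" for z w
      using go[OF that(1) fu(1)[OF that(2)]] fu(2)[OF that(2)] by simp
    moreover have "(z, w) \<in> same_grand_orbit \<phi> \<longleftrightarrow> (\<exists>n k. (\<phi> ^^ n) z = (\<phi> ^^ k) w)"
      if "z \<in> uhp" "w \<in> uhp" for z w
      using that by (simp add: same_grand_orbit_def)
    moreover have "canonical \<phi> \<sigma> \<tau> \<longleftrightarrow>
        (\<forall>w\<in>uhp. \<exists>z\<in>uhp. (\<sigma> z, w) \<in> same_grand_orbit \<tau>) \<and>
        (\<forall>z\<in>uhp. \<forall>w\<in>uhp. (\<sigma> z, \<sigma> w) \<in> same_grand_orbit \<tau> \<longrightarrow> (z, w) \<in> same_grand_orbit \<phi>)"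
      by (rule canonical_iff[OF sig(2) phi_image semi])
    ultimately have "canonical \<phi> \<sigma> \<tau> \<longleftrightarrow> orbit_bijective"
      unfolding orbit_bijective_def using go by simp
    then show ?thesis using orbit_bijective_if_affine_form affine_form_if_orbit_bijective by blast
  qed
  have c: "(\<exists>(\<rho> :: nat \<Rightarrow> real) (M :: nat \<Rightarrow> nat).
              (\<forall>k. \<rho> k > 0) \<and> incseq \<rho> \<and> filterlim \<rho> at_top sequentially \<and>
              (\<forall>k. M k > 0) \<and> incseq M \<and> filterlim M at_top sequentially \<and>
              univalent_on f (orbit_neighbourhood \<phi> z0 \<rho> M) \<and>
              (A > 1 \<longrightarrow> inner_tangent_infinity (orbit_neighbourhood \<phi> z0 \<rho> M) \<and>
                inner_tangent_infinity (f ` orbit_neighbourhood \<phi> z0 \<rho> M)) \<and>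
              (A = 1 \<longrightarrow> lateral_tangent_plus_infinity (f ` orbit_neighbourhood \<phi> z0 \<rho> M)))
      \<longleftrightarrow> affine_form" (is "?c \<longleftrightarrow> _")
  proof
    assume ?c
    then obtain \<rho> M where *: "\<forall>k. \<rho> k > 0" "filterlim \<rho> at_top sequentially"
      "univalent_on f (orbit_neighbourhood \<phi> z0 \<rho> M)"
      "A > 1 \<longrightarrow> inner_tangent_infinity (f ` orbit_neighbourhood \<phi> z0 \<rho> M)"
      "A = 1 \<longrightarrow> lateral_tangent_plus_infinity (f ` orbit_neighbourhood \<phi> z0 \<rho> M)"
      by blast
    show affine_form
      by (rule affine_form_if_univalent_covering[OF _ *(2)]) (use * in \<open>auto simp: univalent_on_def\<close>)
  next
    assume form: affine_form
    \<comment> \<open>A convenient positive, increasing and divergent choice of radii; the start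
      indices are then adapted to it.\<close>
    define \<rho> where "\<rho> = (\<lambda>k. real (Suc k))"
    have \<rho>: "\<And>k. \<rho> k > 0" "incseq \<rho>" "filterlim \<rho> at_top sequentially"
      unfolding \<rho>_def
      by (simp, simp add: incseq_def, rule filterlim_compose[OF filterlim_real_sequentially filterlim_Suc])
    obtain M :: "nat \<Rightarrow> nat" where M: "\<And>k. M k > 0" "incseq M" "filterlim M at_top sequentially"
      "inj_on f (orbit_neighbourhood \<phi> z0 \<rho> M)"
      using exists_univalence_seq[OF form \<rho>(1,2)] by blast
    have "orbit_neighbourhood \<phi> z0 \<rho> M \<subseteq> uhp" unfolding orbit_neighbourhood_eq[OF \<rho>(1)] by blast
    then have "univalent_on f (orbit_neighbourhood \<phi> z0 \<rho> M)"
      unfolding univalent_on_def using M(4) holomorphic_f holomorphic_on_subset by blast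
    then show ?c
      using \<rho> M(1-3) inner_tangent_orbit_neighbourhood[OF _ Im_phi \<rho>(1,3)]
        inner_tangent_if_affine_form[OF form \<rho>(1,3)] lateral_tangent_if_affine_form[OF form \<rho>(1,3)]
      by blast
  qed
  have d: "(\<exists>z\<in>uhp. \<exists>w\<in>uhp.
              hyp_dist (\<sigma> z) (\<sigma> w) = hyp_dist (g z) (g w) \<and> hyp_dist (g z) (g w) \<noteq> 0)
      \<longleftrightarrow> affine_form"
  proof -
    \<comment> \<open>The normalising automorphism is an isometry, so (d) may be tested on
      \<open>f\<close>.\<close>
    have "hyp_ratio (\<sigma> z) (\<sigma> w) = hyp_ratio (f z) (f w)" if "z \<in> uhp" "w \<in> uhp" for z w
      using hyp_ratio_aut[OF aut(1) fu(1)[OF that(1)] fu(1)[OF that(2)]] fu(2) that by simp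
    then show ?thesis unfolding affine_form_iff_isometric
      by (intro bex_cong refl) (simp add: hyp_dist_eq_iff hyp_dist_eq_0_iff su g_in_uhp)
  qed
  show ?thesis
    unfolding Let_def B_def[symmetric] unfolding f_def[symmetric] a b c d by simp
qed

end
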